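(* Let $\mathcal{S}$ be a category with fiber products and final object and $\mathcal{S}_0$ a class of morphisms of $\mathcal{S}$. For a morphism $f:S\to T$ of $\mathcal{S}$ let $\Delta_f:S\to S\times_TS$ be the diagonal. 1. Let $\mathcal{D}\to\mathcal{S}^{\mathrm{cor},0}$ be a proper six-functor-formalism. If $\Delta_f\in\mathcal{S}_0$ then there is a canonical natural transformation $f_!\to f_*$, which is an isomorphism if (moreover) $f\in\mathcal{S}_0$. 2. Let $\mathcal{D}\to\mathcal{S}^{\mathrm{cor},0}$ be an etale six-functor-formalism. If $f\in\mathcal{S}_0$ then there is a canonical natural transformation $f^*\to f^!$, which is an isomorphism if (moreover) $\Delta_f\in\mathcal{S}_0$. In particular, for a Wirthmüller context there is a canonical isomorphism $f^*\cong f^!$ for all morphisms $f$ in $\mathcal{S}$, and for a Grothendieck context there is a canonical isomorphism $f_!\cong f_*$ for all morphisms $f$ in $\mathcal{S}$.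
   Context: **2-multicategories.** A 2-multicategory has objects, categories $\mathrm{Hom}(X_1,\dots,X_n;Y)$ for $n\ge0$ (objects: 1-morphisms; morphisms: 2-morphisms), composition functors $(f,g)\mapsto g\circ_if$ inserting $f$ in the $i$-th slot of $g$, and identities; strictly associative and unital, compositions in different slots commuting. Strict functors preserve everything strictly. For a strict functor $p:\mathcal{D}\to\mathcal{C}$, $\mathrm{Hom}_f$ denotes the category of 1-morphisms over $f$ and 2-morphisms over $\mathrm{id}_f$; the fiber $\mathcal{D}_X$ is the 2-category of objects, unary 1-morphisms and 2-morphisms mapped to $X,\mathrm{id}_X,\mathrm{id}_{\mathrm{id}_X}$. $p$ has 1-categorical fibers if all fibers are equivalent to 1-categories. A strictly commutative square of categories with functors $\mathcal{A}\to\mathcal{B}\xrightarrow{\beta}\mathcal{C}''$, $\mathcal{A}\to\mathcal{C}'\xrightarrow{\gamma}\mathcal{C}''$ is 2-Cartesian if the functor from $\mathcal{A}$ to the category of triples $(b,c,\nu:\beta(b)\xrightarrow{\sim}\gamma(c))$ is an equivalence. A 1-morphism $\xi\in\mathrm{Hom}_f(\mathcal{E}_1,\dots,\mathcal{E}_n;\mathcal{F})$ is coCartesian if for all $m,i$ and objects $\mathcal{F}_1,\dots,\mathcal{F}_m,\mathcal{G}$ with $\mathcal{F}_i=\mathcal{F}$ the square formed by $\circ_i\xi$ (on Hom categories of $\mathcal{D}$ with source $\mathcal{F}_1,\dots,\mathcal{F}_m$ and target $\mathcal{G}$), $\circ_if$ and the functors induced by $p$ is 2-Cartesian; it is Cartesian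 w.r.t. the $i$-th slot if for all objects $\mathcal{G}_1,\dots,\mathcal{G}_m$ the square formed by $\xi\circ_i$ on $\mathrm{Hom}(\mathcal{G}_1,\dots,\mathcal{G}_m;\mathcal{E}_i)$, $f\circ_i$ and the functors induced by $p$ is 2-Cartesian. $p$ is a 1-opfibration (1-fibration) if coCartesian 1-morphisms with given sources (Cartesian 1-morphisms w.r.t. every slot with given target and given other sources) exist over every 1-morphism; a 1-bifibration if both. $p$ is a 2-fibration (2-opfibration) if all functors $\mathrm{Hom}_{\mathcal{D}}(\mathcal{E}_1,\dots,\mathcal{E}_n;\mathcal{F})\to\mathrm{Hom}_{\mathcal{C}}(p\mathcal{E}_1,\dots,p\mathcal{E}_n;p\mathcal{F})$ are fibrations (opfibrations) and composition maps pairs of Cartesian (coCartesian) 2-morphisms to Cartesian (coCartesian) ones. Push-forward along $f$ is the functor sending objects to the target of a coCartesian 1-morphism over $f$; pull-back along a unary $f$ sends an object to the source of a Cartesian 1-morphism over $f$. These are well defined up to canonical isomorphism on 1-categorical fibers. **Correspondences.** Strictly associative fiber products have been chosen in $\mathcal{S}$. $\mathcal{S}^{\mathrm{cor},0}$ is the 2-multicategory with objects those of $\mathcal{S}$; 1-morphisms in $\mathrm{Hom}(S_1,\dots,S_n;T)$ are multicorrespondences $(U;\alpha_1:U\to S_1,\dots,\alpha_n:U\to S_n;\beta:U\to T)$; 2-morphisms $U\Rightarrow U'$ are morphisms $\gamma:U\to U'$ in $\mathcal{S}_0$ with $\alpha_i'\gamma=\alpha_i$, $\beta'\gamma=\beta$;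 composition is by fiber product. The class $\mathcal{S}_0$ is understood to be such that this is a 2-multicategory ($\mathcal{S}_0$ contains isomorphisms and is stable under composition and base change). If $\mathcal{S}_0$ consists of all morphisms, write $\mathcal{S}^{\mathrm{cor},G}$. A *proper* (resp. *etale* ) *six-functor-formalism* is a 1-bifibration $\mathcal{D}\to\mathcal{S}^{\mathrm{cor},0}$ with 1-categorical fibers which is a 2-opfibration (resp. 2-fibration). A *Grothendieck* (resp. *Wirthmüller* ) *context* is a 1-bifibration $\mathcal{D}\to\mathcal{S}^{\mathrm{cor},G}$ with 1-categorical fibers which is a 2-opfibration (resp. 2-fibration). For $f:S\to T$ in $\mathcal{S}$, $f^*$ and $f_*$ denote push-forward and pull-back along the correspondence $f^{\mathrm{op}}=(S;f:S\to T;\mathrm{id}_S)\in\mathrm{Hom}(T;S)$, and $f_!$ and $f^!$ denote push-forward and pull-back along the correspondence $(S;\mathrm{id}_S;f:S\to T)\in\mathrm{Hom}(S;T)$, again denoted $f$; so $f^*\dashv f_*$ and $f_!\dashv f^!$. "Canonical" means: in 1., the transformation is adjoint to the transformation $f^*f_!\to\mathrm{id}$ induced by the 2-morphism $\mathrm{id}_S\Rightarrow f^{\mathrm{op}}\circ f$ given by $\Delta_f$; in 2., it is adjoint to $f_!f^*\to\mathrm{id}$ induced by the 2-morphism $f\circ f^{\mathrm{op}}\Rightarrow\mathrm{id}_T$ given by $f$. *)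

theory Defs
  imports Main "HOL-Library.FuncSet"
begin

section \<open>Categories\<close>

record ('o, 'a) cat =
  Ob :: "'o set"
  Ar :: "'a set"
  Dom :: "'a \<Rightarrow> 'o"
  Cod :: "'a \<Rightarrow> 'o"
  Idt :: "'o \<Rightarrow> 'a"
  Cmp :: "'a \<Rightarrow> 'a \<Rightarrow> 'a"   \<comment> \<open>\<open>Cmp C g f\<close> is \<open>g\<close> after \<open>f\<close>\<close>

locale category =
  fixes C :: "('o, 'a) cat"
  assumes Dom_Ob: "a \<in> Ar C \<Longrightarrow> Dom C a \<in> Ob C"
    and Cod_Ob: "a \<in> Ar C \<Longrightarrow> Cod C a \<in> Ob C"
    and Idt_Ar: "x \<in> Ob C \<Longrightarrow> Idt C x \<in> Ar C"
    and Dom_Idt: "x \<in> Ob C \<Longrightarrow> Dom C (Idt C x) = x"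
    and Cod_Idt: "x \<in> Ob C \<Longrightarrow> Cod C (Idt C x) = x"
    and Cmp_Ar: "\<lbrakk>f \<in> Ar C; g \<in> Ar C; Cod C f = Dom C g\<rbrakk> \<Longrightarrow> Cmp C g f \<in> Ar C"
    and Dom_Cmp: "\<lbrakk>f \<in> Ar C; g \<in> Ar C; Cod C f = Dom C g\<rbrakk> \<Longrightarrow> Dom C (Cmp C g f) = Dom C f"
    and Cod_Cmp: "\<lbrakk>f \<in> Ar C; g \<in> Ar C; Cod C f = Dom C g\<rbrakk> \<Longrightarrow> Cod C (Cmp C g f) = Cod C g"
    and Cmp_Idt: "f \<in> Ar C \<Longrightarrow> Cmp C f (Idt C (Dom C f)) = f"
    and Idt_Cmp: "f \<in> Ar C \<Longrightarrow> Cmp C (Idt C (Cod C f)) f = f"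
    and Cmp_assoc: "\<lbrakk>f \<in> Ar C; g \<in> Ar C; h \<in> Ar C; Cod C f = Dom C g; Cod C g = Dom C h\<rbrakk>
          \<Longrightarrow> Cmp C h (Cmp C g f) = Cmp C (Cmp C h g) f"

definition hom :: "('o, 'a) cat \<Rightarrow> 'o \<Rightarrow> 'o \<Rightarrow> 'a set" where
  "hom C x y = {a \<in> Ar C. Dom C a = x \<and> Cod C a = y}"

definition is_iso :: "('o, 'a) cat \<Rightarrow> 'a \<Rightarrow> bool" where
  "is_iso C u \<longleftrightarrow> u \<in> Ar C \<and>
     (\<exists>v \<in> hom C (Cod C u) (Dom C u). Cmp C v u = Idt C (Dom C u) \<and> Cmp C u v = Idt C (Cod C u))"

definition isomorphic :: "('o, 'a) cat \<Rightarrow> 'o \<Rightarrow> 'o \<Rightarrow> bool" where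
  "isomorphic C x y \<longleftrightarrow> (\<exists>u \<in> hom C x y. is_iso C u)"

definition final_object :: "('o, 'a) cat \<Rightarrow> 'o \<Rightarrow> bool" where
  "final_object C t \<longleftrightarrow> t \<in> Ob C \<and> (\<forall>x \<in> Ob C. \<exists>!a. a \<in> hom C x t)"

definition is_fiber_product :: "('o, 'a) cat \<Rightarrow> 'a \<Rightarrow> 'a \<Rightarrow> 'a \<Rightarrow> 'a \<Rightarrow> bool" where
  "is_fiber_product C f g p q \<longleftrightarrow>
     f \<in> Ar C \<and> g \<in> Ar C \<and> p \<in> Ar C \<and> q \<in> Ar C \<and> Cod C f = Cod C g \<and>
     Dom C p = Dom C q \<and> Cod C p = Dom C f \<and> Cod C q = Dom C g \<and> Cmp C f p = Cmp C g q \<and>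
     (\<forall>u \<in> Ar C. \<forall>v \<in> Ar C.
        Dom C u = Dom C v \<and> Cod C u = Dom C f \<and> Cod C v = Dom C g \<and> Cmp C f u = Cmp C g v \<longrightarrow>
        (\<exists>!w. w \<in> hom C (Dom C u) (Dom C p) \<and> Cmp C p w = u \<and> Cmp C q w = v))"

definition has_fiber_products :: "('o, 'a) cat \<Rightarrow> bool" where
  "has_fiber_products C \<longleftrightarrow>
     (\<forall>f \<in> Ar C. \<forall>g \<in> Ar C. Cod C f = Cod C g \<longrightarrow> (\<exists>p q. is_fiber_product C f g p q))"

record ('o, 'a, 'o2, 'a2) ftor =
  fo :: "'o \<Rightarrow> 'o2"
  fa :: "'a \<Rightarrow> 'a2"

definition is_functor ::
  "('o, 'a) cat \<Rightarrow> ('o2, 'a2) cat \<Rightarrow> ('o, 'a, 'o2, 'a2) ftor \<Rightarrow> bool" where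
  "is_functor A B F \<longleftrightarrow> category A \<and> category B \<and>
     (\<forall>x \<in> Ob A. fo F x \<in> Ob B \<and> fa F (Idt A x) = Idt B (fo F x)) \<and>
     (\<forall>u \<in> Ar A. fa F u \<in> hom B (fo F (Dom A u)) (fo F (Cod A u))) \<and>
     (\<forall>u \<in> Ar A. \<forall>v \<in> Ar A. Cod A u = Dom A v \<longrightarrow> fa F (Cmp A v u) = Cmp B (fa F v) (fa F u))"

definition id_ftor :: "('o, 'a, 'o, 'a) ftor" where
  "id_ftor = \<lparr>fo = id, fa = id\<rparr>"

definition comp_ftor ::
  "('o2, 'a2, 'o3, 'a3) ftor \<Rightarrow> ('o, 'a, 'o2, 'a2) ftor \<Rightarrow> ('o, 'a, 'o3, 'a3) ftor" where
  "comp_ftor G F = \<lparr>fo = fo G \<circ> fo F, fa = fa G \<circ> fa F\<rparr>"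

definition nat_trans ::
  "('o, 'a) cat \<Rightarrow> ('o2, 'a2) cat \<Rightarrow> ('o, 'a, 'o2, 'a2) ftor \<Rightarrow> ('o, 'a, 'o2, 'a2) ftor
     \<Rightarrow> ('o \<Rightarrow> 'a2) \<Rightarrow> bool" where
  "nat_trans A B F G \<tau> \<longleftrightarrow> is_functor A B F \<and> is_functor A B G \<and>
     (\<forall>x \<in> Ob A. \<tau> x \<in> hom B (fo F x) (fo G x)) \<and>
     (\<forall>u \<in> Ar A. Cmp B (\<tau> (Cod A u)) (fa F u) = Cmp B (fa G u) (\<tau> (Dom A u)))"

definition nat_iso ::
  "('o, 'a) cat \<Rightarrow> ('o2, 'a2) cat \<Rightarrow> ('o, 'a, 'o2, 'a2) ftor \<Rightarrow> ('o, 'a, 'o2, 'a2) ftor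
     \<Rightarrow> ('o \<Rightarrow> 'a2) \<Rightarrow> bool" where
  "nat_iso A B F G \<tau> \<longleftrightarrow> nat_trans A B F G \<tau> \<and> (\<forall>x \<in> Ob A. is_iso B (\<tau> x))"

definition equivalence ::
  "('o, 'a) cat \<Rightarrow> ('o2, 'a2) cat \<Rightarrow> ('o, 'a, 'o2, 'a2) ftor \<Rightarrow> bool" where
  "equivalence A B F \<longleftrightarrow> is_functor A B F \<and>
     (\<exists>G \<eta> \<epsilon>. is_functor B A G \<and> nat_iso A A id_ftor (comp_ftor G F) \<eta> \<and>
        nat_iso B B (comp_ftor F G) id_ftor \<epsilon>)"

definition discrete_cat :: "'x set \<Rightarrow> ('x, 'x) cat" where
  "discrete_cat X = \<lparr>Ob = X, Ar = X, Dom = id, Cod = id, Idt = id, Cmp = (\<lambda>v u. u)\<rparr>"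

text \<open>The category of triples \<open>(b, c, \<nu>)\<close> with \<open>\<nu>\<close> an isomorphism from \<open>\<beta> b\<close> to \<open>\<gamma> c\<close>;
  arrows carry their source and target.\<close>

definition iso_comma ::
  "('b, 'u) cat \<Rightarrow> ('c, 'v) cat \<Rightarrow> ('d, 'w) cat \<Rightarrow> ('b, 'u, 'd, 'w) ftor \<Rightarrow> ('c, 'v, 'd, 'w) ftor
     \<Rightarrow> ('b \<times> 'c \<times> 'w, ('b \<times> 'c \<times> 'w) \<times> ('u \<times> 'v) \<times> ('b \<times> 'c \<times> 'w)) cat" where
  "iso_comma B C' C'' \<beta> \<gamma> = (let
     obs = {(b, c, \<nu>). b \<in> Ob B \<and> c \<in> Ob C' \<and> \<nu> \<in> hom C'' (fo \<beta> b) (fo \<gamma> c) \<and> is_iso C'' \<nu>} in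
   \<lparr>Ob = obs,
    Ar = {((b, c, \<nu>), (u, v), (b', c', \<nu>')). (b, c, \<nu>) \<in> obs \<and> (b', c', \<nu>') \<in> obs \<and>
            u \<in> hom B b b' \<and> v \<in> hom C' c c' \<and> Cmp C'' (fa \<gamma> v) \<nu> = Cmp C'' \<nu>' (fa \<beta> u)},
    Dom = (\<lambda>(x, w, y). x),
    Cod = (\<lambda>(x, w, y). y),
    Idt = (\<lambda>(b, c, \<nu>). ((b, c, \<nu>), (Idt B b, Idt C' c), (b, c, \<nu>))),
    Cmp = (\<lambda>(x', (u', v'), y') (x, (u, v), y). (x, (Cmp B u' u, Cmp C' v' v), y'))\<rparr>)"

text \<open>The square \<open>\<beta> \<circ> F = \<gamma> \<circ> G\<close>, where \<open>F\<close> maps \<open>A\<close> to \<open>B\<close> and \<open>G\<close> maps \<open>A\<close> to \<open>C'\<close>.\<close>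

definition comparison ::
  "('a, 'x) cat \<Rightarrow> ('d, 'w) cat \<Rightarrow> ('a, 'x, 'b, 'u) ftor \<Rightarrow> ('a, 'x, 'c, 'v) ftor
     \<Rightarrow> ('b, 'u, 'd, 'w) ftor
     \<Rightarrow> ('a, 'x, 'b \<times> 'c \<times> 'w, ('b \<times> 'c \<times> 'w) \<times> ('u \<times> 'v) \<times> ('b \<times> 'c \<times> 'w)) ftor" where
  "comparison A C'' F G \<beta> = (let ob = (\<lambda>a. (fo F a, fo G a, Idt C'' (fo \<beta> (fo F a)))) in
     \<lparr>fo = ob, fa = (\<lambda>u. (ob (Dom A u), (fa F u, fa G u), ob (Cod A u)))\<rparr>)"

definition two_cartesian ::
  "('a, 'x) cat \<Rightarrow> ('b, 'u) cat \<Rightarrow> ('c, 'v) cat \<Rightarrow> ('d, 'w) cat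
     \<Rightarrow> ('a, 'x, 'b, 'u) ftor \<Rightarrow> ('a, 'x, 'c, 'v) ftor
     \<Rightarrow> ('b, 'u, 'd, 'w) ftor \<Rightarrow> ('c, 'v, 'd, 'w) ftor \<Rightarrow> bool" where
  "two_cartesian A B C' C'' F G \<beta> \<gamma> \<longleftrightarrow>
     equivalence A (iso_comma B C' C'' \<beta> \<gamma>) (comparison A C'' F G \<beta>)"

definition cartesian_arrow ::
  "('o, 'a) cat \<Rightarrow> ('o2, 'a2) cat \<Rightarrow> ('o, 'a, 'o2, 'a2) ftor \<Rightarrow> 'a \<Rightarrow> bool" where
  "cartesian_arrow A B F u \<longleftrightarrow> u \<in> Ar A \<and>
     (\<forall>v \<in> Ar A. \<forall>w \<in> hom B (fo F (Dom A v)) (fo F (Dom A u)).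
        Cod A v = Cod A u \<and> Cmp B (fa F u) w = fa F v \<longrightarrow>
        (\<exists>!v'. v' \<in> hom A (Dom A v) (Dom A u) \<and> fa F v' = w \<and> Cmp A u v' = v))"

definition cocartesian_arrow ::
  "('o, 'a) cat \<Rightarrow> ('o2, 'a2) cat \<Rightarrow> ('o, 'a, 'o2, 'a2) ftor \<Rightarrow> 'a \<Rightarrow> bool" where
  "cocartesian_arrow A B F u \<longleftrightarrow> u \<in> Ar A \<and>
     (\<forall>v \<in> Ar A. \<forall>w \<in> hom B (fo F (Cod A u)) (fo F (Cod A v)).
        Dom A v = Dom A u \<and> Cmp B w (fa F u) = fa F v \<longrightarrow>
        (\<exists>!v'. v' \<in> hom A (Cod A u) (Cod A v) \<and> fa F v' = w \<and> Cmp A v' u = v))"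

definition fibration ::
  "('o, 'a) cat \<Rightarrow> ('o2, 'a2) cat \<Rightarrow> ('o, 'a, 'o2, 'a2) ftor \<Rightarrow> bool" where
  "fibration A B F \<longleftrightarrow> is_functor A B F \<and>
     (\<forall>y \<in> Ob A. \<forall>w \<in> Ar B. Cod B w = fo F y \<longrightarrow>
        (\<exists>u \<in> Ar A. Cod A u = y \<and> fa F u = w \<and> cartesian_arrow A B F u))"

definition opfibration ::
  "('o, 'a) cat \<Rightarrow> ('o2, 'a2) cat \<Rightarrow> ('o, 'a, 'o2, 'a2) ftor \<Rightarrow> bool" where
  "opfibration A B F \<longleftrightarrow> is_functor A B F \<and>
     (\<forall>x \<in> Ob A. \<forall>w \<in> Ar B. Dom B w = fo F x \<longrightarrow>
        (\<exists>u \<in> Ar A. Dom A u = x \<and> fa F u = w \<and> cocartesian_arrow A B F u))"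


section \<open>2-multicategories\<close>

text \<open>Slots are numbered from \<open>0\<close>. \<open>comp1 M g i f\<close> and \<open>comp2 M b i a\<close> insert \<open>f\<close> (resp. \<open>a\<close>)
  in the \<open>i\<close>-th slot of \<open>g\<close> (resp. \<open>b\<close>); \<open>vcmp M b a\<close> is the composition \<open>b\<close> after \<open>a\<close> inside a
  Hom category.\<close>

record ('o, 'f, 't) mcat2 =
  obj :: "'o set"
  mor :: "'f set"
  src :: "'f \<Rightarrow> 'o list"
  tgt :: "'f \<Rightarrow> 'o"
  cell :: "'t set"
  cdom :: "'t \<Rightarrow> 'f"
  ccod :: "'t \<Rightarrow> 'f"
  cidt :: "'f \<Rightarrow> 't"
  vcmp :: "'t \<Rightarrow> 't \<Rightarrow> 't"
  idn :: "'o \<Rightarrow> 'f"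
  comp1 :: "'f \<Rightarrow> nat \<Rightarrow> 'f \<Rightarrow> 'f"
  comp2 :: "'t \<Rightarrow> nat \<Rightarrow> 't \<Rightarrow> 't"

definition Hom :: "('o, 'f, 't) mcat2 \<Rightarrow> 'o list \<Rightarrow> 'o \<Rightarrow> ('f, 't) cat" where
  "Hom M Xs Y = (let obs = {f \<in> mor M. src M f = Xs \<and> tgt M f = Y} in
     \<lparr>Ob = obs, Ar = {a \<in> cell M. cdom M a \<in> obs \<and> ccod M a \<in> obs},
      Dom = cdom M, Cod = ccod M, Idt = cidt M, Cmp = vcmp M\<rparr>)"

definition insert_at :: "nat \<Rightarrow> 'x list \<Rightarrow> 'x list \<Rightarrow> 'x list" where
  "insert_at i ys xs = take i xs @ ys @ drop (Suc i) xs"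

definition composable :: "('o, 'f, 't) mcat2 \<Rightarrow> 'f \<Rightarrow> nat \<Rightarrow> 'f \<Rightarrow> bool" where
  "composable M g i f \<longleftrightarrow> g \<in> mor M \<and> f \<in> mor M \<and> i < length (src M g) \<and> src M g ! i = tgt M f"

definition composable2 :: "('o, 'f, 't) mcat2 \<Rightarrow> 't \<Rightarrow> nat \<Rightarrow> 't \<Rightarrow> bool" where
  "composable2 M b i a \<longleftrightarrow> b \<in> cell M \<and> a \<in> cell M \<and> composable M (cdom M b) i (cdom M a)"

locale two_multicategory =
  fixes M :: "('o, 'f, 't) mcat2"
  assumes src_obj: "f \<in> mor M \<Longrightarrow> set (src M f) \<subseteq> obj M"
    and tgt_obj: "f \<in> mor M \<Longrightarrow> tgt M f \<in> obj M"
    and cell_mor: "a \<in> cell M \<Longrightarrow> cdom M a \<in> mor M \<and> ccod M a \<in> mor M"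
    and cell_parallel: "a \<in> cell M \<Longrightarrow> src M (ccod M a) = src M (cdom M a) \<and> tgt M (ccod M a) = tgt M (cdom M a)"
    and Hom_category: "category (Hom M Xs Y)"
    and idn_mor: "X \<in> obj M \<Longrightarrow> idn M X \<in> mor M \<and> src M (idn M X) = [X] \<and> tgt M (idn M X) = X"
    and comp1_mor: "composable M g i f \<Longrightarrow> comp1 M g i f \<in> mor M \<and>
          src M (comp1 M g i f) = insert_at i (src M f) (src M g) \<and> tgt M (comp1 M g i f) = tgt M g"
    and comp2_cell: "composable2 M b i a \<Longrightarrow> comp2 M b i a \<in> cell M \<and>
          cdom M (comp2 M b i a) = comp1 M (cdom M b) i (cdom M a) \<and>
          ccod M (comp2 M b i a) = comp1 M (ccod M b) i (ccod M a)"
    and comp2_cidt: "composable M g i f \<Longrightarrow>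
          comp2 M (cidt M g) i (cidt M f) = cidt M (comp1 M g i f)"
    and comp2_vcmp: "\<lbrakk>composable2 M b i a; composable2 M b' i a';
            ccod M b = cdom M b'; ccod M a = cdom M a'\<rbrakk> \<Longrightarrow>
          comp2 M (vcmp M b' b) i (vcmp M a' a) = vcmp M (comp2 M b' i a') (comp2 M b i a)"
    and comp1_idn_left: "f \<in> mor M \<Longrightarrow> comp1 M (idn M (tgt M f)) 0 f = f"
    and comp1_idn_right: "\<lbrakk>g \<in> mor M; i < length (src M g)\<rbrakk> \<Longrightarrow>
          comp1 M g i (idn M (src M g ! i)) = g"
    and comp2_idn_left: "a \<in> cell M \<Longrightarrow>
          comp2 M (cidt M (idn M (tgt M (cdom M a)))) 0 a = a"
    and comp2_idn_right: "\<lbrakk>b \<in> cell M; i < length (src M (cdom M b))\<rbrakk> \<Longrightarrow>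
          comp2 M b i (cidt M (idn M (src M (cdom M b) ! i))) = b"
    and comp1_assoc: "\<lbrakk>composable M g i f; composable M f j h\<rbrakk> \<Longrightarrow>
          comp1 M (comp1 M g i f) (i + j) h = comp1 M g i (comp1 M f j h)"
    and comp2_assoc: "\<lbrakk>composable2 M b i a; composable2 M a j c\<rbrakk> \<Longrightarrow>
          comp2 M (comp2 M b i a) (i + j) c = comp2 M b i (comp2 M a j c)"
    and comp1_slots: "\<lbrakk>composable M g i f; composable M g k h; i < k\<rbrakk> \<Longrightarrow>
          comp1 M (comp1 M g i f) (k - 1 + length (src M f)) h = comp1 M (comp1 M g k h) i f"
    and comp2_slots: "\<lbrakk>composable2 M b i a; composable2 M b k c; i < k\<rbrakk> \<Longrightarrow>
          comp2 M (comp2 M b i a) (k - 1 + length (src M (cdom M a))) c = comp2 M (comp2 M b k c) i a"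

record ('o, 'f, 't, 'o2, 'f2, 't2) mfunctor =
  po :: "'o \<Rightarrow> 'o2"
  pm :: "'f \<Rightarrow> 'f2"
  pc :: "'t \<Rightarrow> 't2"

locale strict_functor = D: two_multicategory D + C: two_multicategory C
  for D :: "('o, 'f, 't) mcat2" and C :: "('o2, 'f2, 't2) mcat2" +
  fixes p :: "('o, 'f, 't, 'o2, 'f2, 't2) mfunctor"
  assumes po_obj: "X \<in> obj D \<Longrightarrow> po p X \<in> obj C"
    and pm_mor: "f \<in> mor D \<Longrightarrow> pm p f \<in> mor C \<and>
          src C (pm p f) = map (po p) (src D f) \<and> tgt C (pm p f) = po p (tgt D f)"
    and pc_cell: "a \<in> cell D \<Longrightarrow> pc p a \<in> cell C \<and>
          cdom C (pc p a) = pm p (cdom D a) \<and> ccod C (pc p a) = pm p (ccod D a)"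
    and pc_cidt: "f \<in> mor D \<Longrightarrow> pc p (cidt D f) = cidt C (pm p f)"
    and pc_vcmp: "\<lbrakk>a \<in> cell D; b \<in> cell D; ccod D a = cdom D b\<rbrakk> \<Longrightarrow>
          pc p (vcmp D b a) = vcmp C (pc p b) (pc p a)"
    and pm_idn: "X \<in> obj D \<Longrightarrow> pm p (idn D X) = idn C (po p X)"
    and pm_comp1: "composable D g i f \<Longrightarrow> pm p (comp1 D g i f) = comp1 C (pm p g) i (pm p f)"
    and pc_comp2: "composable2 D b i a \<Longrightarrow> pc p (comp2 D b i a) = comp2 C (pc p b) i (pc p a)"

definition Hom_functor :: "('o, 'f, 't, 'o2, 'f2, 't2) mfunctor \<Rightarrow> ('f, 't, 'f2, 't2) ftor" where
  "Hom_functor p = \<lparr>fo = pm p, fa = pc p\<rparr>"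

text \<open>\<open>g \<mapsto> g \<circ>\<^sub>i f\<close> and \<open>f \<mapsto> g \<circ>\<^sub>i f\<close> as functors between Hom categories.\<close>

definition precomp :: "('o, 'f, 't) mcat2 \<Rightarrow> nat \<Rightarrow> 'f \<Rightarrow> ('f, 't, 'f, 't) ftor" where
  "precomp M i f = \<lparr>fo = (\<lambda>g. comp1 M g i f), fa = (\<lambda>b. comp2 M b i (cidt M f))\<rparr>"

definition postcomp :: "('o, 'f, 't) mcat2 \<Rightarrow> 'f \<Rightarrow> nat \<Rightarrow> ('f, 't, 'f, 't) ftor" where
  "postcomp M g i = \<lparr>fo = (\<lambda>f. comp1 M g i f), fa = (\<lambda>a. comp2 M (cidt M g) i a)\<rparr>"

definition cocartesian1 ::
  "('o, 'f, 't) mcat2 \<Rightarrow> ('o2, 'f2, 't2) mcat2 \<Rightarrow> ('o, 'f, 't, 'o2, 'f2, 't2) mfunctor \<Rightarrow> 'f \<Rightarrow> bool" where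
  "cocartesian1 D C p \<xi> \<longleftrightarrow> \<xi> \<in> mor D \<and>
     (\<forall>Fs i G. set Fs \<subseteq> obj D \<and> G \<in> obj D \<and> i < length Fs \<and> Fs ! i = tgt D \<xi> \<longrightarrow>
        (let Es = insert_at i (src D \<xi>) Fs in
         two_cartesian
           (Hom D Fs G) (Hom D Es G)
           (Hom C (map (po p) Fs) (po p G)) (Hom C (map (po p) Es) (po p G))
           (precomp D i \<xi>) (Hom_functor p)
           (Hom_functor p) (precomp C i (pm p \<xi>))))"

definition cartesian1 ::
  "('o, 'f, 't) mcat2 \<Rightarrow> ('o2, 'f2, 't2) mcat2 \<Rightarrow> ('o, 'f, 't, 'o2, 'f2, 't2) mfunctor \<Rightarrow> nat \<Rightarrow> 'f \<Rightarrow> bool" where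
  "cartesian1 D C p i \<xi> \<longleftrightarrow> \<xi> \<in> mor D \<and> i < length (src D \<xi>) \<and>
     (\<forall>Gs. set Gs \<subseteq> obj D \<longrightarrow>
        (let E = src D \<xi> ! i; F = tgt D \<xi>; Es = insert_at i Gs (src D \<xi>) in
         two_cartesian
           (Hom D Gs E) (Hom D Es F)
           (Hom C (map (po p) Gs) (po p E)) (Hom C (map (po p) Es) (po p F))
           (postcomp D \<xi> i) (Hom_functor p)
           (Hom_functor p) (postcomp C (pm p \<xi>) i)))"

definition one_opfibration ::
  "('o, 'f, 't) mcat2 \<Rightarrow> ('o2, 'f2, 't2) mcat2 \<Rightarrow> ('o, 'f, 't, 'o2, 'f2, 't2) mfunctor \<Rightarrow> bool" where
  "one_opfibration D C p \<longleftrightarrow> strict_functor D C p \<and>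
     (\<forall>f \<in> mor C. \<forall>Es. set Es \<subseteq> obj D \<and> map (po p) Es = src C f \<longrightarrow>
        (\<exists>\<xi>. cocartesian1 D C p \<xi> \<and> pm p \<xi> = f \<and> src D \<xi> = Es))"

definition one_fibration ::
  "('o, 'f, 't) mcat2 \<Rightarrow> ('o2, 'f2, 't2) mcat2 \<Rightarrow> ('o, 'f, 't, 'o2, 'f2, 't2) mfunctor \<Rightarrow> bool" where
  "one_fibration D C p \<longleftrightarrow> strict_functor D C p \<and>
     (\<forall>f \<in> mor C. \<forall>i < length (src C f). \<forall>Es. \<forall>F \<in> obj D.
        length Es = length (src C f) \<and>
        (\<forall>j < length Es. j \<noteq> i \<longrightarrow> Es ! j \<in> obj D \<and> po p (Es ! j) = src C f ! j) \<and>
        po p F = tgt C f \<longrightarrow>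
        (\<exists>\<xi> E. cartesian1 D C p i \<xi> \<and> pm p \<xi> = f \<and> src D \<xi> = Es[i := E] \<and> tgt D \<xi> = F))"

definition one_bifibration ::
  "('o, 'f, 't) mcat2 \<Rightarrow> ('o2, 'f2, 't2) mcat2 \<Rightarrow> ('o, 'f, 't, 'o2, 'f2, 't2) mfunctor \<Rightarrow> bool" where
  "one_bifibration D C p \<longleftrightarrow> one_opfibration D C p \<and> one_fibration D C p"

definition cartesian2 ::
  "('o, 'f, 't) mcat2 \<Rightarrow> ('o2, 'f2, 't2) mcat2 \<Rightarrow> ('o, 'f, 't, 'o2, 'f2, 't2) mfunctor \<Rightarrow> 't \<Rightarrow> bool" where
  "cartesian2 D C p a \<longleftrightarrow> (let Es = src D (cdom D a); F = tgt D (cdom D a) in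
     cartesian_arrow (Hom D Es F) (Hom C (map (po p) Es) (po p F)) (Hom_functor p) a)"

definition cocartesian2 ::
  "('o, 'f, 't) mcat2 \<Rightarrow> ('o2, 'f2, 't2) mcat2 \<Rightarrow> ('o, 'f, 't, 'o2, 'f2, 't2) mfunctor \<Rightarrow> 't \<Rightarrow> bool" where
  "cocartesian2 D C p a \<longleftrightarrow> (let Es = src D (cdom D a); F = tgt D (cdom D a) in
     cocartesian_arrow (Hom D Es F) (Hom C (map (po p) Es) (po p F)) (Hom_functor p) a)"

definition two_fibration ::
  "('o, 'f, 't) mcat2 \<Rightarrow> ('o2, 'f2, 't2) mcat2 \<Rightarrow> ('o, 'f, 't, 'o2, 'f2, 't2) mfunctor \<Rightarrow> bool" where
  "two_fibration D C p \<longleftrightarrow> strict_functor D C p \<and>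
     (\<forall>Es F. set Es \<subseteq> obj D \<and> F \<in> obj D \<longrightarrow>
        fibration (Hom D Es F) (Hom C (map (po p) Es) (po p F)) (Hom_functor p)) \<and>
     (\<forall>b i a. composable2 D b i a \<and> cartesian2 D C p b \<and> cartesian2 D C p a \<longrightarrow>
        cartesian2 D C p (comp2 D b i a))"

definition two_opfibration ::
  "('o, 'f, 't) mcat2 \<Rightarrow> ('o2, 'f2, 't2) mcat2 \<Rightarrow> ('o, 'f, 't, 'o2, 'f2, 't2) mfunctor \<Rightarrow> bool" where
  "two_opfibration D C p \<longleftrightarrow> strict_functor D C p \<and>
     (\<forall>Es F. set Es \<subseteq> obj D \<and> F \<in> obj D \<longrightarrow>
        opfibration (Hom D Es F) (Hom C (map (po p) Es) (po p F)) (Hom_functor p)) \<and>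
     (\<forall>b i a. composable2 D b i a \<and> cocartesian2 D C p b \<and> cocartesian2 D C p a \<longrightarrow>
        cocartesian2 D C p (comp2 D b i a))"


section \<open>Fibers\<close>

text \<open>The category \<open>Hom\<^sub>f(Es; F)\<close>. The Hom categories of the fiber over \<open>X\<close> are those with
  \<open>f = id\<^sub>X\<close> and \<open>Es = [E]\<close>.\<close>

definition Hom_over ::
  "('o, 'f, 't) mcat2 \<Rightarrow> ('o2, 'f2, 't2) mcat2 \<Rightarrow> ('o, 'f, 't, 'o2, 'f2, 't2) mfunctor
     \<Rightarrow> 'f2 \<Rightarrow> 'o list \<Rightarrow> 'o \<Rightarrow> ('f, 't) cat" where
  "Hom_over D C p f Es F = (let obs = {k \<in> mor D. src D k = Es \<and> tgt D k = F \<and> pm p k = f} in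
     \<lparr>Ob = obs, Ar = {a \<in> cell D. cdom D a \<in> obs \<and> ccod D a \<in> obs \<and> pc p a = cidt C f},
      Dom = cdom D, Cod = ccod D, Idt = cidt D, Cmp = vcmp D\<rparr>)"

definition fiber_obj ::
  "('o, 'f, 't) mcat2 \<Rightarrow> ('o, 'f, 't, 'o2, 'f2, 't2) mfunctor \<Rightarrow> 'o2 \<Rightarrow> 'o set" where
  "fiber_obj D p X = {E \<in> obj D. po p E = X}"

text \<open>The fiber over \<open>X\<close> is equivalent to a 1-category \<open>K\<close>, regarded as a 2-category with only
  identity 2-morphisms: there is a 2-functor to \<open>K\<close> that is essentially surjective on objects and
  an equivalence on Hom categories. (A pseudofunctor to such a \<open>K\<close> is strict.) The types of \<open>K\<close> are
  no restriction: if there is any \<open>K\<close>, then there is one on the objects of the fiber with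
  isomorphism classes of 1-morphisms as arrows.\<close>

definition fiber_equivalent_to_1_category ::
  "('o, 'f, 't) mcat2 \<Rightarrow> ('o2, 'f2, 't2) mcat2 \<Rightarrow> ('o, 'f, 't, 'o2, 'f2, 't2) mfunctor \<Rightarrow> 'o2 \<Rightarrow> bool" where
  "fiber_equivalent_to_1_category D C p X \<longleftrightarrow>
     (\<exists>(K :: ('o, 'f set) cat) \<Phi>\<^sub>0 \<Phi>\<^sub>1. category K \<and>
        (\<forall>E \<in> fiber_obj D p X. \<Phi>\<^sub>0 E \<in> Ob K \<and> \<Phi>\<^sub>1 (idn D E) = Idt K (\<Phi>\<^sub>0 E)) \<and>
        (\<forall>E \<in> fiber_obj D p X. \<forall>F \<in> fiber_obj D p X. \<forall>G \<in> fiber_obj D p X.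
           \<forall>k \<in> Ob (Hom_over D C p (idn C X) [E] F). \<forall>l \<in> Ob (Hom_over D C p (idn C X) [F] G).
             \<Phi>\<^sub>1 (comp1 D l 0 k) = Cmp K (\<Phi>\<^sub>1 l) (\<Phi>\<^sub>1 k)) \<and>
        (\<forall>x \<in> Ob K. \<exists>E \<in> fiber_obj D p X. isomorphic K (\<Phi>\<^sub>0 E) x) \<and>
        (\<forall>E \<in> fiber_obj D p X. \<forall>F \<in> fiber_obj D p X.
           equivalence (Hom_over D C p (idn C X) [E] F) (discrete_cat (hom K (\<Phi>\<^sub>0 E) (\<Phi>\<^sub>0 F)))
             \<lparr>fo = \<Phi>\<^sub>1, fa = (\<lambda>a. \<Phi>\<^sub>1 (cdom D a))\<rparr>))"

definition one_categorical_fibers ::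
  "('o, 'f, 't) mcat2 \<Rightarrow> ('o2, 'f2, 't2) mcat2 \<Rightarrow> ('o, 'f, 't, 'o2, 'f2, 't2) mfunctor \<Rightarrow> bool" where
  "one_categorical_fibers D C p \<longleftrightarrow> (\<forall>X \<in> obj C. fiber_equivalent_to_1_category D C p X)"

text \<open>The 1-category represented by a 1-categorical fiber: same objects, and isomorphism classes of
  1-morphisms as arrows.\<close>

definition iso_class ::
  "('o, 'f, 't) mcat2 \<Rightarrow> ('o2, 'f2, 't2) mcat2 \<Rightarrow> ('o, 'f, 't, 'o2, 'f2, 't2) mfunctor \<Rightarrow> 'f \<Rightarrow> 'f set" where
  "iso_class D C p k = {k'. isomorphic (Hom_over D C p (pm p k) (src D k) (tgt D k)) k k'}"

definition fiber ::
  "('o, 'f, 't) mcat2 \<Rightarrow> ('o2, 'f2, 't2) mcat2 \<Rightarrow> ('o, 'f, 't, 'o2, 'f2, 't2) mfunctor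
     \<Rightarrow> 'o2 \<Rightarrow> ('o, 'f set) cat" where
  "fiber D C p X =
     \<lparr>Ob = fiber_obj D p X,
      Ar = {iso_class D C p k | k E F. E \<in> fiber_obj D p X \<and> F \<in> fiber_obj D p X \<and>
              k \<in> Ob (Hom_over D C p (idn C X) [E] F)},
      Dom = (\<lambda>A. hd (src D (SOME k. k \<in> A))),
      Cod = (\<lambda>A. tgt D (SOME k. k \<in> A)),
      Idt = (\<lambda>E. iso_class D C p (idn D E)),
      Cmp = (\<lambda>B A. iso_class D C p (comp1 D (SOME l. l \<in> B) 0 (SOME k. k \<in> A)))\<rparr>"


section \<open>Push-forward and pull-back along unary 1-morphisms\<close>

text \<open>\<open>\<xi> E\<close> is the chosen coCartesian 1-morphism over \<open>f\<close> with source \<open>E\<close>; \<open>\<zeta> F\<close> is the chosen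
  Cartesian 1-morphism over \<open>f\<close> with target \<open>F\<close>.\<close>

definition push_choice ::
  "('o, 'f, 't) mcat2 \<Rightarrow> ('o2, 'f2, 't2) mcat2 \<Rightarrow> ('o, 'f, 't, 'o2, 'f2, 't2) mfunctor
     \<Rightarrow> 'f2 \<Rightarrow> ('o \<Rightarrow> 'f) \<Rightarrow> bool" where
  "push_choice D C p f \<xi> \<longleftrightarrow> (\<forall>E \<in> fiber_obj D p (hd (src C f)).
     cocartesian1 D C p (\<xi> E) \<and> pm p (\<xi> E) = f \<and> src D (\<xi> E) = [E])"

definition pull_choice ::
  "('o, 'f, 't) mcat2 \<Rightarrow> ('o2, 'f2, 't2) mcat2 \<Rightarrow> ('o, 'f, 't, 'o2, 'f2, 't2) mfunctor
     \<Rightarrow> 'f2 \<Rightarrow> ('o \<Rightarrow> 'f) \<Rightarrow> bool" where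
  "pull_choice D C p f \<zeta> \<longleftrightarrow> (\<forall>F \<in> fiber_obj D p (tgt C f).
     cartesian1 D C p 0 (\<zeta> F) \<and> pm p (\<zeta> F) = f \<and> tgt D (\<zeta> F) = F)"

text \<open>On arrows, the push-forward of (the class of) \<open>k : E \<rightarrow> E'\<close> is the class of the
  1-morphism \<open>k'\<close> in the fiber with \<open>k' \<circ> \<xi> E \<cong> \<xi> E' \<circ> k\<close> in \<open>Hom\<^sub>f\<close>; dually for the pull-back.\<close>

definition push ::
  "('o, 'f, 't) mcat2 \<Rightarrow> ('o2, 'f2, 't2) mcat2 \<Rightarrow> ('o, 'f, 't, 'o2, 'f2, 't2) mfunctor
     \<Rightarrow> 'f2 \<Rightarrow> ('o \<Rightarrow> 'f) \<Rightarrow> ('o, 'f set, 'o, 'f set) ftor" where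
  "push D C p f \<xi> =
     \<lparr>fo = (\<lambda>E. tgt D (\<xi> E)),
      fa = (\<lambda>A. let E = Dom (fiber D C p (hd (src C f))) A; E' = Cod (fiber D C p (hd (src C f))) A in
        THE B. B \<in> hom (fiber D C p (tgt C f)) (tgt D (\<xi> E)) (tgt D (\<xi> E')) \<and>
          (\<exists>k \<in> A. \<exists>k' \<in> B. isomorphic (Hom_over D C p f [E] (tgt D (\<xi> E')))
             (comp1 D k' 0 (\<xi> E)) (comp1 D (\<xi> E') 0 k)))\<rparr>"

definition pull ::
  "('o, 'f, 't) mcat2 \<Rightarrow> ('o2, 'f2, 't2) mcat2 \<Rightarrow> ('o, 'f, 't, 'o2, 'f2, 't2) mfunctor
     \<Rightarrow> 'f2 \<Rightarrow> ('o \<Rightarrow> 'f) \<Rightarrow> ('o, 'f set, 'o, 'f set) ftor" where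
  "pull D C p f \<zeta> =
     \<lparr>fo = (\<lambda>F. hd (src D (\<zeta> F))),
      fa = (\<lambda>A. let F = Dom (fiber D C p (tgt C f)) A; F' = Cod (fiber D C p (tgt C f)) A in
        THE B. B \<in> hom (fiber D C p (hd (src C f))) (hd (src D (\<zeta> F))) (hd (src D (\<zeta> F'))) \<and>
          (\<exists>k \<in> A. \<exists>k' \<in> B. isomorphic (Hom_over D C p f [hd (src D (\<zeta> F))] F')
             (comp1 D (\<zeta> F') 0 k') (comp1 D k 0 (\<zeta> F))))\<rparr>"

text \<open>The arrows \<open>a : f\<^sub>\<bullet> E \<rightarrow> F\<close> and \<open>b : E \<rightarrow> f\<^sup>\<bullet> F\<close> correspond to each other under the
  adjunction between push-forward \<open>f\<^sub>\<bullet>\<close> and pull-back \<open>f\<^sup>\<bullet>\<close> along \<open>f\<close>, i.e. under the bijections of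
  both sets of arrows with the isomorphism classes in \<open>Hom\<^sub>f(E; F)\<close>.\<close>

definition adjoint_arrows ::
  "('o, 'f, 't) mcat2 \<Rightarrow> ('o2, 'f2, 't2) mcat2 \<Rightarrow> ('o, 'f, 't, 'o2, 'f2, 't2) mfunctor
     \<Rightarrow> 'f2 \<Rightarrow> ('o \<Rightarrow> 'f) \<Rightarrow> ('o \<Rightarrow> 'f) \<Rightarrow> 'o \<Rightarrow> 'o \<Rightarrow> 'f set \<Rightarrow> 'f set \<Rightarrow> bool" where
  "adjoint_arrows D C p f \<xi> \<zeta> E F a b \<longleftrightarrow>
     a \<in> hom (fiber D C p (tgt C f)) (fo (push D C p f \<xi>) E) F \<and>
     b \<in> hom (fiber D C p (hd (src C f))) E (fo (pull D C p f \<zeta>) F) \<and>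
     (\<exists>k \<in> a. \<exists>l \<in> b. isomorphic (Hom_over D C p f [E] F) (comp1 D k 0 (\<xi> E)) (comp1 D (\<zeta> F) 0 l))"

text \<open>Let \<open>\<gamma>\<close> be a 2-morphism \<open>g \<Rightarrow> h\<close> between unary 1-morphisms, and \<open>\<xi>g : E \<rightarrow> g\<^sub>\<bullet> E\<close> and
  \<open>\<xi>h : E \<rightarrow> h\<^sub>\<bullet> E\<close> coCartesian over \<open>g\<close> and \<open>h\<close>. In a 2-opfibration, \<open>\<gamma>\<close> induces an arrow
  \<open>h\<^sub>\<bullet> E \<rightarrow> g\<^sub>\<bullet> E\<close>, by factoring the target of a coCartesian 2-morphism over \<open>\<gamma>\<close> with source \<open>\<xi>g\<close>
  through \<open>\<xi>h\<close>; in a 2-fibration, it induces an arrow \<open>g\<^sub>\<bullet> E \<rightarrow> h\<^sub>\<bullet> E\<close>, by factoring the source of a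
  Cartesian 2-morphism over \<open>\<gamma>\<close> with target \<open>\<xi>h\<close> through \<open>\<xi>g\<close>.\<close>

definition induced_by_opfibration ::
  "('o, 'f, 't) mcat2 \<Rightarrow> ('o2, 'f2, 't2) mcat2 \<Rightarrow> ('o, 'f, 't, 'o2, 'f2, 't2) mfunctor
     \<Rightarrow> 't2 \<Rightarrow> 'f \<Rightarrow> 'f \<Rightarrow> 'f set \<Rightarrow> bool" where
  "induced_by_opfibration D C p \<gamma> \<xi>g \<xi>h a \<longleftrightarrow>
     a \<in> hom (fiber D C p (tgt C (cdom C \<gamma>))) (tgt D \<xi>h) (tgt D \<xi>g) \<and>
     (\<exists>k \<in> a. \<exists>\<mu>. cocartesian2 D C p \<mu> \<and> pc p \<mu> = \<gamma> \<and> cdom D \<mu> = \<xi>g \<and> ccod D \<mu> = comp1 D k 0 \<xi>h)"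

definition induced_by_fibration ::
  "('o, 'f, 't) mcat2 \<Rightarrow> ('o2, 'f2, 't2) mcat2 \<Rightarrow> ('o, 'f, 't, 'o2, 'f2, 't2) mfunctor
     \<Rightarrow> 't2 \<Rightarrow> 'f \<Rightarrow> 'f \<Rightarrow> 'f set \<Rightarrow> bool" where
  "induced_by_fibration D C p \<gamma> \<xi>g \<xi>h a \<longleftrightarrow>
     a \<in> hom (fiber D C p (tgt C (cdom C \<gamma>))) (tgt D \<xi>g) (tgt D \<xi>h) \<and>
     (\<exists>k \<in> a. \<exists>\<mu>. cartesian2 D C p \<mu> \<and> pc p \<mu> = \<gamma> \<and> cdom D \<mu> = comp1 D k 0 \<xi>g \<and> ccod D \<mu> = \<xi>h)"


section \<open>Multicorrespondences\<close>

text \<open>\<open>(U, [\<alpha>\<^sub>1, \<dots>, \<alpha>\<^sub>n], \<beta>)\<close>; the objects \<open>S\<^sub>i\<close> and \<open>T\<close> are the codomains of the \<open>\<alpha>\<^sub>i\<close>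
  and of \<open>\<beta>\<close>.\<close>

type_synonym ('o, 'm) corr = "'o \<times> 'm list \<times> 'm"

definition is_corr :: "('o, 'm) cat \<Rightarrow> ('o, 'm) corr \<Rightarrow> bool" where
  "is_corr S = (\<lambda>(U, \<alpha>s, \<beta>). U \<in> Ob S \<and> \<beta> \<in> Ar S \<and> Dom S \<beta> = U \<and>
     (\<forall>\<alpha> \<in> set \<alpha>s. \<alpha> \<in> Ar S \<and> Dom S \<alpha> = U))"

text \<open>A choice of fiber products: \<open>pb g i f = (p, q)\<close> consists of the projections of the chosen
  fiber product, used to form \<open>g \<circ>\<^sub>i f\<close>, to the apices of \<open>f\<close> and \<open>g\<close>. The choice is allowed
  to depend on the multicorrespondences \<open>g\<close> and \<open>f\<close> and on the slot, and not only on the two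
  morphisms whose fiber product is taken. For a choice depending on the latter only, compositions
  can be strictly unital and commute strictly in different slots only if any two parallel
  morphisms of \<open>S\<close> are equal: consider \<open>(1; id, id; id)\<close> with \<open>(U; id; U \<rightarrow> 1)\<close> inserted in
  both slots.\<close>

type_synonym ('o, 'm) fp_choice = "('o, 'm) corr \<Rightarrow> nat \<Rightarrow> ('o, 'm) corr \<Rightarrow> 'm \<times> 'm"

definition fiber_product_choice :: "('o, 'm) cat \<Rightarrow> ('o, 'm) fp_choice \<Rightarrow> bool" where
  "fiber_product_choice S pb \<longleftrightarrow>
     (\<forall>V \<alpha>s' \<beta>' i U \<alpha>s \<beta>. is_corr S (V, \<alpha>s', \<beta>') \<and> is_corr S (U, \<alpha>s, \<beta>) \<and>
        i < length \<alpha>s' \<and> Cod S (\<alpha>s' ! i) = Cod S \<beta> \<longrightarrow>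
        (case pb (V, \<alpha>s', \<beta>') i (U, \<alpha>s, \<beta>) of (p, q) \<Rightarrow> is_fiber_product S \<beta> (\<alpha>s' ! i) p q))"

fun corr_comp :: "('o, 'm) cat \<Rightarrow> ('o, 'm) fp_choice
     \<Rightarrow> ('o, 'm) corr \<Rightarrow> nat \<Rightarrow> ('o, 'm) corr \<Rightarrow> ('o, 'm) corr" where
  "corr_comp S pb (V, \<alpha>s', \<beta>') i (U, \<alpha>s, \<beta>) =
     (case pb (V, \<alpha>s', \<beta>') i (U, \<alpha>s, \<beta>) of (p, q) \<Rightarrow>
        (Dom S p,
         insert_at i (map (\<lambda>\<alpha>. Cmp S \<alpha> p) \<alpha>s) (map (\<lambda>\<alpha>. Cmp S \<alpha> q) \<alpha>s'),
         Cmp S \<beta>' q))"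

text \<open>2-morphisms \<open>(c, \<gamma>, c')\<close> carry their source and target.\<close>

type_synonym ('o, 'm) corr_cell = "('o, 'm) corr \<times> 'm \<times> ('o, 'm) corr"

definition is_corr_cell :: "('o, 'm) cat \<Rightarrow> 'm set \<Rightarrow> ('o, 'm) corr_cell \<Rightarrow> bool" where
  "is_corr_cell S S0 = (\<lambda>((U, \<alpha>s, \<beta>), \<gamma>, (U', \<alpha>s', \<beta>')).
     is_corr S (U, \<alpha>s, \<beta>) \<and> is_corr S (U', \<alpha>s', \<beta>') \<and>
     \<gamma> \<in> S0 \<and> \<gamma> \<in> hom S U U' \<and> map (\<lambda>\<alpha>. Cmp S \<alpha> \<gamma>) \<alpha>s' = \<alpha>s \<and> Cmp S \<beta>' \<gamma> = \<beta>)"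

fun corr_comp2 :: "('o, 'm) cat \<Rightarrow> ('o, 'm) fp_choice
     \<Rightarrow> ('o, 'm) corr_cell \<Rightarrow> nat \<Rightarrow> ('o, 'm) corr_cell \<Rightarrow> ('o, 'm) corr_cell" where
  "corr_comp2 S pb (g, \<delta>, g') i (f, \<gamma>, f') =
     (case pb g i f of (p, q) \<Rightarrow> case pb g' i f' of (p', q') \<Rightarrow>
        (corr_comp S pb g i f,
         (THE w. w \<in> hom S (Dom S p) (Dom S p') \<and> Cmp S p' w = Cmp S \<gamma> p \<and> Cmp S q' w = Cmp S \<delta> q),
         corr_comp S pb g' i f'))"

definition cor ::
  "('o, 'm) cat \<Rightarrow> ('o, 'm) fp_choice \<Rightarrow> 'm set \<Rightarrow> ('o, ('o, 'm) corr, ('o, 'm) corr_cell) mcat2" where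
  "cor S pb S0 =
     \<lparr>obj = Ob S,
      mor = {c. is_corr S c},
      src = (\<lambda>(U, \<alpha>s, \<beta>). map (Cod S) \<alpha>s),
      tgt = (\<lambda>(U, \<alpha>s, \<beta>). Cod S \<beta>),
      cell = {a. is_corr_cell S S0 a},
      cdom = (\<lambda>(c, \<gamma>, c'). c),
      ccod = (\<lambda>(c, \<gamma>, c'). c'),
      cidt = (\<lambda>c. (c, Idt S (fst c), c)),
      vcmp = (\<lambda>(c', \<delta>, c'') (c, \<gamma>, d). (c, Cmp S \<delta> \<gamma>, c'')),
      idn = (\<lambda>X. (X, [Idt S X], Idt S X)),
      comp1 = corr_comp S pb,
      comp2 = corr_comp2 S pb\<rparr>"

definition cor_G ::
  "('o, 'm) cat \<Rightarrow> ('o, 'm) fp_choice \<Rightarrow> ('o, ('o, 'm) corr, ('o, 'm) corr_cell) mcat2" where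
  "cor_G S pb = cor S pb (Ar S)"

text \<open>The chosen fiber products are strictly associative, in the sense needed for the
  correspondences to form a (strict) 2-multicategory.\<close>

definition strict_fiber_product_choice :: "('o, 'm) cat \<Rightarrow> ('o, 'm) fp_choice \<Rightarrow> bool" where
  "strict_fiber_product_choice S pb \<longleftrightarrow>
     fiber_product_choice S pb \<and> two_multicategory (cor_G S pb)"

definition admissible_class :: "('o, 'm) cat \<Rightarrow> 'm set \<Rightarrow> bool" where
  "admissible_class S S0 \<longleftrightarrow> S0 \<subseteq> Ar S \<and>
     (\<forall>u. is_iso S u \<longrightarrow> u \<in> S0) \<and>
     (\<forall>u \<in> S0. \<forall>v \<in> S0. Cod S u = Dom S v \<longrightarrow> Cmp S v u \<in> S0) \<and>
     (\<forall>f g p q. is_fiber_product S f g p q \<and> f \<in> S0 \<longrightarrow> q \<in> S0)"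


section \<open>Six-functor-formalisms\<close>

definition proper_six_functor_formalism ::
  "('o, 'm) cat \<Rightarrow> ('o, 'm) fp_choice \<Rightarrow> 'm set \<Rightarrow> ('x, 'f, 't) mcat2
     \<Rightarrow> ('x, 'f, 't, 'o, ('o, 'm) corr, ('o, 'm) corr_cell) mfunctor \<Rightarrow> bool" where
  "proper_six_functor_formalism S pb S0 D p \<longleftrightarrow>
     one_bifibration D (cor S pb S0) p \<and> one_categorical_fibers D (cor S pb S0) p \<and>
     two_opfibration D (cor S pb S0) p"

definition etale_six_functor_formalism ::
  "('o, 'm) cat \<Rightarrow> ('o, 'm) fp_choice \<Rightarrow> 'm set \<Rightarrow> ('x, 'f, 't) mcat2
     \<Rightarrow> ('x, 'f, 't, 'o, ('o, 'm) corr, ('o, 'm) corr_cell) mfunctor \<Rightarrow> bool" where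
  "etale_six_functor_formalism S pb S0 D p \<longleftrightarrow>
     one_bifibration D (cor S pb S0) p \<and> one_categorical_fibers D (cor S pb S0) p \<and>
     two_fibration D (cor S pb S0) p"

definition grothendieck_context ::
  "('o, 'm) cat \<Rightarrow> ('o, 'm) fp_choice \<Rightarrow> ('x, 'f, 't) mcat2
     \<Rightarrow> ('x, 'f, 't, 'o, ('o, 'm) corr, ('o, 'm) corr_cell) mfunctor \<Rightarrow> bool" where
  "grothendieck_context S pb D p \<longleftrightarrow>
     one_bifibration D (cor_G S pb) p \<and> one_categorical_fibers D (cor_G S pb) p \<and>
     two_opfibration D (cor_G S pb) p"

definition wirthmueller_context ::
  "('o, 'm) cat \<Rightarrow> ('o, 'm) fp_choice \<Rightarrow> ('x, 'f, 't) mcat2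
     \<Rightarrow> ('x, 'f, 't, 'o, ('o, 'm) corr, ('o, 'm) corr_cell) mfunctor \<Rightarrow> bool" where
  "wirthmueller_context S pb D p \<longleftrightarrow>
     one_bifibration D (cor_G S pb) p \<and> one_categorical_fibers D (cor_G S pb) p \<and>
     two_fibration D (cor_G S pb) p"

definition corr_of :: "('o, 'm) cat \<Rightarrow> 'm \<Rightarrow> ('o, 'm) corr" where
  "corr_of S f = (Dom S f, [Idt S (Dom S f)], f)"

definition corr_op :: "('o, 'm) cat \<Rightarrow> 'm \<Rightarrow> ('o, 'm) corr" where
  "corr_op S f = (Dom S f, [f], Idt S (Dom S f))"

text \<open>The diagonal of \<open>f\<close>, with target the fiber product chosen for \<open>f\<^sup>o\<^sup>p \<circ> f\<close>, i.e. the apex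
  of this correspondence.\<close>

definition diagonal :: "('o, 'm) cat \<Rightarrow> ('o, 'm) fp_choice \<Rightarrow> 'm \<Rightarrow> 'm" where
  "diagonal S pb f = (case pb (corr_op S f) 0 (corr_of S f) of (p, q) \<Rightarrow>
     THE d. d \<in> hom S (Dom S f) (Dom S p) \<and> Cmp S p d = Idt S (Dom S f) \<and> Cmp S q d = Idt S (Dom S f))"

definition diagonal_cell ::
  "('o, 'm) cat \<Rightarrow> ('o, 'm) fp_choice \<Rightarrow> 'm \<Rightarrow> ('o, 'm) corr_cell" where
  "diagonal_cell S pb f =
     ((Dom S f, [Idt S (Dom S f)], Idt S (Dom S f)), diagonal S pb f,
      corr_comp S pb (corr_op S f) 0 (corr_of S f))"

text \<open>The 2-morphism \<open>f \<circ> f\<^sup>o\<^sup>p \<Rightarrow> id\<^sub>T\<close> given by \<open>f\<close>. The apex of \<open>f \<circ> f\<^sup>o\<^sup>p\<close> is the chosen fiber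
  product of \<open>id\<^sub>S\<close> with itself; it is identified with \<open>S\<close> by means of the projection \<open>q\<close>.\<close>

definition counit_cell ::
  "('o, 'm) cat \<Rightarrow> ('o, 'm) fp_choice \<Rightarrow> 'm \<Rightarrow> ('o, 'm) corr_cell" where
  "counit_cell S pb f = (case pb (corr_of S f) 0 (corr_op S f) of (p, q) \<Rightarrow>
     (corr_comp S pb (corr_of S f) 0 (corr_op S f), Cmp S f q,
      (Cod S f, [Idt S (Cod S f)], Idt S (Cod S f))))"

text \<open>In the following two definitions, \<open>C\<close> is the 2-multicategory of correspondences.
  \<open>cs\<close> and \<open>zs\<close> are choices of coCartesian and Cartesian 1-morphisms over the correspondence \<open>f\<close>
  (defining \<open>f\<^sub>!\<close> and \<open>f\<^sup>!\<close>), while \<open>cu\<close> and \<open>zu\<close> are such choices over \<open>f\<^sup>o\<^sup>p\<close> (defining \<open>f\<^sup>*\<close> and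
  \<open>f\<^sub>*\<close>). The 1-morphism \<open>id\<^sub>E\<close> is coCartesian over \<open>id\<close>, and the composition of the chosen
  coCartesian 1-morphisms, with target \<open>f\<^sup>* f\<^sub>! E\<close> (resp. \<open>f\<^sub>! f\<^sup>* E\<close>), is coCartesian over
  \<open>f\<^sup>o\<^sup>p \<circ> f\<close> (resp. \<open>f \<circ> f\<^sup>o\<^sup>p\<close>).\<close>

definition canonical_shriek_to_star ::
  "('o, 'm) cat \<Rightarrow> ('o, 'm) fp_choice \<Rightarrow> ('o, ('o, 'm) corr, ('o, 'm) corr_cell) mcat2
     \<Rightarrow> ('x, 'f, 't) mcat2 \<Rightarrow> ('x, 'f, 't, 'o, ('o, 'm) corr, ('o, 'm) corr_cell) mfunctor
     \<Rightarrow> 'm \<Rightarrow> ('x \<Rightarrow> 'f) \<Rightarrow> ('x \<Rightarrow> 'f) \<Rightarrow> ('x \<Rightarrow> 'f) \<Rightarrow> ('x \<Rightarrow> 'f set) \<Rightarrow> bool" where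
  "canonical_shriek_to_star S pb C D p f cs cu zu \<tau> \<longleftrightarrow>
     (let D\<^sub>S = fiber D C p (Dom S f); D\<^sub>T = fiber D C p (Cod S f);
          f_shriek = push D C p (corr_of S f) cs;
          f_upper_star = push D C p (corr_op S f) cu;
          f_lower_star = pull D C p (corr_op S f) zu
      in nat_trans D\<^sub>S D\<^sub>T f_shriek f_lower_star \<tau> \<and>
         (\<exists>\<epsilon>. nat_trans D\<^sub>S D\<^sub>S (comp_ftor f_upper_star f_shriek) id_ftor \<epsilon> \<and>
            (\<forall>E \<in> Ob D\<^sub>S.
               induced_by_opfibration D C p (diagonal_cell S pb f)
                 (idn D E) (comp1 D (cu (fo f_shriek E)) 0 (cs E)) (\<epsilon> E) \<and>
               adjoint_arrows D C p (corr_op S f) cu zu (fo f_shriek E) E (\<epsilon> E) (\<tau> E))))"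

definition canonical_star_to_shriek ::
  "('o, 'm) cat \<Rightarrow> ('o, 'm) fp_choice \<Rightarrow> ('o, ('o, 'm) corr, ('o, 'm) corr_cell) mcat2
     \<Rightarrow> ('x, 'f, 't) mcat2 \<Rightarrow> ('x, 'f, 't, 'o, ('o, 'm) corr, ('o, 'm) corr_cell) mfunctor
     \<Rightarrow> 'm \<Rightarrow> ('x \<Rightarrow> 'f) \<Rightarrow> ('x \<Rightarrow> 'f) \<Rightarrow> ('x \<Rightarrow> 'f) \<Rightarrow> ('x \<Rightarrow> 'f set) \<Rightarrow> bool" where
  "canonical_star_to_shriek S pb C D p f cs cu zs \<tau> \<longleftrightarrow>
     (let D\<^sub>S = fiber D C p (Dom S f); D\<^sub>T = fiber D C p (Cod S f);
          f_lower_shriek = push D C p (corr_of S f) cs;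
          f_upper_star = push D C p (corr_op S f) cu;
          f_upper_shriek = pull D C p (corr_of S f) zs
      in nat_trans D\<^sub>T D\<^sub>S f_upper_star f_upper_shriek \<tau> \<and>
         (\<exists>\<epsilon>. nat_trans D\<^sub>T D\<^sub>T (comp_ftor f_lower_shriek f_upper_star) id_ftor \<epsilon> \<and>
            (\<forall>F \<in> Ob D\<^sub>T.
               induced_by_fibration D C p (counit_cell S pb f)
                 (comp1 D (cs (fo f_upper_star F)) 0 (cu F)) (idn D F) (\<epsilon> F) \<and>
               adjoint_arrows D C p (corr_of S f) cs zs (fo f_upper_star F) F (\<epsilon> F) (\<tau> F))))"

end

(*
Both parts are one statement about a 2-opfibration D -> C and 1-morphisms f : X -> Y, g : Y -> X of C
with a 2-morphism delta : id_X => g f.  Isomorphism classes of 1-morphisms over a fixed 1-morphism of C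
are transported along 2-morphisms of C (target of a coCartesian lift), compatibly with composition.
Transporting id_E along delta and factoring the result as zeta l xi, with xi coCartesian over f and
zeta Cartesian over g, gives the component l of f_! -> g^!.  If delta is the unit of an adjunction with
counit gamma : f g => id_Y, then transporting xi zeta along gamma gives an inverse of l, by the triangle
identities.  For correspondences these identities say that the diagonal is a section of both
projections.  The etale case is the proper case after reversing all 2-morphisms, which turns
2-fibrations into 2-opfibrations and exchanges the roles of f and its opposite, of unit and counit.
*)
theory Submission
  imports Defs
begin

section \<open>Isomorphisms, equivalences and coCartesian arrows\<close>

text \<open>Push-forwards, pull-backs and arrows of fibers are determined only up to isomorphism. So
  the relation \<open>\<simeq>\<close>, isomorphism by a 2-morphism over an identity, takes the
  place of equality, and universal properties are used as bijections on
  \<open>\<simeq>\<close>-classes over a fixed 1-morphism of the base. The obstacle is that the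
  comparison functor of a 2-Cartesian square is only essentially surjective: it yields 1-morphisms
  over something isomorphic to the prescribed 1-morphism. They are moved to the right place along
  lifts of isomorphisms, which exist because the functors between Hom categories are fibrations or
  opfibrations. As \<open>\<simeq>\<close> does not see the direction of 2-morphisms, reversal
  leaves fibers, push-forwards and pull-backs literally unchanged; this is what makes the two cases
  one. For correspondences the difficulty is that every composite uses its own chosen fiber product.
  The strict unit and associativity laws, read as equalities of legs, identify exactly those
  projections that occur in the triangle identities.\<close>

context category
begin

lemma hom_Cmp: "\<lbrakk>f \<in> hom C x y; g \<in> hom C y z\<rbrakk> \<Longrightarrow> Cmp C g f \<in> hom C x z"
  by (auto simp: hom_def Cmp_Ar Dom_Cmp Cod_Cmp)

lemma hom_Idt: "x \<in> Ob C \<Longrightarrow> Idt C x \<in> hom C x x"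
  by (auto simp: hom_def Idt_Ar Dom_Idt Cod_Idt)

lemma hom_assoc: "\<lbrakk>f \<in> hom C w x; g \<in> hom C x y; h \<in> hom C y z\<rbrakk>
    \<Longrightarrow> Cmp C (Cmp C h g) f = Cmp C h (Cmp C g f)"
  by (auto simp: hom_def Cmp_assoc)

lemma hom_Cmp_Idt: "f \<in> hom C x y \<Longrightarrow> Cmp C f (Idt C x) = f"
  and hom_Idt_Cmp: "f \<in> hom C x y \<Longrightarrow> Cmp C (Idt C y) f = f"
  by (auto simp: hom_def Cmp_Idt Idt_Cmp)

lemma hom_Ob: "f \<in> hom C x y \<Longrightarrow> x \<in> Ob C \<and> y \<in> Ob C"
  by (auto simp: hom_def Dom_Ob Cod_Ob)

lemma is_iso_iff: "u \<in> hom C x y \<Longrightarrow>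
    is_iso C u \<longleftrightarrow> (\<exists>v \<in> hom C y x. Cmp C v u = Idt C x \<and> Cmp C u v = Idt C y)"
  by (auto simp: is_iso_def hom_def)

lemma is_iso_Idt: "x \<in> Ob C \<Longrightarrow> is_iso C (Idt C x)"
  using is_iso_iff[OF hom_Idt] hom_Idt hom_Cmp_Idt by blast

lemma iso_inverse:
  assumes "u \<in> hom C x y" "is_iso C u"
  obtains v where "v \<in> hom C y x" "is_iso C v" "Cmp C v u = Idt C x" "Cmp C u v = Idt C y"
  using assms is_iso_iff by metis

lemma is_iso_Cmp:
  assumes u: "u \<in> hom C x y" "is_iso C u" and v: "v \<in> hom C y z" "is_iso C v"
  shows "is_iso C (Cmp C v u)"
proof -
  obtain u' where u': "u' \<in> hom C y x" "Cmp C u' u = Idt C x" "Cmp C u u' = Idt C y"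
    using u iso_inverse by metis
  obtain v' where v': "v' \<in> hom C z y" "Cmp C v' v = Idt C y" "Cmp C v v' = Idt C z"
    using v iso_inverse by metis
  have "Cmp C (Cmp C u' v') (Cmp C v u) = Cmp C u' (Cmp C (Cmp C v' v) u)"
    using hom_assoc[OF hom_Cmp[OF u(1) v(1)] v'(1) u'(1)] hom_assoc[OF u(1) v(1) v'(1)] by simp
  also have "\<dots> = Idt C x"
    using u u' v' by (simp add: hom_Idt_Cmp)
  finally have 1: "Cmp C (Cmp C u' v') (Cmp C v u) = Idt C x" .
  have "Cmp C (Cmp C v u) (Cmp C u' v') = Cmp C v (Cmp C (Cmp C u u') v')"
    using hom_assoc[OF hom_Cmp[OF v'(1) u'(1)] u(1) v(1)] hom_assoc[OF v'(1) u'(1) u(1)] by simp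
  also have "\<dots> = Idt C z"
    using v u' v' by (simp add: hom_Idt_Cmp)
  finally show ?thesis
    using 1 u v u' v' is_iso_iff hom_Cmp by meson
qed

lemma isomorphic_refl: "x \<in> Ob C \<Longrightarrow> isomorphic C x x"
  using hom_Idt is_iso_Idt isomorphic_def by metis

lemma isomorphic_sym: "isomorphic C x y \<Longrightarrow> isomorphic C y x"
  using iso_inverse isomorphic_def by metis

lemma isomorphic_trans: "\<lbrakk>isomorphic C x y; isomorphic C y z\<rbrakk> \<Longrightarrow> isomorphic C x z"
  unfolding isomorphic_def using is_iso_Cmp hom_Cmp by blast

end

section \<open>Functors, natural isomorphisms and equivalences\<close>

lemma is_functorD:
  assumes "is_functor A B F"
  shows "category A" "category B"
    and "x \<in> Ob A \<Longrightarrow> fo F x \<in> Ob B"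
    and "x \<in> Ob A \<Longrightarrow> fa F (Idt A x) = Idt B (fo F x)"
    and "u \<in> hom A x y \<Longrightarrow> fa F u \<in> hom B (fo F x) (fo F y)"
    and "\<lbrakk>u \<in> hom A x y; v \<in> hom A y z\<rbrakk> \<Longrightarrow> fa F (Cmp A v u) = Cmp B (fa F v) (fa F u)"
  using assms unfolding is_functor_def hom_def by auto

lemma nat_isoD:
  assumes "nat_iso A B F G \<tau>"
  shows "is_functor A B F" "is_functor A B G"
    and "x \<in> Ob A \<Longrightarrow> \<tau> x \<in> hom B (fo F x) (fo G x)"
    and "x \<in> Ob A \<Longrightarrow> is_iso B (\<tau> x)"
    and "u \<in> hom A x y \<Longrightarrow> Cmp B (\<tau> y) (fa F u) = Cmp B (fa G u) (\<tau> x)"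
  using assms unfolding nat_iso_def nat_trans_def hom_def by auto

text \<open>Naturality gives \<open>u\<close> and \<open>v\<close> the same composite with the
  component at \<open>x\<close>, which is invertible. This direction of the isomorphism serves the
  counit of an equivalence, \<open>nat_iso_from_id_faithful\<close> the unit.\<close>

lemma nat_iso_to_id_faithful:
  assumes n: "nat_iso A A F id_ftor \<tau>" and u: "u \<in> hom A x y" and v: "v \<in> hom A x y"
    and eq: "fa F u = fa F v"
  shows "u = v"
proof -
  note N = nat_isoD[OF n, unfolded id_ftor_def, simplified]
  interpret A: category A using N(1) by (rule is_functorD)
  have x: "x \<in> Ob A" using u A.hom_Ob by blast
  obtain t where t: "t \<in> hom A x (fo F x)" "Cmp A (\<tau> x) t = Idt A x"
    using N(3,4)[OF x] A.iso_inverse by metis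
  have "Cmp A u (\<tau> x) = Cmp A v (\<tau> x)"
    using N(5) u v eq by metis
  then have "Cmp A u (Cmp A (\<tau> x) t) = Cmp A v (Cmp A (\<tau> x) t)"
    using A.hom_assoc[OF t(1) N(3)[OF x]] u v by metis
  then show ?thesis
    using t u v by (simp add: A.hom_Cmp_Idt)
qed

lemma nat_iso_from_id_faithful:
  assumes n: "nat_iso A A id_ftor F \<tau>" and u: "u \<in> hom A x y" and v: "v \<in> hom A x y"
    and eq: "fa F u = fa F v"
  shows "u = v"
proof -
  note N = nat_isoD[OF n, unfolded id_ftor_def, simplified]
  interpret A: category A using N(1) by (rule is_functorD)
  have y: "y \<in> Ob A" using u A.hom_Ob by blast
  obtain t where t: "t \<in> hom A (fo F y) y" "Cmp A t (\<tau> y) = Idt A y"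
    using N(3,4)[OF y] A.iso_inverse by metis
  have "Cmp A (\<tau> y) u = Cmp A (\<tau> y) v"
    using N(5) u v eq by metis
  then have "Cmp A (Cmp A t (\<tau> y)) u = Cmp A (Cmp A t (\<tau> y)) v"
    using A.hom_assoc[OF _ N(3)[OF y] t(1)] u v by metis
  then show ?thesis
    using t u v by (simp add: A.hom_Idt_Cmp)
qed

lemma equivalence_faithful:
  assumes "equivalence A B F" "u \<in> hom A x y" "v \<in> hom A x y" "fa F u = fa F v"
  shows "u = v"
  using assms nat_iso_from_id_faithful unfolding equivalence_def comp_ftor_def by fastforce

text \<open>The conjugate \<open>u\<close> of \<open>fa G w\<close> by the unit satisfies
  \<open>fa G (fa F u) = fa G w\<close>, and \<open>G\<close> is faithful because \<open>F\<close>
  after \<open>G\<close> is isomorphic to the identity.\<close>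

lemma equivalence_full:
  assumes e: "equivalence A B F" and x: "x \<in> Ob A" and y: "y \<in> Ob A"
    and w: "w \<in> hom B (fo F x) (fo F y)"
  shows "\<exists>u \<in> hom A x y. fa F u = w"
proof -
  obtain G \<eta> \<epsilon> where F: "is_functor A B F" and G: "is_functor B A G"
    and \<eta>: "nat_iso A A id_ftor (comp_ftor G F) \<eta>" and \<epsilon>: "nat_iso B B (comp_ftor F G) id_ftor \<epsilon>"
    using e unfolding equivalence_def by blast
  note N = nat_isoD[OF \<eta>, unfolded id_ftor_def comp_ftor_def, simplified]
  interpret A: category A using F by (rule is_functorD)
  have Gw: "fa G w \<in> hom A (fo G (fo F x)) (fo G (fo F y))"
    using w is_functorD(5)[OF G] by blast
  obtain t where t: "t \<in> hom A (fo G (fo F y)) y" "Cmp A (\<eta> y) t = Idt A (fo G (fo F y))"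
    using N(3,4)[OF y] A.iso_inverse by metis
  obtain s where s: "s \<in> hom A (fo G (fo F x)) x" "Cmp A (\<eta> x) s = Idt A (fo G (fo F x))"
    using N(3,4)[OF x] A.iso_inverse by metis
  define u where "u = Cmp A t (Cmp A (fa G w) (\<eta> x))"
  have h: "Cmp A (fa G w) (\<eta> x) \<in> hom A x (fo G (fo F y))"
    using Gw N(3)[OF x] A.hom_Cmp by blast
  have u: "u \<in> hom A x y"
    unfolding u_def using A.hom_Cmp h t by blast
  then have GFu: "fa G (fa F u) \<in> hom A (fo G (fo F x)) (fo G (fo F y))"
    using is_functorD(5) F G by metis
  have "Cmp A (fa G (fa F u)) (\<eta> x) = Cmp A (\<eta> y) u"
    using N(5)[OF u] by simp
  also have "\<dots> = Cmp A (fa G w) (\<eta> x)"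
    unfolding u_def using A.hom_assoc[OF h t(1) N(3)[OF y]] t h by (simp add: A.hom_Idt_Cmp)
  finally have "Cmp A (fa G (fa F u)) (Cmp A (\<eta> x) s) = Cmp A (fa G w) (Cmp A (\<eta> x) s)"
    using A.hom_assoc[OF s(1) N(3)[OF x]] GFu Gw by metis
  then have "fa G (fa F u) = fa G w"
    using s GFu Gw by (simp add: A.hom_Cmp_Idt)
  moreover have "fa F u \<in> hom B (fo F x) (fo F y)"
    using u is_functorD(5)[OF F] by blast
  ultimately have "fa F u = w"
    using nat_iso_to_id_faithful[OF \<epsilon>] w by (simp add: comp_ftor_def)
  then show ?thesis using u by blast
qed

lemma equivalence_ess_surj:
  assumes e: "equivalence A B F" and y: "y \<in> Ob B"
  shows "\<exists>x \<in> Ob A. isomorphic B (fo F x) y"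
proof -
  obtain G \<epsilon> where G: "is_functor B A G" and \<epsilon>: "nat_iso B B (comp_ftor F G) id_ftor \<epsilon>"
    using e unfolding equivalence_def by blast
  note N = nat_isoD[OF \<epsilon>, unfolded id_ftor_def comp_ftor_def, simplified]
  show ?thesis
    using N(3,4)[OF y] is_functorD(3)[OF G y] unfolding isomorphic_def by blast
qed

text \<open>Keeps inverses inside the categories \<open>Hom_over\<close>, whose 2-morphisms have to
  lie over an identity.\<close>

lemma iso_lift_over_identity:
  assumes F: "is_functor A B F" and u: "u \<in> hom A x y" "is_iso A u" "fa F u = Idt B b"
    and xy: "fo F x = b" "fo F y = b"
    and v: "v \<in> hom A y x" "Cmp A v u = Idt A x"
  shows "fa F v = Idt B b"
proof -
  interpret B: category B using F by (rule is_functorD)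
  interpret A: category A using F by (rule is_functorD)
  have x: "x \<in> Ob A" using u A.hom_Ob by blast
  have "Cmp B (fa F v) (Idt B b) = Idt B b"
    using is_functorD(6)[OF F u(1) v(1)] is_functorD(4)[OF F x] v(2) u(3) xy by simp
  moreover have "fa F v \<in> hom B b b"
    using is_functorD(5)[OF F v(1)] xy by simp
  ultimately show ?thesis by (simp add: B.hom_Cmp_Idt)
qed

section \<open>coCartesian arrows of a functor\<close>

lemma cocartesian_arrowD:
  assumes "cocartesian_arrow A B F u" "u \<in> hom A x y" "v \<in> hom A x z"
    "w \<in> hom B (fo F y) (fo F z)" "Cmp B w (fa F u) = fa F v"
  shows "\<exists>!v'. v' \<in> hom A y z \<and> fa F v' = w \<and> Cmp A v' u = v"
  using assms(1)[unfolded cocartesian_arrow_def, THEN conjunct2, rule_format, of v w] assms(2-)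
  by (simp add: hom_def)

lemma cocartesian_arrowI:
  assumes "u \<in> hom A x y"
    and "\<And>z v w. \<lbrakk>v \<in> hom A x z; w \<in> hom B (fo F y) (fo F z); Cmp B w (fa F u) = fa F v\<rbrakk>
      \<Longrightarrow> \<exists>!v'. v' \<in> hom A y z \<and> fa F v' = w \<and> Cmp A v' u = v"
  shows "cocartesian_arrow A B F u"
  unfolding cocartesian_arrow_def
proof (intro conjI ballI impI)
  show "u \<in> Ar A" using assms(1) by (simp add: hom_def)
  fix v w assume "v \<in> Ar A" "w \<in> hom B (fo F (Cod A u)) (fo F (Cod A v))"
    "Dom A v = Dom A u \<and> Cmp B w (fa F u) = fa F v"
  then show "\<exists>!v'. v' \<in> hom A (Cod A u) (Cod A v) \<and> fa F v' = w \<and> Cmp A v' u = v"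
    using assms(2)[of v "Cod A v" w] assms(1) by (simp add: hom_def)
qed

lemma iso_cocartesian:
  assumes F: "is_functor A B F" and u: "u \<in> hom A x y" "is_iso A u"
  shows "cocartesian_arrow A B F u"
proof (rule cocartesian_arrowI[OF u(1)])
  interpret B: category B using F by (rule is_functorD)
  interpret A: category A using F by (rule is_functorD)
  note Fh = is_functorD(5)[OF F] and Fc = is_functorD(6)[OF F] and Fi = is_functorD(4)[OF F]
  obtain t where t: "t \<in> hom A y x" "Cmp A t u = Idt A x" "Cmp A u t = Idt A y"
    using u A.iso_inverse by metis
  have xy: "x \<in> Ob A" "y \<in> Ob A" using u A.hom_Ob by blast+
  fix z v w
  assume v: "v \<in> hom A x z" and w: "w \<in> hom B (fo F y) (fo F z)" and e: "Cmp B w (fa F u) = fa F v"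
  show "\<exists>!v'. v' \<in> hom A y z \<and> fa F v' = w \<and> Cmp A v' u = v"
  proof
    have "Cmp B (Cmp B w (fa F u)) (fa F t) = w"
      using B.hom_assoc[OF Fh[OF t(1)] Fh[OF u(1)] w] Fc[OF t(1) u(1)] t Fi[OF xy(2)]
        B.hom_Cmp_Idt[OF w] by simp
    then have 1: "fa F (Cmp A v t) = w"
      using Fc[OF t(1) v] e by simp
    have 2: "Cmp A (Cmp A v t) u = v"
      using A.hom_assoc[OF u(1) t(1) v] t v by (simp add: A.hom_Cmp_Idt)
    show "Cmp A v t \<in> hom A y z \<and> fa F (Cmp A v t) = w \<and> Cmp A (Cmp A v t) u = v"
      using 1 2 A.hom_Cmp t v by blast
  next
    fix v' assume v': "v' \<in> hom A y z \<and> fa F v' = w \<and> Cmp A v' u = v"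
    then show "v' = Cmp A v t"
      using A.hom_assoc[OF t(1) u(1), of v' z] t by (auto simp: A.hom_Cmp_Idt)
  qed
qed

text \<open>Lifting the inverse of \<open>fa F u\<close> against \<open>Idt A x\<close> gives a left
  inverse \<open>v\<close>. It is also a right inverse, since \<open>Cmp A u v\<close> and
  \<open>Idt A y\<close> both factor \<open>u\<close> through itself over an identity.\<close>

lemma cocartesian_over_iso:
  assumes F: "is_functor A B F" and u: "u \<in> hom A x y" "cocartesian_arrow A B F u"
    and i: "is_iso B (fa F u)"
  shows "is_iso A u"
proof -
  interpret B: category B using F by (rule is_functorD)
  interpret A: category A using F by (rule is_functorD)
  note Fh = is_functorD(5)[OF F] and Fc = is_functorD(6)[OF F] and Fi = is_functorD(4)[OF F]
  have xy: "x \<in> Ob A" "y \<in> Ob A" using u A.hom_Ob by blast+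
  obtain w where w: "w \<in> hom B (fo F y) (fo F x)" "Cmp B w (fa F u) = Idt B (fo F x)"
      "Cmp B (fa F u) w = Idt B (fo F y)"
    using B.iso_inverse[OF Fh[OF u(1)] i] by metis
  obtain v where v: "v \<in> hom A y x" "fa F v = w" "Cmp A v u = Idt A x"
    using cocartesian_arrowD[OF u(2,1) A.hom_Idt[OF xy(1)] w(1)] w Fi[OF xy(1)] by auto
  have uu: "Idt B (fo F y) \<in> hom B (fo F y) (fo F y)"
    using is_functorD(3)[OF F xy(2)] B.hom_Idt by blast
  have "Cmp A u v \<in> hom A y y \<and> fa F (Cmp A u v) = Idt B (fo F y) \<and> Cmp A (Cmp A u v) u = u"
    using A.hom_Cmp[OF v(1) u(1)] Fc[OF v(1) u(1)] v w A.hom_assoc[OF u(1) v(1) u(1)] u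
    by (simp add: A.hom_Cmp_Idt)
  moreover have "Idt A y \<in> hom A y y \<and> fa F (Idt A y) = Idt B (fo F y) \<and> Cmp A (Idt A y) u = u"
    using A.hom_Idt xy Fi A.hom_Idt_Cmp u by metis
  moreover have "Cmp B (Idt B (fo F y)) (fa F u) = fa F u"
    using Fh[OF u(1)] by (simp add: B.hom_Idt_Cmp)
  ultimately have "Cmp A u v = Idt A y"
    using cocartesian_arrowD[OF u(2,1,1) uu] by blast
  then show ?thesis
    using A.is_iso_iff[OF u(1)] v by blast
qed

lemma cocartesian_Cmp:
  assumes F: "is_functor A B F" and u: "u \<in> hom A x y" "cocartesian_arrow A B F u"
    and v: "v \<in> hom A y z" "cocartesian_arrow A B F v"
  shows "cocartesian_arrow A B F (Cmp A v u)"
proof -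
  interpret B: category B using F by (rule is_functorD)
  interpret A: category A using F by (rule is_functorD)
  note Fh = is_functorD(5)[OF F] and Fc = is_functorD(6)[OF F]
  show ?thesis
  proof (rule cocartesian_arrowI[OF A.hom_Cmp[OF u(1) v(1)]])
    fix z' t w
    assume t: "t \<in> hom A x z'" and w: "w \<in> hom B (fo F z) (fo F z')"
      and e: "Cmp B w (fa F (Cmp A v u)) = fa F t"
    have wv: "Cmp B w (fa F v) \<in> hom B (fo F y) (fo F z')"
      using B.hom_Cmp Fh v w by blast
    have "Cmp B (Cmp B w (fa F v)) (fa F u) = fa F t"
      using e Fc[OF u(1) v(1)] B.hom_assoc[OF Fh[OF u(1)] Fh[OF v(1)] w] by simp
    then have ex1: "\<exists>!t'. t' \<in> hom A y z' \<and> fa F t' = Cmp B w (fa F v) \<and> Cmp A t' u = t"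
      using cocartesian_arrowD[OF u(2,1) t wv] by blast
    then obtain t' where t': "t' \<in> hom A y z'" "fa F t' = Cmp B w (fa F v)" "Cmp A t' u = t"
      by blast
    have ex2: "\<exists>!s. s \<in> hom A z z' \<and> fa F s = w \<and> Cmp A s v = t'"
      using cocartesian_arrowD[OF v(2,1) t'(1) w] t' by simp
    show "\<exists>!v'. v' \<in> hom A z z' \<and> fa F v' = w \<and> Cmp A v' (Cmp A v u) = t"
    proof (rule ex_ex1I)
      show "\<exists>v'. v' \<in> hom A z z' \<and> fa F v' = w \<and> Cmp A v' (Cmp A v u) = t"
        using ex2 A.hom_assoc[OF u(1) v(1)] t' by metis
    next
      fix s s'
      assume s: "s \<in> hom A z z' \<and> fa F s = w \<and> Cmp A s (Cmp A v u) = t"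
        and s': "s' \<in> hom A z z' \<and> fa F s' = w \<and> Cmp A s' (Cmp A v u) = t"
      \<comment> \<open>Any solution \<open>r\<close> composed with \<open>v\<close> solves the
        factorization problem for \<open>u\<close>, so it is \<open>t'\<close>. This reduces
        uniqueness to the universal property of \<open>v\<close>.\<close>
      have "Cmp A r v = t'" if "r \<in> hom A z z' \<and> fa F r = w \<and> Cmp A r (Cmp A v u) = t" for r
        using that ex1 t' A.hom_assoc[OF u(1) v(1)] A.hom_Cmp[OF v(1)] Fc[OF v(1)] by metis
      then show "s = s'" using s s' ex2 by blast
    qed
  qed
qed

text \<open>The usual uniqueness, with the additional information that the comparison lies over an
  identity. This makes transport along a 2-morphism well defined up to
  \<open>\<simeq>\<close>.\<close>

lemma cocartesian_unique:
  assumes F: "is_functor A B F" and u: "u \<in> hom A x y" "cocartesian_arrow A B F u"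
    and v: "v \<in> hom A x z" "cocartesian_arrow A B F v" and e: "fa F u = fa F v"
  shows "\<exists>w \<in> hom A y z. is_iso A w \<and> fa F w = Idt B (fo F y)"
proof -
  interpret B: category B using F by (rule is_functorD)
  interpret A: category A using F by (rule is_functorD)
  note Fh = is_functorD(5)[OF F] and Fc = is_functorD(6)[OF F] and Fi = is_functorD(4)[OF F]
  have yz: "y \<in> Ob A" "z \<in> Ob A" using u v A.hom_Ob by blast+
  have "fa F u \<in> hom B (fo F x) (fo F y)" "fa F v \<in> hom B (fo F x) (fo F z)"
    using Fh u v by blast+
  then have fy: "fo F z = fo F y" using e by (auto simp: hom_def)
  have I: "Idt B (fo F y) \<in> hom B (fo F y) (fo F y)"
    using is_functorD(3)[OF F yz(1)] B.hom_Idt by blast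
  have Iu: "Cmp B (Idt B (fo F y)) (fa F u) = fa F u"
    using Fh[OF u(1)] by (simp add: B.hom_Idt_Cmp)
  have key: "\<exists>!w. w \<in> hom A y' z' \<and> fa F w = Idt B (fo F y) \<and> Cmp A w u' = v'"
    if "u' \<in> hom A x y'" "cocartesian_arrow A B F u'" "v' \<in> hom A x z'"
      "fo F y' = fo F y" "fo F z' = fo F y" "fa F u' = fa F u" "fa F v' = fa F u" for y' z' u' v'
    using cocartesian_arrowD[OF that(2,1,3), of "Idt B (fo F y)"] that(4-) I Iu by simp
  have uni: "w = w'" if "u' \<in> hom A x y'" "cocartesian_arrow A B F u'" "fo F y' = fo F y" "fa F u' = fa F u"
      "w \<in> hom A y' y'" "w' \<in> hom A y' y'" "fa F w = Idt B (fo F y)" "fa F w' = Idt B (fo F y)"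
      "Cmp A w u' = u'" "Cmp A w' u' = u'" for y' u' w w'
    using key[OF that(1,2,1,3,3,4,4)] that(5-) by blast
  obtain w where w: "w \<in> hom A y z" "fa F w = Idt B (fo F y)" "Cmp A w u = v"
    using key[OF u v(1) refl fy refl e[symmetric]] by blast
  obtain w' where w': "w' \<in> hom A z y" "fa F w' = Idt B (fo F y)" "Cmp A w' v = u"
    using key[OF v u(1) fy refl e[symmetric] refl] by blast
  have I2: "Cmp B (Idt B (fo F y)) (Idt B (fo F y)) = Idt B (fo F y)"
    using I by (simp add: B.hom_Cmp_Idt)
  have "Cmp A w' w = Idt A y"
    using uni[OF u, of "Cmp A w' w" "Idt A y"] A.hom_Cmp[OF w(1) w'(1)] A.hom_Idt[OF yz(1)]
      Fc[OF w(1) w'(1)] w w' I2 Fi[OF yz(1)] A.hom_assoc[OF u(1) w(1) w'(1)] u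
    by (simp add: A.hom_Idt_Cmp)
  moreover have "Cmp A w w' = Idt A z"
    using uni[OF v, of "Cmp A w w'" "Idt A z"] A.hom_Cmp[OF w'(1) w(1)] A.hom_Idt[OF yz(2)]
      Fc[OF w'(1) w(1)] w w' I2 Fi[OF yz(2)] A.hom_assoc[OF v(1) w'(1) w(1)] v fy e
    by (simp add: A.hom_Idt_Cmp)
  ultimately show ?thesis
    using A.is_iso_iff[OF w(1)] w w' by blast
qed

section \<open>Isofibrations and 2-Cartesian squares\<close>

text \<open>The consequence of being a fibration or an opfibration that the proper and the etale
  case share: an object can be moved so that its image becomes a prescribed isomorphic object on the
  nose.\<close>

definition isofibration ::
  "('o, 'a) cat \<Rightarrow> ('o2, 'a2) cat \<Rightarrow> ('o, 'a, 'o2, 'a2) ftor \<Rightarrow> bool" where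
  "isofibration A B F \<longleftrightarrow> is_functor A B F \<and>
     (\<forall>x \<in> Ob A. \<forall>y. \<forall>w \<in> hom B (fo F x) y. is_iso B w \<longrightarrow>
        (\<exists>x'. \<exists>u \<in> hom A x x'. is_iso A u \<and> fo F x' = y \<and> fa F u = w))"

lemma opfibration_isofibration:
  assumes "opfibration A B F"
  shows "isofibration A B F"
  unfolding isofibration_def
proof (intro conjI ballI allI impI)
  show F: "is_functor A B F" using assms by (simp add: opfibration_def)
  fix x y w assume x: "x \<in> Ob A" and w: "w \<in> hom B (fo F x) y" "is_iso B w"
  obtain u where u: "u \<in> Ar A" "Dom A u = x" "fa F u = w" "cocartesian_arrow A B F u"
    using assms x w unfolding opfibration_def hom_def by blast
  then have uh: "u \<in> hom A x (Cod A u)" by (simp add: hom_def)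
  then have "is_iso A u" using cocartesian_over_iso[OF F uh u(4)] u w by simp
  moreover have "fo F (Cod A u) = y"
    using is_functorD(5)[OF F uh] u w by (simp add: hom_def)
  ultimately show "\<exists>x'. \<exists>u \<in> hom A x x'. is_iso A u \<and> fo F x' = y \<and> fa F u = w"
    using uh u by blast
qed

text \<open>\<open>G\<close> is an isofibration because the comparison functor reaches triples only
  up to isomorphism, while objects of \<open>A\<close> with a prescribed image in \<open>C'\<close>
  are wanted. The outcome is surjectivity and injectivity on isomorphism classes of objects over a
  fixed \<open>c\<close>.\<close>

locale cartesian_square =
  fixes A :: "('a, 'x) cat" and B :: "('b, 'u) cat" and C' :: "('c, 'v) cat" and C'' :: "('d, 'w) cat"
    and F :: "('a, 'x, 'b, 'u) ftor" and G :: "('a, 'x, 'c, 'v) ftor"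
    and \<beta> :: "('b, 'u, 'd, 'w) ftor" and \<gamma> :: "('c, 'v, 'd, 'w) ftor"
  assumes F: "is_functor A B F" and G: "isofibration A C' G"
    and \<beta>: "is_functor B C'' \<beta>" and \<gamma>: "is_functor C' C'' \<gamma>"
    and sq: "a \<in> Ob A \<Longrightarrow> fo \<beta> (fo F a) = fo \<gamma> (fo G a)"
      "x \<in> hom A a a' \<Longrightarrow> fa \<beta> (fa F x) = fa \<gamma> (fa G x)"
    and cart: "two_cartesian A B C' C'' F G \<beta> \<gamma>"
begin

sublocale A: category A using F by (rule is_functorD)
sublocale B: category B using F by (rule is_functorD)
sublocale C': category C' using \<gamma> by (rule is_functorD)
sublocale C'': category C'' using \<gamma> by (rule is_functorD)

lemma Gf: "is_functor A C' G" using G by (simp add: isofibration_def)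

abbreviation "P \<equiv> iso_comma B C' C'' \<beta> \<gamma>"
abbreviation "K \<equiv> comparison A C'' F G \<beta>"

lemma K: "equivalence A P K" using cart by (simp add: two_cartesian_def)

text \<open>The comparison functor reaches the triple of \<open>b\<close>, \<open>c\<close> and the
  identity up to an isomorphism \<open>(u, v)\<close>. Lifting \<open>v\<close> along
  \<open>G\<close> corrects the second component; the price is to compose \<open>u\<close> with the
  image of the inverse lift, and over \<open>C''\<close> the two cancel.\<close>

lemma lift_object:
  assumes b: "b \<in> Ob B" and c: "c \<in> Ob C'" and e: "fo \<beta> b = fo \<gamma> c"
  shows "\<exists>a \<in> Ob A. fo G a = c \<and> (\<exists>u \<in> hom B (fo F a) b. is_iso B u \<and> fa \<beta> u = Idt C'' (fo \<beta> b))"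
proof -
  let ?i = "Idt C'' (fo \<beta> b)"
  have ob: "fo \<beta> b \<in> Ob C''" using is_functorD(3)[OF \<beta> b] .
  have "(b, c, ?i) \<in> Ob P"
    using b c e C''.hom_Idt[OF ob] C''.is_iso_Idt[OF ob] by (simp add: iso_comma_def Let_def)
  then obtain a h where a: "a \<in> Ob A" and h: "h \<in> hom P (fo K a) (b, c, ?i)" "is_iso P h"
    using equivalence_ess_surj[OF K] unfolding isomorphic_def by metis
  interpret P: category P using K unfolding equivalence_def by (meson is_functorD(2))
  obtain h' where h': "h' \<in> hom P (b, c, ?i) (fo K a)" "Cmp P h' h = Idt P (fo K a)"
      "Cmp P h h' = Idt P (b, c, ?i)"
    using h P.iso_inverse by metis
  obtain u v where hu: "h = (fo K a, (u, v), (b, c, ?i))" "u \<in> hom B (fo F a) b" "v \<in> hom C' (fo G a) c"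
      "Cmp C'' (fa \<gamma> v) (Idt C'' (fo \<beta> (fo F a))) = Cmp C'' ?i (fa \<beta> u)"
    using h(1) by (auto simp: hom_def iso_comma_def comparison_def Let_def)
  obtain u' v' where hu': "h' = ((b, c, ?i), (u', v'), fo K a)" "u' \<in> hom B b (fo F a)" "v' \<in> hom C' c (fo G a)"
    using h'(1) by (auto simp: hom_def iso_comma_def comparison_def Let_def)
  have inv: "Cmp B u' u = Idt B (fo F a)" "Cmp C' v' v = Idt C' (fo G a)"
      "Cmp B u u' = Idt B b" "Cmp C' v v' = Idt C' c"
    using h'(2,3) hu(1) hu'(1) by (auto simp: iso_comma_def comparison_def Let_def)
  have iso: "is_iso B u" "is_iso C' v"
    using inv hu hu' B.is_iso_iff C'.is_iso_iff by blast+
  have \<beta>u: "fa \<beta> u \<in> hom C'' (fo \<beta> (fo F a)) (fo \<beta> b)"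
    using is_functorD(5)[OF \<beta> hu(2)] .
  have "fa \<gamma> v \<in> hom C'' (fo \<beta> (fo F a)) (fo \<beta> b)"
    using is_functorD(5)[OF \<gamma> hu(3)] sq(1)[OF a] e by simp
  \<comment> \<open>The isomorphisms in both triples are identities, so compatibility of the pair
    becomes an equality of images.\<close>
  then have vu: "fa \<gamma> v = fa \<beta> u"
    using hu(4) \<beta>u by (simp add: C''.hom_Cmp_Idt C''.hom_Idt_Cmp)
  \<comment> \<open>\<open>a\<close> is replaced by an isomorphic object whose image under
    \<open>G\<close> is exactly \<open>c\<close>.\<close>
  obtain a' x where x: "x \<in> hom A a a'" "is_iso A x" "fo G a' = c" "fa G x = v"
    using G a hu(3) iso(2) unfolding isofibration_def by metis
  obtain y where y: "y \<in> hom A a' a" "is_iso A y" "Cmp A x y = Idt A a'" "Cmp A y x = Idt A a"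
    using x A.iso_inverse by metis
  have a': "a' \<in> Ob A" using x A.hom_Ob by blast
  have Fy: "fa F y \<in> hom B (fo F a') (fo F a)" using is_functorD(5)[OF F y(1)] .
  have Fx: "fa F x \<in> hom B (fo F a) (fo F a')" using is_functorD(5)[OF F x(1)] .
  have Fyi: "is_iso B (fa F y)"
    unfolding B.is_iso_iff[OF Fy] using Fx is_functorD(6)[OF F x(1) y(1)] is_functorD(6)[OF F y(1) x(1)] y
      is_functorD(4)[OF F] a a' by metis
  have "fa \<beta> (Cmp B u (fa F y)) = Cmp C'' (fa \<beta> u) (fa \<beta> (fa F y))"
    using is_functorD(6)[OF \<beta> Fy hu(2)] .
  also have "\<dots> = Cmp C'' (fa \<gamma> (fa G x)) (fa \<gamma> (fa G y))"
    using vu x sq(2)[OF y(1)] by simp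
  also have "\<dots> = fa \<gamma> (fa G (Cmp A x y))"
    using is_functorD(5,6)[OF Gf] is_functorD(6)[OF \<gamma>] x y by metis
  also have "\<dots> = Idt C'' (fo \<beta> b)"
    using y is_functorD(4)[OF Gf a'] is_functorD(4)[OF \<gamma> c] x e by simp
  finally show ?thesis
    using a' x(3) B.hom_Cmp[OF Fy hu(2)] B.is_iso_Cmp[OF Fy Fyi hu(2) iso(1)] by blast
qed

text \<open>Paired with \<open>Idt C' c\<close>, both \<open>u\<close> and its inverse are arrows of
  triples. Fullness lifts them separately, and faithfulness shows that the lifts are mutually
  inverse.\<close>

lemma lift_isomorphism:
  assumes a: "a \<in> Ob A" "a' \<in> Ob A" "fo G a = c" "fo G a' = c"
    and u: "u \<in> hom B (fo F a) (fo F a')" "is_iso B u" "fa \<beta> u = Idt C'' (fo \<gamma> c)"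
  shows "\<exists>x \<in> hom A a a'. is_iso A x \<and> fa G x = Idt C' c"
proof -
  have c: "c \<in> Ob C'" using is_functorD(3)[OF Gf a(1)] a by simp
  have gc: "fo \<gamma> c \<in> Ob C''" using is_functorD(3)[OF \<gamma> c] .
  have bF: "fo \<beta> (fo F a) = fo \<gamma> c" "fo \<beta> (fo F a') = fo \<gamma> c" using sq a by auto
  have Fa: "fo F a \<in> Ob B" "fo F a' \<in> Ob B" using is_functorD(3)[OF F] a by auto
  obtain v where v: "v \<in> hom B (fo F a') (fo F a)" "Cmp B v u = Idt B (fo F a)" "Cmp B u v = Idt B (fo F a')"
    using u B.iso_inverse by metis
  have \<beta>v: "fa \<beta> v = Idt C'' (fo \<gamma> c)"
    using iso_lift_over_identity[OF \<beta> u bF v(1,2)] .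
  have key: "\<exists>x \<in> hom A d d'. fa F x = t \<and> fa G x = Idt C' c"
    if d: "d \<in> Ob A" "d' \<in> Ob A" "fo G d = c" "fo G d' = c" "t \<in> hom B (fo F d) (fo F d')"
      "fa \<beta> t = Idt C'' (fo \<gamma> c)" for d d' t
  proof -
    have bF: "fo \<beta> (fo F d) = fo \<gamma> c" "fo \<beta> (fo F d') = fo \<gamma> c" using sq d by auto
    have "fo F d \<in> Ob B" "fo F d' \<in> Ob B" using is_functorD(3)[OF F] d by auto
    then have "(fo K d, (t, Idt C' c), fo K d') \<in> hom P (fo K d) (fo K d')"
      unfolding hom_def[of P]
      using d c bF C''.hom_Idt[OF gc] C''.is_iso_Idt[OF gc] C'.hom_Idt[OF c] is_functorD(4)[OF \<gamma> c]
      by (simp add: iso_comma_def comparison_def Let_def)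
    then obtain x where "x \<in> hom A d d'" "fa K x = (fo K d, (t, Idt C' c), fo K d')"
      using equivalence_full[OF K d(1,2)] by metis
    then show ?thesis
      unfolding comparison_def Let_def by auto
  qed
  obtain x where x: "x \<in> hom A a a'" "fa F x = u" "fa G x = Idt C' c"
    using key[OF a u(1,3)] by blast
  obtain y where y: "y \<in> hom A a' a" "fa F y = v" "fa G y = Idt C' c"
    using key[OF a(2,1,4,3) v(1) \<beta>v] by blast
  have cc: "Cmp C' (Idt C' c) (Idt C' c) = Idt C' c"
    using C'.hom_Cmp_Idt[OF C'.hom_Idt[OF c]] .
  have id: "Cmp A s r = Idt A d"
    if "r \<in> hom A d d'" "s \<in> hom A d' d" "d \<in> Ob A" "fo G d = c" "fa G r = Idt C' c" "fa G s = Idt C' c"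
      "Cmp B (fa F s) (fa F r) = Idt B (fo F d)" for r s d d'
  proof (rule equivalence_faithful[OF K A.hom_Cmp[OF that(1,2)] A.hom_Idt[OF that(3)]])
    have "Cmp A s r \<in> hom A d d" using A.hom_Cmp that by blast
    then show "fa K (Cmp A s r) = fa K (Idt A d)"
      using that is_functorD(6)[OF F that(1,2)] is_functorD(6)[OF Gf that(1,2)] cc
        is_functorD(4)[OF F that(3)] is_functorD(4)[OF Gf that(3)] A.hom_Idt[OF that(3)]
      by (simp add: comparison_def Let_def hom_def)
  qed
  have "Cmp A y x = Idt A a" "Cmp A x y = Idt A a'"
    using id[OF x(1) y(1)] id[OF y(1) x(1)] x y a v by auto
  then show ?thesis
    using A.is_iso_iff[OF x(1)] x y by blast
qed

end

section \<open>Isomorphism classes of 1-morphisms\<close>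

lemma insert_at_singleton [simp]: "insert_at 0 ys [x] = ys"
  by (simp add: insert_at_def)

lemma is_functorI:
  assumes "category A" "category B"
    and "\<And>x. x \<in> Ob A \<Longrightarrow> fo F x \<in> Ob B"
    and "\<And>x. x \<in> Ob A \<Longrightarrow> fa F (Idt A x) = Idt B (fo F x)"
    and "\<And>u x y. u \<in> hom A x y \<Longrightarrow> fa F u \<in> hom B (fo F x) (fo F y)"
    and "\<And>u v x y z. \<lbrakk>u \<in> hom A x y; v \<in> hom A y z\<rbrakk> \<Longrightarrow> fa F (Cmp A v u) = Cmp B (fa F v) (fa F u)"
  shows "is_functor A B F"
  using assms unfolding is_functor_def hom_def by simp

lemma Ob_Hom: "f \<in> Ob (Hom M Xs Y) \<longleftrightarrow> f \<in> mor M \<and> src M f = Xs \<and> tgt M f = Y"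
  and Idt_Hom [simp]: "Idt (Hom M Xs Y) = cidt M"
  and Cmp_Hom [simp]: "Cmp (Hom M Xs Y) = vcmp M"
  by (simp_all add: Hom_def Let_def)

section \<open>Whiskering and horizontal composition of 2-morphisms\<close>

context two_multicategory
begin

lemma hom_Hom: "a \<in> hom (Hom M Xs Y) f g \<longleftrightarrow>
    a \<in> cell M \<and> cdom M a = f \<and> ccod M a = g \<and> src M f = Xs \<and> tgt M f = Y"
  using cell_mor[of a] cell_parallel[of a] by (auto simp: hom_def Hom_def Let_def)

lemma cidt_hom: "f \<in> mor M \<Longrightarrow> cidt M f \<in> hom (Hom M (src M f) (tgt M f)) f f"
  using category.hom_Idt[OF Hom_category] by (simp add: Ob_Hom)

lemma cidt_cell [simp]: "f \<in> mor M \<Longrightarrow> cidt M f \<in> cell M"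
  and cdom_cidt [simp]: "f \<in> mor M \<Longrightarrow> cdom M (cidt M f) = f"
  and ccod_cidt [simp]: "f \<in> mor M \<Longrightarrow> ccod M (cidt M f) = f"
  using cidt_hom hom_Hom by blast+

lemma vcmp_cidt: "f \<in> mor M \<Longrightarrow> vcmp M (cidt M f) (cidt M f) = cidt M f"
  using category.hom_Cmp_Idt[OF Hom_category cidt_hom] by simp

lemma hom_comp2:
  assumes "a \<in> hom (Hom M Xs Y) f f'" "b \<in> hom (Hom M Ys Z) g g'" "composable M g i f"
  shows "comp2 M b i a \<in> hom (Hom M (insert_at i Xs Ys) Z) (comp1 M g i f) (comp1 M g' i f')"
  using assms comp2_cell[of b i a] comp1_mor[of g i f] by (simp add: hom_Hom composable2_def)

lemma composable_parallel:
  assumes "a \<in> hom (Hom M Xs Y) f f'" "b \<in> hom (Hom M Ys Z) g g'"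
  shows "composable M g' i f' \<longleftrightarrow> composable M g i f"
  using assms cell_mor[of a] cell_mor[of b] cell_parallel[of a] cell_parallel[of b]
  by (auto simp: hom_Hom composable_def)

lemma comp2_vcmp_hom:
  assumes "a \<in> hom (Hom M Xs Y) f f'" "a' \<in> hom (Hom M Xs Y) f' f''"
    "b \<in> hom (Hom M Ys Z) g g'" "b' \<in> hom (Hom M Ys Z) g' g''" "composable M g i f"
  shows "comp2 M (vcmp M b' b) i (vcmp M a' a) = vcmp M (comp2 M b' i a') (comp2 M b i a)"
  using assms composable_parallel[OF assms(1,3), of i]
  by (intro comp2_vcmp) (auto simp: hom_Hom composable2_def)

text \<open>By interchange, the horizontal composite of the inverses is an inverse.\<close>

lemma comp2_is_iso:
  assumes a: "a \<in> hom (Hom M Xs Y) f f'" "is_iso (Hom M Xs Y) a"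
    and b: "b \<in> hom (Hom M Ys Z) g g'" "is_iso (Hom M Ys Z) b" and c: "composable M g i f"
  shows "is_iso (Hom M (insert_at i Xs Ys) Z) (comp2 M b i a)"
proof -
  interpret XY: category "Hom M Xs Y" by (rule Hom_category)
  interpret YZ: category "Hom M Ys Z" by (rule Hom_category)
  interpret H: category "Hom M (insert_at i Xs Ys) Z" by (rule Hom_category)
  have c': "composable M g' i f'" using composable_parallel[OF a(1) b(1)] c by blast
  obtain a' where a': "a' \<in> hom (Hom M Xs Y) f' f" "vcmp M a' a = cidt M f" "vcmp M a a' = cidt M f'"
    using XY.iso_inverse[OF a] by auto
  obtain b' where b': "b' \<in> hom (Hom M Ys Z) g' g" "vcmp M b' b = cidt M g" "vcmp M b b' = cidt M g'"
    using YZ.iso_inverse[OF b] by auto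
  show ?thesis
    unfolding H.is_iso_iff[OF hom_comp2[OF a(1) b(1) c]]
  proof (intro bexI conjI)
    show "comp2 M b' i a' \<in> hom (Hom M (insert_at i Xs Ys) Z) (comp1 M g' i f') (comp1 M g i f)"
      using hom_comp2[OF a'(1) b'(1) c'] .
    show "Cmp (Hom M (insert_at i Xs Ys) Z) (comp2 M b' i a') (comp2 M b i a)
        = Idt (Hom M (insert_at i Xs Ys) Z) (comp1 M g i f)"
      using comp2_vcmp_hom[OF a(1) a'(1) b(1) b'(1) c] a'(2) b'(2) comp2_cidt[OF c] by simp
    show "Cmp (Hom M (insert_at i Xs Ys) Z) (comp2 M b i a) (comp2 M b' i a')
        = Idt (Hom M (insert_at i Xs Ys) Z) (comp1 M g' i f')"
      using comp2_vcmp_hom[OF a'(1) a(1) b'(1) b(1) c'] a'(3) b'(3) comp2_cidt[OF c'] by simp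
  qed
qed

lemma precomp_functor:
  assumes f: "f \<in> mor M" "i < length Ys" "Ys ! i = tgt M f"
  shows "is_functor (Hom M Ys Z) (Hom M (insert_at i (src M f) Ys) Z) (precomp M i f)"
proof (rule is_functorI)
  have c: "composable M g i f" if "g \<in> mor M" "src M g = Ys" for g
    using that f by (simp add: composable_def)
  fix g assume "g \<in> Ob (Hom M Ys Z)"
  then have g: "g \<in> mor M" "src M g = Ys" "tgt M g = Z" by (auto simp: Ob_Hom)
  show "fo (precomp M i f) g \<in> Ob (Hom M (insert_at i (src M f) Ys) Z)"
    using comp1_mor[OF c] g by (simp add: precomp_def Ob_Hom)
  show "fa (precomp M i f) (Idt (Hom M Ys Z) g)
      = Idt (Hom M (insert_at i (src M f) Ys) Z) (fo (precomp M i f) g)"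
    using comp2_cidt[OF c] g by (simp add: precomp_def)
next
  have c: "composable M g i f" if "b \<in> hom (Hom M Ys Z) g g'" for b g g'
    using that f cell_mor[of b] by (auto simp: composable_def hom_Hom)
  note f1 = cidt_hom[OF f(1)]
  fix b g g' assume b: "b \<in> hom (Hom M Ys Z) g g'"
  show "fa (precomp M i f) b \<in>
      hom (Hom M (insert_at i (src M f) Ys) Z) (fo (precomp M i f) g) (fo (precomp M i f) g')"
    using hom_comp2[OF f1 b c[OF b]] by (simp add: precomp_def)
  fix b' g'' assume b': "b' \<in> hom (Hom M Ys Z) g' g''"
  show "fa (precomp M i f) (Cmp (Hom M Ys Z) b' b)
      = Cmp (Hom M (insert_at i (src M f) Ys) Z) (fa (precomp M i f) b') (fa (precomp M i f) b)"
    using comp2_vcmp_hom[OF f1 f1 b b' c[OF b]] vcmp_cidt[OF f(1)] by (simp add: precomp_def)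
qed (rule Hom_category)+

lemma postcomp_functor:
  assumes g: "g \<in> mor M" "i < length (src M g)"
  shows "is_functor (Hom M Xs (src M g ! i)) (Hom M (insert_at i Xs (src M g)) (tgt M g)) (postcomp M g i)"
    (is "is_functor ?A ?B _")
proof (rule is_functorI)
  have c: "composable M g i f" if "f \<in> mor M" "tgt M f = src M g ! i" for f
    using that g by (simp add: composable_def)
  fix f assume "f \<in> Ob ?A"
  then have f: "f \<in> mor M" "src M f = Xs" "tgt M f = src M g ! i" by (auto simp: Ob_Hom)
  show "fo (postcomp M g i) f \<in> Ob ?B"
    using comp1_mor[OF c] f by (simp add: postcomp_def Ob_Hom)
  show "fa (postcomp M g i) (Idt ?A f) = Idt ?B (fo (postcomp M g i) f)"
    using comp2_cidt[OF c] f by (simp add: postcomp_def)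
next
  have c: "composable M g i f" if "a \<in> hom ?A f f'" for a f f'
    using that g cell_mor[of a] by (auto simp: composable_def hom_Hom)
  note g1 = cidt_hom[OF g(1)]
  fix a f f' assume a: "a \<in> hom ?A f f'"
  show "fa (postcomp M g i) a \<in> hom ?B (fo (postcomp M g i) f) (fo (postcomp M g i) f')"
    using hom_comp2[OF a g1 c[OF a]] by (simp add: postcomp_def)
  fix a' f'' assume a': "a' \<in> hom ?A f' f''"
  show "fa (postcomp M g i) (Cmp ?A a' a) = Cmp ?B (fa (postcomp M g i) a') (fa (postcomp M g i) a)"
    using comp2_vcmp_hom[OF a a' g1 g1 c[OF a]] vcmp_cidt[OF g(1)] by (simp add: postcomp_def)
qed (rule Hom_category)+

end

section \<open>1-morphisms over a fixed 1-morphism, up to isomorphism\<close>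

context strict_functor
begin

abbreviation cmpD (infixl "\<cdot>" 70) where "l \<cdot> k \<equiv> comp1 D l 0 k"
abbreviation cmpC (infixl "\<bullet>" 70) where "g \<bullet> f \<equiv> comp1 C g 0 f"

abbreviation over where "over g E F \<equiv> Ob (Hom_over D C p g [E] F)"

lemma overI: "\<lbrakk>k \<in> mor D; src D k = [E]; tgt D k = F; pm p k = g\<rbrakk> \<Longrightarrow> k \<in> over g E F"
  and overD: "k \<in> over g E F \<Longrightarrow> k \<in> mor D \<and> src D k = [E] \<and> tgt D k = F \<and> pm p k = g"
  by (auto simp: Hom_over_def Let_def)

lemma over_base:
  assumes "k \<in> over g E F"
  shows "g \<in> mor C" "src C g = [po p E]" "tgt C g = po p F" "E \<in> obj D" "F \<in> obj D"
  using overD[OF assms] pm_mor[of k] D.src_obj[of k] D.tgt_obj[of k] by auto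

lemma composable_over: "\<lbrakk>k \<in> over g E F; l \<in> over h F G\<rbrakk> \<Longrightarrow> composable D l 0 k"
  using overD[of k] overD[of l] by (simp add: composable_def)

lemma cmp_over: "\<lbrakk>k \<in> over g E F; l \<in> over h F G\<rbrakk> \<Longrightarrow> l \<cdot> k \<in> over (h \<bullet> g) E G"
  using composable_over[of k g E F l h G] D.comp1_mor[of l 0 k] pm_comp1[of l 0 k] overD[of k] overD[of l]
  by (auto intro!: overI)

lemma cmp_assoc: "\<lbrakk>k \<in> over g E F; l \<in> over h F G; m \<in> over h' G H\<rbrakk> \<Longrightarrow> (m \<cdot> l) \<cdot> k = m \<cdot> (l \<cdot> k)"
  using D.comp1_assoc[of m 0 l 0 k] composable_over[of k g E F l h G] composable_over[of l h F G m h' H]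
  by simp

lemma idn_over: "E \<in> obj D \<Longrightarrow> idn D E \<in> over (idn C (po p E)) E E"
  using D.idn_mor pm_idn by (auto intro!: overI)

lemma cmp_idn: "k \<in> over g E F \<Longrightarrow> k \<cdot> idn D E = k"
  and idn_cmp: "k \<in> over g E F \<Longrightarrow> idn D F \<cdot> k = k"
  using overD[of k] D.comp1_idn_right[of k 0] D.comp1_idn_left[of k] by auto

lemma Hom_functor: "is_functor (Hom D Es F) (Hom C (map (po p) Es) (po p F)) (Hom_functor p)"
proof (rule is_functorI)
  fix k assume "k \<in> Ob (Hom D Es F)"
  then show "fo (Hom_functor p) k \<in> Ob (Hom C (map (po p) Es) (po p F))"
    "fa (Hom_functor p) (Idt (Hom D Es F) k)
      = Idt (Hom C (map (po p) Es) (po p F)) (fo (Hom_functor p) k)"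
    using pm_mor[of k] pc_cidt[of k] by (auto simp: Ob_Hom Hom_functor_def)
next
  fix a k l assume a: "a \<in> hom (Hom D Es F) k l"
  then show "fa (Hom_functor p) a \<in>
      hom (Hom C (map (po p) Es) (po p F)) (fo (Hom_functor p) k) (fo (Hom_functor p) l)"
    using pc_cell[of a] pm_mor[of k] D.cell_mor[of a] by (auto simp: D.hom_Hom C.hom_Hom Hom_functor_def)
  fix b m assume b: "b \<in> hom (Hom D Es F) l m"
  show "fa (Hom_functor p) (Cmp (Hom D Es F) b a)
      = Cmp (Hom C (map (po p) Es) (po p F)) (fa (Hom_functor p) b) (fa (Hom_functor p) a)"
    using pc_vcmp[of a b] a b by (auto simp: D.hom_Hom Hom_functor_def)
qed (rule D.Hom_category C.Hom_category)+

lemma Hom_over_category: "category (Hom_over D C p g Es F)"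
proof -
  interpret H: category "Hom D Es F" by (rule D.Hom_category)
  have m: "k \<in> mor D \<Longrightarrow> pm p k \<in> mor C" for k using pm_mor by blast
  note ax = H.Cmp_Ar H.Dom_Cmp H.Cod_Cmp H.Cmp_Idt H.Idt_Cmp H.Cmp_assoc
  show ?thesis
    by unfold_locales
      (use ax in \<open>auto simp: Hom_over_def Hom_def Let_def pc_cidt pc_vcmp C.vcmp_cidt m\<close>)
qed

lemma hom_Hom_over: "a \<in> hom (Hom_over D C p g Es F) k l \<longleftrightarrow>
    a \<in> hom (Hom D Es F) k l \<and> pm p k = g \<and> pm p l = g \<and> pc p a = cidt C g"
  by (auto simp: hom_def Hom_over_def Hom_def Let_def)

text \<open>Plays the role of equality of arrows in fibers. The base 1-morphism, the sources and the
  target are read off from \<open>k\<close>, which spares the relation all indices.\<close>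

definition sim (infix "\<simeq>" 50) where
  "k \<simeq> l \<longleftrightarrow> isomorphic (Hom_over D C p (pm p k) (src D k) (tgt D k)) k l"

lemma simD: "k \<simeq> l \<Longrightarrow> k \<in> mor D \<and> l \<in> mor D \<and> src D l = src D k \<and> tgt D l = tgt D k \<and> pm p l = pm p k"
  by (auto simp: sim_def isomorphic_def Hom_over_def Let_def hom_def)

lemma sim_refl: "k \<in> mor D \<Longrightarrow> k \<simeq> k"
  unfolding sim_def by (rule category.isomorphic_refl[OF Hom_over_category]) (simp add: Hom_over_def Let_def)

lemma sim_sym: "k \<simeq> l \<Longrightarrow> l \<simeq> k"
  using simD[of k l] category.isomorphic_sym[OF Hom_over_category] by (simp add: sim_def)

lemma sim_trans [trans]: "\<lbrakk>k \<simeq> l; l \<simeq> m\<rbrakk> \<Longrightarrow> k \<simeq> m"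
  using simD[of k l] category.isomorphic_trans[OF Hom_over_category] by (simp add: sim_def)

lemma sim_over: "\<lbrakk>k \<simeq> l; k \<in> over g E F\<rbrakk> \<Longrightarrow> l \<in> over g E F"
  using simD[of k l] overD[of k] by (auto intro!: overI)

lemma isomorphic_over: "k \<in> over g E F \<Longrightarrow> isomorphic (Hom_over D C p g [E] F) k l \<longleftrightarrow> k \<simeq> l"
  using overD[of k] by (simp add: sim_def)

lemma iso_class_eq: "iso_class D C p k = {l. k \<simeq> l}"
  by (simp add: iso_class_def sim_def)

text \<open>Invertibility is asked for in the Hom category of \<open>D\<close> only; that the
  inverse lies over an identity as well is \<open>iso_lift_over_identity\<close>.\<close>

lemma simI:
  assumes u: "u \<in> hom (Hom D Es F) k l" "is_iso (Hom D Es F) u" "pc p u = cidt C (pm p k)"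
  shows "k \<simeq> l"
proof -
  interpret H: category "Hom D Es F" by (rule D.Hom_category)
  obtain v where v: "v \<in> hom (Hom D Es F) l k" "vcmp D v u = cidt D k" "vcmp D u v = cidt D l"
    using H.iso_inverse[OF u(1,2)] by auto
  have kl: "k \<in> mor D" "l \<in> mor D" "src D k = Es" "tgt D k = F" "src D l = Es" "tgt D l = F"
    using u(1) v(1) D.cell_mor by (auto simp: D.hom_Hom)
  have "pm p k = pm p l"
    using u pc_cell[of u] pm_mor[OF kl(1)] by (simp add: D.hom_Hom)
  then have "pc p v = cidt C (pm p k)"
    using iso_lift_over_identity[OF Hom_functor u(1,2), of "pm p k"] u(3) v by (simp add: Hom_functor_def)
  then have "u \<in> hom (Hom_over D C p (pm p k) Es F) k l" "v \<in> hom (Hom_over D C p (pm p k) Es F) l k"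
    using u v \<open>pm p k = pm p l\<close> by (simp_all add: hom_Hom_over)
  then show ?thesis
    unfolding sim_def isomorphic_def kl using v category.is_iso_iff[OF Hom_over_category]
    by (intro bexI[of _ u]) (auto simp: Hom_over_def Let_def)
qed

lemma simE:
  assumes "k \<simeq> l"
  obtains u where "u \<in> hom (Hom D (src D k) (tgt D k)) k l" "is_iso (Hom D (src D k) (tgt D k)) u"
    "pc p u = cidt C (pm p k)"
proof -
  let ?H = "Hom_over D C p (pm p k) (src D k) (tgt D k)"
  obtain u where u: "u \<in> hom ?H k l" "is_iso ?H u"
    using assms by (auto simp: sim_def isomorphic_def)
  then obtain v where v: "v \<in> hom ?H l k" "Cmp ?H v u = Idt ?H k" "Cmp ?H u v = Idt ?H l"
    using category.iso_inverse[OF Hom_over_category] by metis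
  have hom: "a \<in> hom (Hom D (src D k) (tgt D k)) x y" if "a \<in> hom ?H x y" for a x y
    using that by (simp add: hom_Hom_over)
  have "is_iso (Hom D (src D k) (tgt D k)) u"
    unfolding category.is_iso_iff[OF D.Hom_category hom[OF u(1)]]
    using hom[OF v(1)] v by (auto simp: Hom_over_def Let_def)
  moreover have "pc p u = cidt C (pm p k)"
    using u(1) by (simp add: hom_Hom_over)
  ultimately show ?thesis using that hom[OF u(1)] by blast
qed

lemma sim_cmp:
  assumes k: "k \<simeq> k'" and l: "l \<simeq> l'" and c: "composable D l 0 k"
  shows "l \<cdot> k \<simeq> l' \<cdot> k'"
proof -
  obtain u where u: "u \<in> hom (Hom D (src D k) (tgt D k)) k k'" "is_iso (Hom D (src D k) (tgt D k)) u"
    "pc p u = cidt C (pm p k)" using simE[OF k] .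
  obtain v where v: "v \<in> hom (Hom D (src D l) (tgt D l)) l l'" "is_iso (Hom D (src D l) (tgt D l)) v"
    "pc p v = cidt C (pm p l)" using simE[OF l] .
  have "composable C (pm p l) 0 (pm p k)"
    using c pm_mor[of k] pm_mor[of l] by (auto simp: composable_def)
  moreover have "composable2 D v 0 u"
    using u v c by (auto simp: composable2_def D.hom_Hom)
  ultimately have "pc p (comp2 D v 0 u) = cidt C (pm p (l \<cdot> k))"
    using u v c C.comp2_cidt by (simp add: pc_comp2 pm_comp1)
  then show ?thesis
    using simI D.hom_comp2[OF u(1) v(1) c] D.comp2_is_iso[OF u(1,2) v(1,2) c] by blast
qed

text \<open>Of the 2-Cartesian squares only the bijections on isomorphism classes over a fixed
  1-morphism are used.\<close>

definition cocart where
  "cocart f E F \<xi> \<longleftrightarrow> \<xi> \<in> over f E F \<and>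
     (\<forall>c \<in> mor C. \<forall>H \<in> obj D. src C c = [po p F] \<and> tgt C c = po p H \<longrightarrow>
        (\<forall>b \<in> over (c \<bullet> f) E H. \<exists>k \<in> over c F H. k \<cdot> \<xi> \<simeq> b) \<and>
        (\<forall>k \<in> over c F H. \<forall>l \<in> over c F H. k \<cdot> \<xi> \<simeq> l \<cdot> \<xi> \<longrightarrow> k \<simeq> l))"

definition cart where
  "cart f E F \<zeta> \<longleftrightarrow> \<zeta> \<in> over f E F \<and>
     (\<forall>c \<in> mor C. \<forall>H \<in> obj D. src C c = [po p H] \<and> tgt C c = po p E \<longrightarrow>
        (\<forall>b \<in> over (f \<bullet> c) H F. \<exists>k \<in> over c H E. \<zeta> \<cdot> k \<simeq> b) \<and>
        (\<forall>k \<in> over c H E. \<forall>l \<in> over c H E. \<zeta> \<cdot> k \<simeq> \<zeta> \<cdot> l \<longrightarrow> k \<simeq> l))"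

text \<open>The square for unary 1-morphisms suffices, that is \<open>Fs = [F]\<close> and slot 0.
  The two halves of \<open>cocart\<close> are \<open>lift_object\<close> and
  \<open>lift_isomorphism\<close> for it; the first depends on \<open>iso\<close> in order to have
  \<open>k\<close> exactly over \<open>c\<close>.\<close>

lemma cocartesian1_cocart:
  assumes iso: "\<And>Es F. \<lbrakk>set Es \<subseteq> obj D; F \<in> obj D\<rbrakk>
      \<Longrightarrow> isofibration (Hom D Es F) (Hom C (map (po p) Es) (po p F)) (Hom_functor p)"
    and \<xi>: "\<xi> \<in> over f E F" "cocartesian1 D C p \<xi>"
  shows "cocart f E F \<xi>"
  unfolding cocart_def
proof (intro conjI ballI impI)
  show "\<xi> \<in> over f E F" by fact
  note x = overD[OF \<xi>(1)] and o = over_base[OF \<xi>(1)]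
  fix c H assume c: "c \<in> mor C" and H: "H \<in> obj D" and cH: "src C c = [po p F] \<and> tgt C c = po p H"
  interpret Q: cartesian_square "Hom D [F] H" "Hom D [E] H" "Hom C [po p F] (po p H)" "Hom C [po p E] (po p H)"
    "precomp D 0 \<xi>" "Hom_functor p" "Hom_functor p" "precomp C 0 f"
  proof
    show "is_functor (Hom D [F] H) (Hom D [E] H) (precomp D 0 \<xi>)"
      using D.precomp_functor[of \<xi> 0 "[F]" H] x by simp
    show "isofibration (Hom D [F] H) (Hom C [po p F] (po p H)) (Hom_functor p)"
      using iso[of "[F]" H] o H by simp
    show "is_functor (Hom D [E] H) (Hom C [po p E] (po p H)) (Hom_functor p)"
      using Hom_functor[of "[E]" H] by simp
    show "is_functor (Hom C [po p F] (po p H)) (Hom C [po p E] (po p H)) (precomp C 0 f)"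
      using C.precomp_functor[of f 0 "[po p F]" "po p H"] o by simp
    show "two_cartesian (Hom D [F] H) (Hom D [E] H) (Hom C [po p F] (po p H)) (Hom C [po p E] (po p H))
        (precomp D 0 \<xi>) (Hom_functor p) (Hom_functor p) (precomp C 0 f)"
      using \<xi>(2) x o H unfolding cocartesian1_def Let_def
      by (auto dest!: spec[of _ "[F]"] spec[of _ "0::nat"] spec[of _ H])
    fix a assume "a \<in> Ob (Hom D [F] H)"
    then show "fo (Hom_functor p) (fo (precomp D 0 \<xi>) a) = fo (precomp C 0 f) (fo (Hom_functor p) a)"
      using x pm_comp1[of a 0 \<xi>] by (simp add: Hom_functor_def precomp_def Ob_Hom composable_def)
  next
    fix b a a' assume "b \<in> hom (Hom D [F] H) a a'"
    then show "fa (Hom_functor p) (fa (precomp D 0 \<xi>) b) = fa (precomp C 0 f) (fa (Hom_functor p) b)"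
      using x pc_comp2[of b 0 "cidt D \<xi>"] D.cell_mor[of b]
      by (auto simp: Hom_functor_def precomp_def D.hom_Hom composable2_def composable_def pc_cidt)
  qed
  {
    fix b assume b: "b \<in> over (c \<bullet> f) E H"
    then obtain k u where "k \<in> Ob (Hom D [F] H)" "pm p k = c" "u \<in> hom (Hom D [E] H) (k \<cdot> \<xi>) b"
      "is_iso (Hom D [E] H) u" "pc p u = cidt C (pm p b)"
      using Q.lift_object[of b c] overD[OF b] c cH
      by (auto simp: Ob_Hom Hom_functor_def precomp_def)
    moreover have "pm p b = pm p (k \<cdot> \<xi>)"
      using calculation overD[OF b] x by (subst pm_comp1) (auto simp: Ob_Hom composable_def)
    ultimately show "\<exists>k \<in> over c F H. k \<cdot> \<xi> \<simeq> b"
      using simI by (metis Ob_Hom overI)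
  next
    fix k l assume k: "k \<in> over c F H" and l: "l \<in> over c F H" and s: "k \<cdot> \<xi> \<simeq> l \<cdot> \<xi>"
    have ks: "k \<cdot> \<xi> \<in> over (c \<bullet> f) E H" using cmp_over[OF \<xi>(1) k] .
    obtain u where u: "u \<in> hom (Hom D [E] H) (k \<cdot> \<xi>) (l \<cdot> \<xi>)" "is_iso (Hom D [E] H) u"
      "pc p u = cidt C (c \<bullet> f)"
      using simE[OF s] overD[OF ks] by auto
    then obtain v where "v \<in> hom (Hom D [F] H) k l" "is_iso (Hom D [F] H) v" "pc p v = cidt C c"
      using Q.lift_isomorphism[of k l c u] overD[OF k] overD[OF l]
      by (auto simp: Ob_Hom Hom_functor_def precomp_def)
    then show "k \<simeq> l" using simI overD[OF k] by metis
  }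
qed

text \<open>Dual to \<open>cocartesian1_cocart\<close>, with composition after
  \<open>\<zeta>\<close> and the single source \<open>Gs = [H]\<close>.\<close>

lemma cartesian1_cart:
  assumes iso: "\<And>Es F. \<lbrakk>set Es \<subseteq> obj D; F \<in> obj D\<rbrakk>
      \<Longrightarrow> isofibration (Hom D Es F) (Hom C (map (po p) Es) (po p F)) (Hom_functor p)"
    and \<zeta>: "\<zeta> \<in> over f E F" "cartesian1 D C p 0 \<zeta>"
  shows "cart f E F \<zeta>"
  unfolding cart_def
proof (intro conjI ballI impI)
  show "\<zeta> \<in> over f E F" by fact
  note x = overD[OF \<zeta>(1)] and o = over_base[OF \<zeta>(1)]
  fix c H assume c: "c \<in> mor C" and H: "H \<in> obj D" and cH: "src C c = [po p H] \<and> tgt C c = po p E"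
  interpret Q: cartesian_square "Hom D [H] E" "Hom D [H] F" "Hom C [po p H] (po p E)" "Hom C [po p H] (po p F)"
    "postcomp D \<zeta> 0" "Hom_functor p" "Hom_functor p" "postcomp C f 0"
  proof
    show "is_functor (Hom D [H] E) (Hom D [H] F) (postcomp D \<zeta> 0)"
      using D.postcomp_functor[of \<zeta> 0 "[H]"] x by simp
    show "isofibration (Hom D [H] E) (Hom C [po p H] (po p E)) (Hom_functor p)"
      using iso[of "[H]" E] o H by simp
    show "is_functor (Hom D [H] F) (Hom C [po p H] (po p F)) (Hom_functor p)"
      using Hom_functor[of "[H]" F] by simp
    show "is_functor (Hom C [po p H] (po p E)) (Hom C [po p H] (po p F)) (postcomp C f 0)"
      using C.postcomp_functor[of f 0 "[po p H]"] o by simp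
    show "two_cartesian (Hom D [H] E) (Hom D [H] F) (Hom C [po p H] (po p E)) (Hom C [po p H] (po p F))
        (postcomp D \<zeta> 0) (Hom_functor p) (Hom_functor p) (postcomp C f 0)"
      using \<zeta>(2) x o H unfolding cartesian1_def Let_def
      by (auto dest!: spec[of _ "[H]"])
    fix a assume "a \<in> Ob (Hom D [H] E)"
    then show "fo (Hom_functor p) (fo (postcomp D \<zeta> 0) a) = fo (postcomp C f 0) (fo (Hom_functor p) a)"
      using x pm_comp1[of \<zeta> 0 a] by (simp add: Hom_functor_def postcomp_def Ob_Hom composable_def)
  next
    fix b a a' assume "b \<in> hom (Hom D [H] E) a a'"
    then show "fa (Hom_functor p) (fa (postcomp D \<zeta> 0) b) = fa (postcomp C f 0) (fa (Hom_functor p) b)"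
      using x pc_comp2[of "cidt D \<zeta>" 0 b] D.cell_mor[of b]
      by (auto simp: Hom_functor_def postcomp_def D.hom_Hom composable2_def composable_def pc_cidt)
  qed
  {
    fix b assume b: "b \<in> over (f \<bullet> c) H F"
    then obtain k u where "k \<in> Ob (Hom D [H] E)" "pm p k = c" "u \<in> hom (Hom D [H] F) (\<zeta> \<cdot> k) b"
      "is_iso (Hom D [H] F) u" "pc p u = cidt C (pm p b)"
      using Q.lift_object[of b c] overD[OF b] c cH
      by (auto simp: Ob_Hom Hom_functor_def postcomp_def)
    moreover have "pm p b = pm p (\<zeta> \<cdot> k)"
      using calculation overD[OF b] x by (subst pm_comp1) (auto simp: Ob_Hom composable_def)
    ultimately show "\<exists>k \<in> over c H E. \<zeta> \<cdot> k \<simeq> b"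
      using simI by (metis Ob_Hom overI)
  next
    fix k l assume k: "k \<in> over c H E" and l: "l \<in> over c H E" and s: "\<zeta> \<cdot> k \<simeq> \<zeta> \<cdot> l"
    have ks: "\<zeta> \<cdot> k \<in> over (f \<bullet> c) H F" using cmp_over[OF k \<zeta>(1)] .
    obtain u where u: "u \<in> hom (Hom D [H] F) (\<zeta> \<cdot> k) (\<zeta> \<cdot> l)" "is_iso (Hom D [H] F) u"
      "pc p u = cidt C (f \<bullet> c)"
      using simE[OF s] overD[OF ks] by auto
    then obtain v where "v \<in> hom (Hom D [H] E) k l" "is_iso (Hom D [H] E) v" "pc p v = cidt C c"
      using Q.lift_isomorphism[of k l c u] overD[OF k] overD[OF l]
      by (auto simp: Ob_Hom Hom_functor_def postcomp_def)
    then show "k \<simeq> l" using simI overD[OF k] by metis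
  }
qed

end

section \<open>Fibers, push-forward and pull-back\<close>

lemma comp_ftor_functor: "\<lbrakk>is_functor A B F; is_functor B E G\<rbrakk> \<Longrightarrow> is_functor A E (comp_ftor G F)"
  by (rule is_functorI) (auto simp: comp_ftor_def is_functorD intro: is_functorD)

lemma id_ftor_functor: "category A \<Longrightarrow> is_functor A A id_ftor"
  by (rule is_functorI) (auto simp: id_ftor_def)

lemma Ob_fiber: "Ob (fiber D C p X) = fiber_obj D p X"
  by (simp add: fiber_def)

lemma fo_push [simp]: "fo (push D C p f \<xi>) E = tgt D (\<xi> E)"
  and fo_pull [simp]: "fo (pull D C p f \<zeta>) F = hd (src D (\<zeta> F))"
  by (simp_all add: push_def pull_def)

context two_multicategory
begin

lemma comp1_idn: "\<lbrakk>f \<in> mor M; src M f = [X]\<rbrakk> \<Longrightarrow> comp1 M f 0 (idn M X) = f"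
  and idn_comp1: "\<lbrakk>f \<in> mor M; tgt M f = Y\<rbrakk> \<Longrightarrow> comp1 M (idn M Y) 0 f = f"
  using comp1_idn_right[of f 0] comp1_idn_left[of f] by auto

end

context strict_functor
begin

text \<open>Together with \<open>seq_assoc\<close>, these rules let the simplifier check sources and
  targets and rebracket unary composites, given the facts collected under names such as
  \<open>simps\<close>.\<close>

lemma seq [simp]:
  assumes "l \<in> mor D" "k \<in> mor D" "src D l = [tgt D k]"
  shows "l \<cdot> k \<in> mor D" "src D (l \<cdot> k) = src D k" "tgt D (l \<cdot> k) = tgt D l"
    "pm p (l \<cdot> k) = pm p l \<bullet> pm p k"
  using assms D.comp1_mor[of l 0 k] pm_comp1[of l 0 k] by (auto simp: composable_def)

lemma seq_assoc [simp]:
  assumes "m \<in> mor D" "l \<in> mor D" "k \<in> mor D" "src D m = [tgt D l]" "src D l = [tgt D k]"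
  shows "(m \<cdot> l) \<cdot> k = m \<cdot> (l \<cdot> k)"
  using assms D.comp1_assoc[of m 0 l 0 k] by (auto simp: composable_def)

lemma sim_cong:
  assumes "k \<simeq> k'" "l \<simeq> l'" "src D l = [tgt D k]"
  shows "l \<cdot> k \<simeq> l' \<cdot> k'"
  using assms sim_cmp[OF assms(1,2)] simD[OF assms(1)] simD[OF assms(2)] by (simp add: composable_def)

lemma sim_cong_left: "\<lbrakk>l \<simeq> l'; k \<in> mor D; src D l = [tgt D k]\<rbrakk> \<Longrightarrow> l \<cdot> k \<simeq> l' \<cdot> k"
  and sim_cong_right: "\<lbrakk>k \<simeq> k'; l \<in> mor D; src D l = [tgt D k]\<rbrakk> \<Longrightarrow> l \<cdot> k \<simeq> l \<cdot> k'"
  using sim_cong sim_refl by blast+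

abbreviation "cls \<equiv> iso_class D C p"

lemma mem_cls: "l \<in> cls k \<longleftrightarrow> k \<simeq> l"
  by (simp add: iso_class_eq)

lemma cls_eq: "k \<in> mor D \<Longrightarrow> cls k = cls l \<longleftrightarrow> k \<simeq> l"
  using sim_refl sim_sym sim_trans unfolding iso_class_eq by blast

lemma some_cls: "k \<in> mor D \<Longrightarrow> k \<simeq> (SOME l. l \<in> cls k)"
  using someI[of "\<lambda>l. l \<in> cls k" k] sim_refl by (simp add: mem_cls)

lemma fiber_objD: "E \<in> fiber_obj D p X \<Longrightarrow> E \<in> obj D \<and> po p E = X"
  by (simp add: fiber_obj_def)

lemma vertD:
  assumes "X \<in> obj C" "k \<in> over (idn C X) E F"
  shows "k \<in> mor D" "src D k = [E]" "tgt D k = F" "pm p k = idn C X" "E \<in> fiber_obj D p X" "F \<in> fiber_obj D p X"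
  using overD[OF assms(2)] over_base[OF assms(2)] C.idn_mor[OF assms(1)] by (auto simp: fiber_obj_def)

lemma idn_vert: "E \<in> fiber_obj D p X \<Longrightarrow> idn D E \<in> over (idn C X) E E"
  using idn_over fiber_objD by metis

lemma cmp_vert:
  assumes "X \<in> obj C" "k \<in> over (idn C X) E F" "l \<in> over (idn C X) F G"
  shows "l \<cdot> k \<in> over (idn C X) E G"
  using cmp_over[OF assms(2,3)] C.comp1_idn C.idn_mor assms(1) by simp

lemma Ar_fiber:
  assumes X: "X \<in> obj C"
  shows "A \<in> Ar (fiber D C p X) \<longleftrightarrow> (\<exists>E F. \<exists>k \<in> over (idn C X) E F. A = cls k)"
  using vertD(5,6)[OF X] by (simp add: fiber_def) blast

lemma Dom_Cod_fiber:
  assumes "k \<in> over g E F"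
  shows "Dom (fiber D C p X) (cls k) = E" "Cod (fiber D C p X) (cls k) = F"
  using overD[OF assms] simD[OF some_cls] by (auto simp: fiber_def)

lemma hom_fiber:
  assumes X: "X \<in> obj C"
  shows "A \<in> hom (fiber D C p X) E F \<longleftrightarrow> (\<exists>k \<in> over (idn C X) E F. A = cls k)"
  unfolding hom_def using Ar_fiber[OF X] Dom_Cod_fiber by auto

lemma cls_hom: "\<lbrakk>X \<in> obj C; k \<in> over (idn C X) E F\<rbrakk> \<Longrightarrow> cls k \<in> hom (fiber D C p X) E F"
  using hom_fiber by blast

lemma Idt_fiber: "Idt (fiber D C p X) E = cls (idn D E)"
  by (simp add: fiber_def)

text \<open>Composition in \<open>fiber\<close> uses representatives picked by \<open>SOME\<close>;
  as \<open>\<simeq>\<close> is a congruence, any others may be taken.\<close>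

lemma Cmp_fiber:
  assumes "k \<in> over g E F" "l \<in> over h F G"
  shows "Cmp (fiber D C p X) (cls l) (cls k) = cls (l \<cdot> k)"
proof -
  have k: "k \<simeq> (SOME k'. k' \<in> cls k)" and l: "l \<simeq> (SOME l'. l' \<in> cls l)"
    using some_cls overD assms by metis+
  then have "l \<cdot> k \<simeq> (SOME l'. l' \<in> cls l) \<cdot> (SOME k'. k' \<in> cls k)"
    using sim_cong overD[OF assms(1)] overD[OF assms(2)] by simp
  then show ?thesis
    using cls_eq simD by (simp add: fiber_def) metis
qed

lemma category_fiber:
  assumes X: "X \<in> obj C"
  shows "category (fiber D C p X)" (is "category ?F")
proof
  note homD = hom_fiber[OF X] and ch = cls_hom[OF X] and V = vertD[OF X]
  have arr: "\<exists>k. k \<in> over (idn C X) (Dom ?F A) (Cod ?F A) \<and> A = cls k" if "A \<in> Ar ?F" for A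
    using that homD[of A "Dom ?F A" "Cod ?F A"] by (auto simp: hom_def)
  {
    fix A assume "A \<in> Ar ?F"
    then obtain k where k: "k \<in> over (idn C X) (Dom ?F A) (Cod ?F A)" "A = cls k" using arr by blast
    show "Dom ?F A \<in> Ob ?F" "Cod ?F A \<in> Ob ?F"
      using V(5,6)[OF k(1)] by (simp_all add: Ob_fiber)
    show "Cmp ?F A (Idt ?F (Dom ?F A)) = A" "Cmp ?F (Idt ?F (Cod ?F A)) A = A"
      using k Cmp_fiber[OF idn_vert[OF V(5)[OF k(1)]] k(1)] Cmp_fiber[OF k(1) idn_vert[OF V(6)[OF k(1)]]]
        cmp_idn[OF k(1)] idn_cmp[OF k(1)] by (metis Idt_fiber)+
    fix B assume "B \<in> Ar ?F" and AB: "Cod ?F A = Dom ?F B"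
    then obtain l where l: "l \<in> over (idn C X) (Cod ?F A) (Cod ?F B)" "B = cls l" using arr by metis
    have c: "Cmp ?F B A = cls (l \<cdot> k)"
      using Cmp_fiber[OF k(1) l(1)] k(2) l(2) by simp
    show "Cmp ?F B A \<in> Ar ?F" "Dom ?F (Cmp ?F B A) = Dom ?F A" "Cod ?F (Cmp ?F B A) = Cod ?F B"
      unfolding c using ch[OF cmp_vert[OF X k(1) l(1)]] by (simp_all add: hom_def)
    fix H assume "H \<in> Ar ?F" and BH: "Cod ?F B = Dom ?F H"
    then obtain m where m: "m \<in> over (idn C X) (Cod ?F B) (Cod ?F H)" "H = cls m" using arr by metis
    show "Cmp ?F H (Cmp ?F B A) = Cmp ?F (Cmp ?F H B) A"
      using Cmp_fiber[OF cmp_over[OF k(1) l(1)] m(1)] Cmp_fiber[OF k(1) cmp_over[OF l(1) m(1)]]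
        Cmp_fiber[OF l(1) m(1)] c k(2) l(2) m(2) cmp_assoc[OF k(1) l(1) m(1)] by simp
  next
    fix E assume "E \<in> Ob ?F"
    then have "Idt ?F E \<in> hom ?F E E"
      using ch[OF idn_vert] by (simp add: Ob_fiber Idt_fiber)
    then show "Idt ?F E \<in> Ar ?F" "Dom ?F (Idt ?F E) = E" "Cod ?F (Idt ?F E) = E"
      by (simp_all add: hom_def)
  }
qed

lemma cocartD:
  assumes "cocart f E F \<xi>"
  shows "\<xi> \<in> mor D" "src D \<xi> = [E]" "tgt D \<xi> = F" "pm p \<xi> = f"
    and "\<lbrakk>c \<in> mor C; H \<in> obj D; src C c = [po p F]; tgt C c = po p H; b \<in> over (c \<bullet> f) E H\<rbrakk>
      \<Longrightarrow> \<exists>k \<in> over c F H. k \<cdot> \<xi> \<simeq> b"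
    and "\<lbrakk>k \<in> over c F H; l \<in> over c F H; k \<cdot> \<xi> \<simeq> l \<cdot> \<xi>\<rbrakk> \<Longrightarrow> k \<simeq> l"
  using assms overD[of \<xi>] over_base[of k c F H] unfolding cocart_def by blast+

lemma cartD:
  assumes "cart f E F \<zeta>"
  shows "\<zeta> \<in> mor D" "src D \<zeta> = [E]" "tgt D \<zeta> = F" "pm p \<zeta> = f"
    and "\<lbrakk>c \<in> mor C; H \<in> obj D; src C c = [po p H]; tgt C c = po p E; b \<in> over (f \<bullet> c) H F\<rbrakk>
      \<Longrightarrow> \<exists>k \<in> over c H E. \<zeta> \<cdot> k \<simeq> b"
    and "\<lbrakk>k \<in> over c H E; l \<in> over c H E; \<zeta> \<cdot> k \<simeq> \<zeta> \<cdot> l\<rbrakk> \<Longrightarrow> k \<simeq> l"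
  using assms overD[of \<zeta>] over_base[of k c H E] unfolding cart_def by blast+

end

section \<open>Functoriality of push-forward and pull-back along a unary 1-morphism\<close>

locale push_pull = strict_functor D C p
  for D :: "('o, 'f, 't) mcat2" and C :: "('o2, 'f2, 't2) mcat2" and p +
  fixes X Y :: 'o2 and f :: 'f2
  assumes X: "X \<in> obj C" and Y: "Y \<in> obj C"
    and f: "f \<in> mor C" "src C f = [X]" "tgt C f = Y"
begin

lemma f_idn [simp]: "f \<bullet> idn C X = f" "idn C Y \<bullet> f = f"
  using f C.comp1_idn C.idn_comp1 by blast+

lemmas idn_C = C.idn_mor[OF X] C.idn_mor[OF Y]
lemmas vX = vertD[OF X] and vY = vertD[OF Y]

context
  fixes \<xi> assumes \<xi>: "\<And>E. E \<in> fiber_obj D p X \<Longrightarrow> cocart f E (tgt D (\<xi> E)) (\<xi> E)"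
begin

lemma push_obj: "E \<in> fiber_obj D p X \<Longrightarrow> tgt D (\<xi> E) \<in> fiber_obj D p Y"
  using cocartD(1,4)[OF \<xi>] pm_mor[of "\<xi> E"] D.tgt_obj[of "\<xi> E"] f by (simp add: fiber_obj_def)

lemma push_ex:
  assumes k: "k \<in> over (idn C X) E E'"
  shows "\<exists>k' \<in> over (idn C Y) (tgt D (\<xi> E)) (tgt D (\<xi> E')). k' \<cdot> \<xi> E \<simeq> \<xi> E' \<cdot> k"
proof -
  note c = \<xi>[OF vX(5)[OF k]] and c' = \<xi>[OF vX(6)[OF k]]
  have "\<xi> E' \<cdot> k \<in> over (idn C Y \<bullet> f) E (tgt D (\<xi> E'))"
    using cocartD[OF c'] vX[OF k] by (intro overI) simp_all
  then show ?thesis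
    using cocartD(5)[OF c, of "idn C Y" "tgt D (\<xi> E')"] push_obj[OF vX(5)[OF k]] push_obj[OF vX(6)[OF k]] idn_C
      fiber_objD by metis
qed

text \<open>Evaluates the definite description in \<open>push\<close>. A competing class contains a
  1-morphism whose composite with \<open>\<xi> E\<close> is the same up to \<open>\<simeq>\<close>,
  and the injectivity half of \<open>cocart\<close> cancels \<open>\<xi> E\<close>.\<close>

lemma push_arr:
  assumes k: "k \<in> over (idn C X) E E'" and k': "k' \<in> over (idn C Y) (tgt D (\<xi> E)) (tgt D (\<xi> E'))"
    and s: "k' \<cdot> \<xi> E \<simeq> \<xi> E' \<cdot> k"
  shows "fa (push D C p f \<xi>) (cls k) = cls k'"
proof -
  note c = \<xi>[OF vX(5)[OF k]] and c' = \<xi>[OF vX(6)[OF k]]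
  note simps = cocartD(1-4)[OF c] cocartD(1-4)[OF c'] vX[OF k]
  have o: "\<xi> E' \<cdot> k \<in> over f E (tgt D (\<xi> E'))" "l \<in> over (idn C Y) (tgt D (\<xi> E)) (tgt D (\<xi> E')) \<Longrightarrow>
      l \<cdot> \<xi> E \<in> over f E (tgt D (\<xi> E'))" for l
    using simps vY[of l] by (intro overI; simp)+
  have "(THE B. B \<in> hom (fiber D C p Y) (tgt D (\<xi> E)) (tgt D (\<xi> E')) \<and>
      (\<exists>k0 \<in> cls k. \<exists>l \<in> B. isomorphic (Hom_over D C p f [E] (tgt D (\<xi> E'))) (l \<cdot> \<xi> E) (\<xi> E' \<cdot> k0))) = cls k'"
  proof (rule the_equality)
    show "cls k' \<in> hom (fiber D C p Y) (tgt D (\<xi> E)) (tgt D (\<xi> E')) \<and>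
      (\<exists>k0 \<in> cls k. \<exists>l \<in> cls k'. isomorphic (Hom_over D C p f [E] (tgt D (\<xi> E'))) (l \<cdot> \<xi> E) (\<xi> E' \<cdot> k0))"
      using cls_hom[OF Y k'] sim_refl vX(1)[OF k] vY(1)[OF k'] s isomorphic_over[OF o(2)[OF k']]
      by (intro conjI bexI[of _ k] bexI[of _ k']) (simp_all add: mem_cls)
  next
    fix B assume "B \<in> hom (fiber D C p Y) (tgt D (\<xi> E)) (tgt D (\<xi> E')) \<and>
      (\<exists>k0 \<in> cls k. \<exists>l \<in> B. isomorphic (Hom_over D C p f [E] (tgt D (\<xi> E'))) (l \<cdot> \<xi> E) (\<xi> E' \<cdot> k0))"
    then obtain l k0 l0 where l: "l \<in> over (idn C Y) (tgt D (\<xi> E)) (tgt D (\<xi> E'))" "B = cls l"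
      and k0: "k \<simeq> k0" and l0: "l \<simeq> l0"
      and i: "isomorphic (Hom_over D C p f [E] (tgt D (\<xi> E'))) (l0 \<cdot> \<xi> E) (\<xi> E' \<cdot> k0)"
      by (auto simp: hom_fiber[OF Y] mem_cls)
    have "l \<cdot> \<xi> E \<simeq> l0 \<cdot> \<xi> E"
      using sim_cong_left[OF l0] simps vY[OF l(1)] by simp
    also have "\<dots> \<simeq> \<xi> E' \<cdot> k0"
      using i isomorphic_over[OF o(2)[OF sim_over[OF l0 l(1)]]] by simp
    also have "\<dots> \<simeq> \<xi> E' \<cdot> k"
      using sim_cong_right[OF sim_sym[OF k0]] simps simD[OF k0] by simp
    also have "\<dots> \<simeq> k' \<cdot> \<xi> E" using s by (rule sim_sym)
    finally have "l \<simeq> k'" using cocartD(6)[OF c l(1) k'] by blast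
    then show "B = cls k'" using l cls_eq vY by simp
  qed
  then show ?thesis
    using f Dom_Cod_fiber[OF k] by (simp add: push_def Let_def)
qed

text \<open>Pasting of the squares \<open>k' \<cdot> \<xi> E \<simeq> \<xi> E' \<cdot> k\<close>;
  strict associativity of \<open>D\<close> makes all rebracketings equalities.\<close>

lemma push_functor: "is_functor (fiber D C p X) (fiber D C p Y) (push D C p f \<xi>)"
proof (rule is_functorI)
  fix E assume "E \<in> Ob (fiber D C p X)"
  then have E: "E \<in> fiber_obj D p X" by (simp add: Ob_fiber)
  then show "fo (push D C p f \<xi>) E \<in> Ob (fiber D C p Y)" using push_obj by (simp add: Ob_fiber)
  note c = cocartD[OF \<xi>[OF E]]
  have "idn D (tgt D (\<xi> E)) \<cdot> \<xi> E = \<xi> E" "\<xi> E \<cdot> idn D E = \<xi> E"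
    using c D.comp1_idn D.idn_comp1 by blast+
  then show "fa (push D C p f \<xi>) (Idt (fiber D C p X) E) = Idt (fiber D C p Y) (fo (push D C p f \<xi>) E)"
    unfolding Idt_fiber using push_arr[OF idn_vert[OF E] idn_vert[OF push_obj[OF E]]] sim_refl[OF c(1)] by simp
next
  fix u E E' assume "u \<in> hom (fiber D C p X) E E'"
  then obtain k where k: "k \<in> over (idn C X) E E'" "u = cls k" by (auto simp: hom_fiber[OF X])
  obtain k' where k': "k' \<in> over (idn C Y) (tgt D (\<xi> E)) (tgt D (\<xi> E'))" "k' \<cdot> \<xi> E \<simeq> \<xi> E' \<cdot> k"
    using push_ex[OF k(1)] by blast
  have uk: "fa (push D C p f \<xi>) u = cls k'" using push_arr[OF k(1) k'] k by simp
  then show "fa (push D C p f \<xi>) u \<in> hom (fiber D C p Y) (fo (push D C p f \<xi>) E) (fo (push D C p f \<xi>) E')"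
    using cls_hom[OF Y k'(1)] by simp
  fix v E'' assume "v \<in> hom (fiber D C p X) E' E''"
  then obtain l where l: "l \<in> over (idn C X) E' E''" "v = cls l" by (auto simp: hom_fiber[OF X])
  obtain l' where l': "l' \<in> over (idn C Y) (tgt D (\<xi> E')) (tgt D (\<xi> E''))" "l' \<cdot> \<xi> E' \<simeq> \<xi> E'' \<cdot> l"
    using push_ex[OF l(1)] by blast
  note simps = cocartD(1-4)[OF \<xi>[OF vX(5)[OF k(1)]]] cocartD(1-4)[OF \<xi>[OF vX(5)[OF l(1)]]]
    cocartD(1-4)[OF \<xi>[OF vX(6)[OF l(1)]]] vX[OF k(1)] vX[OF l(1)] vY[OF k'(1)] vY[OF l'(1)]
  have "(l' \<cdot> k') \<cdot> \<xi> E = l' \<cdot> (k' \<cdot> \<xi> E)" using simps by simp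
  also have "\<dots> \<simeq> l' \<cdot> (\<xi> E' \<cdot> k)" using sim_cong_right[OF k'(2)] simps by simp
  also have "\<dots> = (l' \<cdot> \<xi> E') \<cdot> k" using simps by simp
  also have "\<dots> \<simeq> (\<xi> E'' \<cdot> l) \<cdot> k"
    by (rule sim_cong_left[OF l'(2)]) (use simps in simp_all)
  also have "\<dots> = \<xi> E'' \<cdot> (l \<cdot> k)" using simps by simp
  finally have "fa (push D C p f \<xi>) (cls (l \<cdot> k)) = cls (l' \<cdot> k')"
    using push_arr[OF cmp_vert[OF X k(1) l(1)] cmp_vert[OF Y k'(1) l'(1)]] by blast
  then show "fa (push D C p f \<xi>) (Cmp (fiber D C p X) v u)
      = Cmp (fiber D C p Y) (fa (push D C p f \<xi>) v) (fa (push D C p f \<xi>) u)"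
    using uk push_arr[OF l(1) l'] k l Cmp_fiber[OF k(1) l(1)] Cmp_fiber[OF k'(1) l'(1)] by simp
qed (rule category_fiber[OF X] category_fiber[OF Y])+

end

context
  fixes \<zeta> assumes \<zeta>: "\<And>E. E \<in> fiber_obj D p Y \<Longrightarrow> cart f (hd (src D (\<zeta> E))) E (\<zeta> E)"
begin

lemma pull_obj:
  assumes E: "E \<in> fiber_obj D p Y"
  shows "hd (src D (\<zeta> E)) \<in> fiber_obj D p X"
proof -
  note c = cartD(1,2,4)[OF \<zeta>[OF E]]
  have "set [hd (src D (\<zeta> E))] \<subseteq> obj D" "map (po p) [hd (src D (\<zeta> E))] = [X]"
    using c(1,3) D.src_obj[of "\<zeta> E"] pm_mor[of "\<zeta> E"] f unfolding c(2)[symmetric] by auto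
  then show ?thesis by (simp add: fiber_obj_def)
qed

lemma pull_ex:
  assumes k: "k \<in> over (idn C Y) E E'"
  shows "\<exists>k' \<in> over (idn C X) (hd (src D (\<zeta> E))) (hd (src D (\<zeta> E'))). \<zeta> E' \<cdot> k' \<simeq> k \<cdot> \<zeta> E"
proof -
  note c = \<zeta>[OF vY(5)[OF k]] and c' = \<zeta>[OF vY(6)[OF k]]
  have "k \<cdot> \<zeta> E \<in> over (f \<bullet> idn C X) (hd (src D (\<zeta> E))) E'"
    using cartD[OF c] vY[OF k] by (intro overI) simp_all
  then show ?thesis
    using cartD(5)[OF c', of "idn C X" "hd (src D (\<zeta> E))"] pull_obj[OF vY(5)[OF k]] pull_obj[OF vY(6)[OF k]] idn_C
      fiber_objD by metis
qed

lemma pull_arr: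
  assumes k: "k \<in> over (idn C Y) E E'" and k': "k' \<in> over (idn C X) (hd (src D (\<zeta> E))) (hd (src D (\<zeta> E')))"
    and s: "\<zeta> E' \<cdot> k' \<simeq> k \<cdot> \<zeta> E"
  shows "fa (pull D C p f \<zeta>) (cls k) = cls k'"
proof -
  let ?s = "\<lambda>E. hd (src D (\<zeta> E))"
  note c = \<zeta>[OF vY(5)[OF k]] and c' = \<zeta>[OF vY(6)[OF k]]
  note simps = cartD(1-4)[OF c] cartD(1-4)[OF c'] vY[OF k]
  have o: "l \<in> over (idn C X) (?s E) (?s E') \<Longrightarrow> \<zeta> E' \<cdot> l \<in> over f (?s E) E'" for l
    using cartD(1,3,4)[OF c'] cartD(2)[OF c'] vX[of l] by (intro overI; simp)
  have "(THE B. B \<in> hom (fiber D C p X) (?s E) (?s E') \<and>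
      (\<exists>k0 \<in> cls k. \<exists>l \<in> B. isomorphic (Hom_over D C p f [?s E] E') (\<zeta> E' \<cdot> l) (k0 \<cdot> \<zeta> E))) = cls k'"
  proof (rule the_equality)
    show "cls k' \<in> hom (fiber D C p X) (?s E) (?s E') \<and>
      (\<exists>k0 \<in> cls k. \<exists>l \<in> cls k'. isomorphic (Hom_over D C p f [?s E] E') (\<zeta> E' \<cdot> l) (k0 \<cdot> \<zeta> E))"
      using cls_hom[OF X k'] sim_refl vY(1)[OF k] vX(1)[OF k'] s isomorphic_over[OF o[OF k']]
      by (intro conjI bexI[of _ k] bexI[of _ k']) (simp_all add: mem_cls)
  next
    fix B assume "B \<in> hom (fiber D C p X) (?s E) (?s E') \<and>
      (\<exists>k0 \<in> cls k. \<exists>l \<in> B. isomorphic (Hom_over D C p f [?s E] E') (\<zeta> E' \<cdot> l) (k0 \<cdot> \<zeta> E))"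
    then obtain l k0 l0 where l: "l \<in> over (idn C X) (?s E) (?s E')" "B = cls l"
      and k0: "k \<simeq> k0" and l0: "l \<simeq> l0"
      and i: "isomorphic (Hom_over D C p f [?s E] E') (\<zeta> E' \<cdot> l0) (k0 \<cdot> \<zeta> E)"
      by (auto simp: hom_fiber[OF X] mem_cls)
    have "src D (\<zeta> E') = [tgt D l]" using cartD(2)[OF c'] vX(3)[OF l(1)] by simp
    then have "\<zeta> E' \<cdot> l \<simeq> \<zeta> E' \<cdot> l0"
      using sim_cong_right[OF l0 cartD(1)[OF c']] by blast
    also have "\<dots> \<simeq> k0 \<cdot> \<zeta> E"
      using i isomorphic_over[OF o[OF sim_over[OF l0 l(1)]]] by simp
    also have "\<dots> \<simeq> k \<cdot> \<zeta> E"
      using sim_cong_left[OF sim_sym[OF k0] cartD(1)[OF c]] cartD(3)[OF c] vY(2)[OF k] simD[OF k0] by simp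
    also have "\<dots> \<simeq> \<zeta> E' \<cdot> k'" using s by (rule sim_sym)
    finally have "l \<simeq> k'" using cartD(6)[OF c' l(1) k'] by blast
    then show "B = cls k'" using l cls_eq vX by simp
  qed
  then show ?thesis
    using f Dom_Cod_fiber[OF k] by (simp add: pull_def Let_def)
qed

lemma pull_functor: "is_functor (fiber D C p Y) (fiber D C p X) (pull D C p f \<zeta>)"
proof (rule is_functorI)
  fix E assume "E \<in> Ob (fiber D C p Y)"
  then have E: "E \<in> fiber_obj D p Y" by (simp add: Ob_fiber)
  then show "fo (pull D C p f \<zeta>) E \<in> Ob (fiber D C p X)" using pull_obj by (simp add: Ob_fiber)
  note c = cartD[OF \<zeta>[OF E]]
  have "idn D E \<cdot> \<zeta> E = \<zeta> E" "\<zeta> E \<cdot> idn D (hd (src D (\<zeta> E))) = \<zeta> E"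
    using c(1-4) D.comp1_idn D.idn_comp1 by blast+
  then show "fa (pull D C p f \<zeta>) (Idt (fiber D C p Y) E) = Idt (fiber D C p X) (fo (pull D C p f \<zeta>) E)"
    unfolding Idt_fiber using pull_arr[OF idn_vert[OF E] idn_vert[OF pull_obj[OF E]]] sim_refl[OF c(1)] by simp
next
  let ?s = "\<lambda>E. hd (src D (\<zeta> E))"
  fix u E E' assume "u \<in> hom (fiber D C p Y) E E'"
  then obtain k where k: "k \<in> over (idn C Y) E E'" "u = cls k" by (auto simp: hom_fiber[OF Y])
  obtain k' where k': "k' \<in> over (idn C X) (?s E) (?s E')" "\<zeta> E' \<cdot> k' \<simeq> k \<cdot> \<zeta> E"
    using pull_ex[OF k(1)] by blast
  have uk: "fa (pull D C p f \<zeta>) u = cls k'" using pull_arr[OF k(1) k'] k by simp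
  then show "fa (pull D C p f \<zeta>) u \<in> hom (fiber D C p X) (fo (pull D C p f \<zeta>) E) (fo (pull D C p f \<zeta>) E')"
    using cls_hom[OF X k'(1)] by simp
  fix v E'' assume "v \<in> hom (fiber D C p Y) E' E''"
  then obtain l where l: "l \<in> over (idn C Y) E' E''" "v = cls l" by (auto simp: hom_fiber[OF Y])
  obtain l' where l': "l' \<in> over (idn C X) (?s E') (?s E'')" "\<zeta> E'' \<cdot> l' \<simeq> l \<cdot> \<zeta> E'"
    using pull_ex[OF l(1)] by blast
  \<comment> \<open>Once the one-element source lists are named, \<open>hd\<close> simplifies
    away.\<close>
  obtain s s' s'' where ss: "src D (\<zeta> E) = [s]" "src D (\<zeta> E') = [s']" "src D (\<zeta> E'') = [s'']"
    using cartD(2)[OF \<zeta>] vY(5,6) k(1) l(1) by metis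
  note simps = ss cartD(1,3,4)[OF \<zeta>[OF vY(5)[OF k(1)]]] cartD(1,3,4)[OF \<zeta>[OF vY(5)[OF l(1)]]]
    cartD(1,3,4)[OF \<zeta>[OF vY(6)[OF l(1)]]] vY[OF k(1)] vY[OF l(1)] vX[OF k'(1)] vX[OF l'(1)]
  have "\<zeta> E'' \<cdot> (l' \<cdot> k') = (\<zeta> E'' \<cdot> l') \<cdot> k'" using simps by simp
  also have "\<dots> \<simeq> (l \<cdot> \<zeta> E') \<cdot> k'"
    by (rule sim_cong_left[OF l'(2)]) (use simps in simp_all)
  also have "\<dots> = l \<cdot> (\<zeta> E' \<cdot> k')" using simps by simp
  also have "\<dots> \<simeq> l \<cdot> (k \<cdot> \<zeta> E)" using sim_cong_right[OF k'(2)] simps by simp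
  also have "\<dots> = (l \<cdot> k) \<cdot> \<zeta> E" using simps by simp
  finally have "fa (pull D C p f \<zeta>) (cls (l \<cdot> k)) = cls (l' \<cdot> k')"
    using pull_arr[OF cmp_vert[OF Y k(1) l(1)] cmp_vert[OF X k'(1) l'(1)]] by blast
  then show "fa (pull D C p f \<zeta>) (Cmp (fiber D C p Y) v u)
      = Cmp (fiber D C p X) (fa (pull D C p f \<zeta>) v) (fa (pull D C p f \<zeta>) u)"
    using uk pull_arr[OF l(1) l'] k l Cmp_fiber[OF k(1) l(1)] Cmp_fiber[OF k'(1) l'(1)] by simp
qed (rule category_fiber[OF X] category_fiber[OF Y])+

end

end

section \<open>Transport along 2-morphisms in a 2-opfibration\<close>

locale two_opfib = strict_functor D C p
  for D :: "('o, 'f, 't) mcat2" and C :: "('o2, 'f2, 't2) mcat2" and p +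
  assumes opfib: "two_opfibration D C p"
begin

text \<open>\<open>l\<close> is a transport of \<open>k\<close> along \<open>\<gamma>\<close>. This
  is a relation, as the target of a coCartesian lift is determined only up to
  \<open>\<simeq>\<close>.\<close>

definition coc where
  "coc \<gamma> k l \<longleftrightarrow> (\<exists>\<mu>. cocartesian2 D C p \<mu> \<and> pc p \<mu> = \<gamma> \<and> cdom D \<mu> = k \<and> ccod D \<mu> = l)"

abbreviation coc_arrow where
  "coc_arrow E F \<equiv> cocartesian_arrow (Hom D [E] F) (Hom C [po p E] (po p F)) (Hom_functor p)"

lemma Hom_functor1: "is_functor (Hom D [E] F) (Hom C [po p E] (po p F)) (Hom_functor p)"
  using Hom_functor[of "[E]"] by simp

lemma cocartesian2_iff:
  assumes "src D (cdom D \<mu>) = [E]" "tgt D (cdom D \<mu>) = F"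
  shows "cocartesian2 D C p \<mu> \<longleftrightarrow> coc_arrow E F \<mu>"
  using assms by (simp add: cocartesian2_def Let_def)

lemma cocE:
  assumes "coc \<gamma> k l" "k \<in> over g E F"
  obtains \<mu> where "\<mu> \<in> hom (Hom D [E] F) k l" "coc_arrow E F \<mu>" "pc p \<mu> = \<gamma>"
proof -
  obtain \<mu> where \<mu>: "cocartesian2 D C p \<mu>" "pc p \<mu> = \<gamma>" "cdom D \<mu> = k" "ccod D \<mu> = l"
    using assms(1) by (auto simp: coc_def)
  then have a: "coc_arrow E F \<mu>"
    using cocartesian2_iff[of \<mu> E F] overD[OF assms(2)] by simp
  then have "\<mu> \<in> hom (Hom D [E] F) k l"
    using \<mu> by (simp add: cocartesian_arrow_def hom_def) (simp add: Hom_def Let_def)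
  then show ?thesis using that a \<mu> by blast
qed

lemma cocI: "\<lbrakk>\<mu> \<in> hom (Hom D [E] F) k l; coc_arrow E F \<mu>; pc p \<mu> = \<gamma>\<rbrakk> \<Longrightarrow> coc \<gamma> k l"
  using cocartesian2_iff[of \<mu> E F] by (auto simp: coc_def D.hom_Hom)

lemma coc_over:
  assumes "coc \<gamma> k l" "k \<in> over g E F"
  shows "\<gamma> \<in> hom (Hom C [po p E] (po p F)) g (ccod C \<gamma>)" "l \<in> over (ccod C \<gamma>) E F"
proof -
  obtain \<mu> where \<mu>: "\<mu> \<in> hom (Hom D [E] F) k l" "pc p \<mu> = \<gamma>" using cocE[OF assms] .
  have "\<gamma> \<in> hom (Hom C [po p E] (po p F)) (pm p k) (pm p l)"
    using is_functorD(5)[OF Hom_functor1 \<mu>(1)] \<mu>(2) by (simp add: Hom_functor_def)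
  then show "\<gamma> \<in> hom (Hom C [po p E] (po p F)) g (ccod C \<gamma>)" "l \<in> over (ccod C \<gamma>) E F"
    using overD[OF assms(2)] \<mu>(1) D.cell_mor[of \<mu>] D.cell_parallel[of \<mu>]
    by (auto simp: C.hom_Hom D.hom_Hom intro!: overI)
qed

lemma coc_ex:
  assumes "\<gamma> \<in> cell C" "k \<in> over (cdom C \<gamma>) E F"
  shows "\<exists>l \<in> over (ccod C \<gamma>) E F. coc \<gamma> k l"
proof -
  note k = overD[OF assms(2)] and o = over_base[OF assms(2)]
  have "opfibration (Hom D [E] F) (Hom C [po p E] (po p F)) (Hom_functor p)"
    using opfib o unfolding two_opfibration_def by (auto dest!: spec[of _ "[E]"])
  moreover have "k \<in> Ob (Hom D [E] F)" using k by (simp add: Ob_Hom)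
  moreover have "\<gamma> \<in> hom (Hom C [po p E] (po p F)) (fo (Hom_functor p) k) (ccod C \<gamma>)"
    using assms(1) k o by (simp add: C.hom_Hom Hom_functor_def)
  ultimately obtain \<mu> where \<mu>: "\<mu> \<in> Ar (Hom D [E] F)" "Dom (Hom D [E] F) \<mu> = k" "pc p \<mu> = \<gamma>" "coc_arrow E F \<mu>"
    unfolding opfibration_def hom_def by (auto simp: Hom_functor_def)
  then have "\<mu> \<in> hom (Hom D [E] F) k (Cod (Hom D [E] F) \<mu>)" by (simp add: hom_def)
  then have "coc \<gamma> k (Cod (Hom D [E] F) \<mu>)" using cocI \<mu> by blast
  then show ?thesis using coc_over(2)[OF _ assms(2)] by blast
qed

lemma coc_unique:
  assumes "coc \<gamma> k l" "coc \<gamma> k l'" "k \<in> over g E F"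
  shows "l \<simeq> l'"
proof -
  obtain \<mu> where \<mu>: "\<mu> \<in> hom (Hom D [E] F) k l" "coc_arrow E F \<mu>" "pc p \<mu> = \<gamma>" using cocE[OF assms(1,3)] .
  obtain \<nu> where \<nu>: "\<nu> \<in> hom (Hom D [E] F) k l'" "coc_arrow E F \<nu>" "pc p \<nu> = \<gamma>" using cocE[OF assms(2,3)] .
  obtain w where "w \<in> hom (Hom D [E] F) l l'" "is_iso (Hom D [E] F) w" "pc p w = cidt C (pm p l)"
    using cocartesian_unique[OF Hom_functor1 \<mu>(1,2) \<nu>(1,2)] \<mu> \<nu> by (auto simp: Hom_functor_def)
  then show ?thesis by (rule simI)
qed

text \<open>Isomorphisms are coCartesian, so whatever is isomorphic to \<open>k\<close> over an
  identity is a transport along it; the converse is uniqueness of transport. With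
  \<open>coc_vcmp\<close>, this turns an equation between 2-morphisms such as a triangle identity
  into an isomorphism of 1-morphisms.\<close>

lemma coc_cidt:
  assumes "k \<in> over g E F"
  shows "coc (cidt C g) k l \<longleftrightarrow> k \<simeq> l"
proof
  have k: "coc (cidt C (pm p k)) k l" if kl: "k \<simeq> l" for l
  proof -
    obtain u where u: "u \<in> hom (Hom D [E] F) k l" "is_iso (Hom D [E] F) u" "pc p u = cidt C (pm p k)"
      using simE[OF kl] overD[OF assms] by auto
    show ?thesis using cocI[OF u(1) iso_cocartesian[OF Hom_functor1 u(1,2)] u(3)] .
  qed
  show "coc (cidt C g) k l" if "k \<simeq> l"
    using k[OF that] overD[OF assms] by simp
  show "k \<simeq> l" if "coc (cidt C g) k l"
    using coc_unique[OF k[OF sim_refl] _ assms] that overD[OF assms] by simp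
qed

lemma coc_vcmp:
  assumes "coc \<gamma> k l" "coc \<gamma>' l m" "k \<in> over g E F"
  shows "coc (vcmp C \<gamma>' \<gamma>) k m"
proof -
  obtain \<mu> where \<mu>: "\<mu> \<in> hom (Hom D [E] F) k l" "coc_arrow E F \<mu>" "pc p \<mu> = \<gamma>" using cocE[OF assms(1,3)] .
  obtain \<nu> where \<nu>: "\<nu> \<in> hom (Hom D [E] F) l m" "coc_arrow E F \<nu>" "pc p \<nu> = \<gamma>'"
    using cocE[OF assms(2) coc_over(2)[OF assms(1,3)]] .
  show ?thesis
    using cocI[OF category.hom_Cmp[OF D.Hom_category \<mu>(1) \<nu>(1)] cocartesian_Cmp[OF Hom_functor1 \<mu>(1,2) \<nu>(1,2)]]
      \<mu> \<nu> pc_vcmp[of \<mu> \<nu>] by (simp add: D.hom_Hom)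
qed

text \<open>Transport once more, along an identity 2-morphism.\<close>

lemma coc_sim: "\<lbrakk>coc \<gamma> k l; l \<simeq> l'; k \<in> over g E F\<rbrakk> \<Longrightarrow> coc \<gamma> k l'"
  using coc_vcmp[of \<gamma> k l "cidt C (ccod C \<gamma>)" l' g E F] coc_cidt[of l "ccod C \<gamma>" E F l'] coc_over[of \<gamma> k l g E F]
    category.hom_Idt_Cmp[OF C.Hom_category, of \<gamma> "[po p E]" "po p F" g "ccod C \<gamma>"] by simp

text \<open>Here the second half of the notion of 2-opfibration enters: composites of coCartesian
  2-morphisms are coCartesian.\<close>

lemma coc_cmp:
  assumes a: "coc \<gamma> k l" "k \<in> over g E F" and b: "coc \<gamma>' k' l'" "k' \<in> over g' F H"
  shows "coc (comp2 C \<gamma>' 0 \<gamma>) (k' \<cdot> k) (l' \<cdot> l)"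
proof -
  obtain \<mu> where \<mu>: "\<mu> \<in> hom (Hom D [E] F) k l" "coc_arrow E F \<mu>" "pc p \<mu> = \<gamma>" using cocE[OF a] .
  obtain \<nu> where \<nu>: "\<nu> \<in> hom (Hom D [F] H) k' l'" "coc_arrow F H \<nu>" "pc p \<nu> = \<gamma>'" using cocE[OF b] .
  have c: "composable2 D \<nu> 0 \<mu>"
    using \<mu> \<nu> composable_over[OF a(2) b(2)] by (simp add: composable2_def D.hom_Hom)
  have "cocartesian2 D C p \<mu>" "cocartesian2 D C p \<nu>"
    using cocartesian2_iff \<mu> \<nu> by (auto simp: D.hom_Hom)
  then have "cocartesian2 D C p (comp2 D \<nu> 0 \<mu>)"
    using opfib c unfolding two_opfibration_def by blast
  then show ?thesis
    using pc_comp2[OF c] D.comp2_cell[OF c] \<mu> \<nu> by (auto simp: coc_def D.hom_Hom)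
qed

lemma coc_cmp_left:
  assumes "coc \<gamma> k l" "k \<in> over g E F" "m \<in> over h F H"
  shows "coc (comp2 C (cidt C h) 0 \<gamma>) (m \<cdot> k) (m \<cdot> l)"
  using coc_cmp[OF assms(1,2) _ assms(3)] coc_cidt[OF assms(3)] sim_refl overD[OF assms(3)] by blast

lemma coc_cmp_right:
  assumes "coc \<gamma> k l" "k \<in> over g E F" "m \<in> over h H E"
  shows "coc (comp2 C \<gamma> 0 (cidt C h)) (k \<cdot> m) (l \<cdot> m)"
  using coc_cmp[OF _ assms(3) assms(1,2)] coc_cidt[OF assms(3)] sim_refl overD[OF assms(3)] by blast

end

section \<open>The mate of the transport of an identity\<close>

text \<open>Common form of both canonical transformations. In the proper case
  \<open>\<delta>\<close> is the cell of the diagonal and \<open>f\<close>, \<open>g\<close> are the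
  correspondence and its opposite. In the etale case, after reversal of 2-morphisms,
  \<open>\<delta>\<close> is the counit cell and the roles of \<open>X\<close>, \<open>Y\<close> and
  of \<open>f\<close>, \<open>g\<close> are exchanged.\<close>

definition canonical_mate ::
  "('o, 'f, 't) mcat2 \<Rightarrow> ('o2, 'f2, 't2) mcat2 \<Rightarrow> ('o, 'f, 't, 'o2, 'f2, 't2) mfunctor
     \<Rightarrow> 'o2 \<Rightarrow> 'o2 \<Rightarrow> 't2 \<Rightarrow> 'f2 \<Rightarrow> 'f2 \<Rightarrow> ('o \<Rightarrow> 'f) \<Rightarrow> ('o \<Rightarrow> 'f) \<Rightarrow> ('o \<Rightarrow> 'f) \<Rightarrow> ('o \<Rightarrow> 'f set) \<Rightarrow> bool" where
  "canonical_mate D C p X Y \<delta> f g cs cu zu \<tau> \<longleftrightarrow>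
     nat_trans (fiber D C p X) (fiber D C p Y) (push D C p f cs) (pull D C p g zu) \<tau> \<and>
     (\<exists>\<epsilon>. nat_trans (fiber D C p X) (fiber D C p X)
           (comp_ftor (push D C p g cu) (push D C p f cs)) id_ftor \<epsilon> \<and>
        (\<forall>E \<in> fiber_obj D p X.
           induced_by_opfibration D C p \<delta> (idn D E) (comp1 D (cu (tgt D (cs E))) 0 (cs E)) (\<epsilon> E) \<and>
           adjoint_arrows D C p g cu zu (tgt D (cs E)) E (\<epsilon> E) (\<tau> E)))"

text \<open>The universal properties are assumed in the form \<open>cocart\<close> and
  \<open>cart\<close>, which is insensitive to reversal of 2-morphisms, so that both cases are
  instances.\<close>

locale mate_situation = two_opfib D C p
  for D :: "('o, 'f, 't) mcat2" and C :: "('o2, 'f2, 't2) mcat2" and p +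
  fixes X Y :: 'o2 and f g :: 'f2 and \<delta> :: 't2 and cs cu zu :: "'o \<Rightarrow> 'f"
  assumes X: "X \<in> obj C" and Y: "Y \<in> obj C"
    and f: "f \<in> mor C" "src C f = [X]" "tgt C f = Y"
    and g: "g \<in> mor C" "src C g = [Y]" "tgt C g = X"
    and \<delta>: "\<delta> \<in> cell C" "cdom C \<delta> = idn C X" "ccod C \<delta> = comp1 C g 0 f"
    and cs: "E \<in> fiber_obj D p X \<Longrightarrow> cocart f E (tgt D (cs E)) (cs E)"
    and cu: "E \<in> fiber_obj D p Y \<Longrightarrow> cocart g E (tgt D (cu E)) (cu E)"
    and zu: "E \<in> fiber_obj D p X \<Longrightarrow> cart g (hd (src D (zu E))) E (zu E)"
begin

sublocale F: push_pull D C p X Y f using X Y f by unfold_locales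
sublocale G: push_pull D C p Y X g using X Y g by unfold_locales

abbreviation fs where "fs E \<equiv> tgt D (cs E)"
abbreviation fl where "fl E \<equiv> hd (src D (zu E))"
abbreviation vX where "vX E F \<equiv> over (idn C X) E F"
abbreviation vY where "vY E F \<equiv> over (idn C Y) E F"

text \<open>\<open>mate\<close> and the following \<open>counit\<close> express on single
  representatives what it means to be the component at \<open>E\<close> of the canonical
  transformation \<open>\<tau>\<close> and of the transformation \<open>\<epsilon>\<close> adjoint
  to it.\<close>

definition mate where
  "mate E l \<longleftrightarrow> l \<in> vY (fs E) (fl E) \<and> coc \<delta> (idn D E) (zu E \<cdot> (l \<cdot> cs E))"

definition counit where
  "counit E k \<longleftrightarrow> k \<in> vX (tgt D (cu (fs E))) E \<and> coc \<delta> (idn D E) (k \<cdot> (cu (fs E) \<cdot> cs E))"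

lemma fs_obj: "E \<in> fiber_obj D p X \<Longrightarrow> fs E \<in> fiber_obj D p Y"
  using F.push_obj cs by blast

lemma fl_obj: "E \<in> fiber_obj D p X \<Longrightarrow> fl E \<in> fiber_obj D p Y"
  using G.pull_obj zu by blast

lemma arrows:
  assumes "E \<in> fiber_obj D p X"
  shows "cs E \<in> mor D" "src D (cs E) = [E]" "pm p (cs E) = f"
    "cu (fs E) \<in> mor D" "src D (cu (fs E)) = [fs E]" "pm p (cu (fs E)) = g"
    "zu E \<in> mor D" "src D (zu E) = [fl E]" "tgt D (zu E) = E" "pm p (zu E) = g"
  using cocartD(1-4)[OF cs[OF assms]] cocartD(1-4)[OF cu[OF fs_obj[OF assms]]] cartD(1-4)[OF zu[OF assms]]
  by simp_all

text \<open>A 1-morphism \<open>m\<close> over \<open>g\<close> with \<open>m \<cdot> cs E\<close> the transport of \<open>idn D E\<close> mediates between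
  \<open>counit\<close> (factor \<open>m\<close> through \<open>cu\<close>) and \<open>mate\<close> (factor \<open>m\<close> through \<open>zu\<close>).\<close>

lemma middle_ex:
  assumes E: "E \<in> fiber_obj D p X"
  shows "\<exists>m \<in> over g (fs E) E. coc \<delta> (idn D E) (m \<cdot> cs E)"
proof -
  have i: "idn D E \<in> over (cdom C \<delta>) E E" using idn_vert[OF E] \<delta>(2) by simp
  obtain m0 where m0: "m0 \<in> over (g \<bullet> f) E E" "coc \<delta> (idn D E) m0"
    using coc_ex[OF \<delta>(1) i] \<delta>(3) by auto
  obtain m where m: "m \<in> over g (fs E) E" "m \<cdot> cs E \<simeq> m0"
    using cocartD(5)[OF cs[OF E], of g E m0] g m0(1) fs_obj[OF E] E by (auto simp: fiber_obj_def)
  then show ?thesis using coc_sim[OF m0(2) sim_sym[OF m(2)] i] by blast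
qed

lemma mate_of_middle:
  assumes E: "E \<in> fiber_obj D p X" and m: "m \<in> over g (fs E) E"
  shows "\<exists>l \<in> vY (fs E) (fl E). zu E \<cdot> l \<simeq> m"
  using cartD(5)[OF zu[OF E], of "idn C Y" "fs E" m] G.idn_C fs_obj[OF E] fl_obj[OF E] m
  by (auto simp: fiber_obj_def)

lemma counit_of_middle:
  assumes E: "E \<in> fiber_obj D p X" and m: "m \<in> over g (fs E) E"
  shows "\<exists>k \<in> vX (tgt D (cu (fs E))) E. k \<cdot> cu (fs E) \<simeq> m"
  using cocartD(5)[OF cu[OF fs_obj[OF E]], of "idn C X" E m] G.idn_C E G.push_obj[OF cu fs_obj[OF E]] m
  by (auto simp: fiber_obj_def)

lemma coc_middle:
  assumes E: "E \<in> fiber_obj D p X" and c: "coc \<delta> (idn D E) (m \<cdot> cs E)" and s: "m' \<simeq> m" "m \<in> over g (fs E) E"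
  shows "coc \<delta> (idn D E) (m' \<cdot> cs E)"
  using coc_sim[OF c _ idn_vert[OF E]] sim_cong_left[OF sim_sym[OF s(1)] arrows(1)[OF E]] overD[OF s(2)] simD[OF s(1)]
  by simp

lemma middle_unique:
  assumes E: "E \<in> fiber_obj D p X" and m: "m \<in> over g (fs E) E" "coc \<delta> (idn D E) (m \<cdot> cs E)"
    and m': "m' \<in> over g (fs E) E" "coc \<delta> (idn D E) (m' \<cdot> cs E)"
  shows "m \<simeq> m'"
  using cocartD(6)[OF cs[OF E] m(1) m'(1)] coc_unique[OF m(2) m'(2) idn_vert[OF E]] by blast

lemma mate_middle:
  assumes E: "E \<in> fiber_obj D p X" and l: "mate E l"
  shows "zu E \<cdot> l \<in> over g (fs E) E" "coc \<delta> (idn D E) ((zu E \<cdot> l) \<cdot> cs E)"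
proof -
  have lv: "l \<in> vY (fs E) (fl E)" and c: "coc \<delta> (idn D E) (zu E \<cdot> (l \<cdot> cs E))"
    using l by (auto simp: mate_def)
  show "zu E \<cdot> l \<in> over g (fs E) E"
    using G.vX[OF lv] arrows[OF E] by (intro overI) simp_all
  show "coc \<delta> (idn D E) ((zu E \<cdot> l) \<cdot> cs E)"
    using c G.vX[OF lv] arrows[OF E] by simp
qed

lemma counit_middle:
  assumes E: "E \<in> fiber_obj D p X" and k: "counit E k"
  shows "k \<cdot> cu (fs E) \<in> over g (fs E) E" "coc \<delta> (idn D E) ((k \<cdot> cu (fs E)) \<cdot> cs E)"
proof -
  have kv: "k \<in> vX (tgt D (cu (fs E))) E" and c: "coc \<delta> (idn D E) (k \<cdot> (cu (fs E) \<cdot> cs E))"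
    using k by (auto simp: counit_def)
  show "k \<cdot> cu (fs E) \<in> over g (fs E) E"
    using G.vY[OF kv] arrows[OF E] by (intro overI) simp_all
  show "coc \<delta> (idn D E) ((k \<cdot> cu (fs E)) \<cdot> cs E)"
    using c G.vY[OF kv] arrows[OF E] by simp
qed

lemma mateI:
  assumes E: "E \<in> fiber_obj D p X" and l: "l \<in> vY (fs E) (fl E)" and c: "coc \<delta> (idn D E) ((zu E \<cdot> l) \<cdot> cs E)"
  shows "mate E l"
  using assms G.vX[OF l] arrows[OF E] by (simp add: mate_def)

lemma counitI:
  assumes E: "E \<in> fiber_obj D p X" and k: "k \<in> vX (tgt D (cu (fs E))) E"
    and c: "coc \<delta> (idn D E) ((k \<cdot> cu (fs E)) \<cdot> cs E)"
  shows "counit E k"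
  using assms G.vY[OF k] arrows[OF E] by (simp add: counit_def)

lemma mate_ex: "E \<in> fiber_obj D p X \<Longrightarrow> \<exists>l. mate E l"
  using middle_ex mate_of_middle coc_middle mateI by metis

lemma counit_ex: "E \<in> fiber_obj D p X \<Longrightarrow> \<exists>k. counit E k"
  using middle_ex counit_of_middle coc_middle counitI by metis

lemma mate_unique: "\<lbrakk>E \<in> fiber_obj D p X; mate E l; mate E l'\<rbrakk> \<Longrightarrow> l \<simeq> l'"
  using middle_unique mate_middle cartD(6)[OF zu] mate_def by metis

lemma counit_mate: "\<lbrakk>E \<in> fiber_obj D p X; counit E k; mate E l\<rbrakk> \<Longrightarrow> k \<cdot> cu (fs E) \<simeq> zu E \<cdot> l"
  using middle_unique mate_middle counit_middle by metis

text \<open>The transport of \<open>u\<close> along \<open>\<delta>\<close> can be obtained from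
  that of \<open>idn D E'\<close> by composing with \<open>u\<close> on the right, or from that of
  \<open>idn D E\<close> by composing on the left, because whiskering \<open>\<delta>\<close> with
  \<open>idn C X\<close> changes nothing. Uniqueness of transport compares the two, and
  \<open>cs E\<close> is cancelled.\<close>

lemma middle_natural:
  assumes u: "u \<in> vX E E'"
    and m: "m \<in> over g (fs E) E" "coc \<delta> (idn D E) (m \<cdot> cs E)"
    and m': "m' \<in> over g (fs E') E'" "coc \<delta> (idn D E') (m' \<cdot> cs E')"
    and v: "v \<in> vY (fs E) (fs E')" "v \<cdot> cs E \<simeq> cs E' \<cdot> u"
  shows "m' \<cdot> v \<simeq> u \<cdot> m"
proof (rule cocartD(6)[OF cs])
  note U = G.vY[OF u] and V = G.vX[OF v(1)]
  note simps = U V arrows[OF U(5)] arrows[OF U(6)] overD[OF m(1)] overD[OF m'(1)]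
  show "E \<in> fiber_obj D p X" by (rule U)
  show "m' \<cdot> v \<in> over g (fs E) E'" "u \<cdot> m \<in> over g (fs E) E'"
    using simps by (intro overI; simp)+
  have "src C (cdom C \<delta>) = [X]" "tgt C (cdom C \<delta>) = X"
    using \<delta> G.idn_C by auto
  then have \<delta>i: "comp2 C \<delta> 0 (cidt C (idn C X)) = \<delta>" "comp2 C (cidt C (idn C X)) 0 \<delta> = \<delta>"
    using C.comp2_idn_right[OF \<delta>(1), of 0] C.comp2_idn_left[OF \<delta>(1)] by simp_all
  have "coc \<delta> u ((m' \<cdot> cs E') \<cdot> u)"
    using coc_cmp_right[OF m'(2) idn_vert[OF U(6)] u] \<delta>i idn_cmp[OF u] by simp
  moreover have "coc \<delta> u (u \<cdot> (m \<cdot> cs E))"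
    using coc_cmp_left[OF m(2) idn_vert[OF U(5)] u] \<delta>i cmp_idn[OF u] by simp
  ultimately have 1: "(m' \<cdot> cs E') \<cdot> u \<simeq> u \<cdot> (m \<cdot> cs E)"
    using coc_unique u by blast
  have "(m' \<cdot> v) \<cdot> cs E = m' \<cdot> (v \<cdot> cs E)" using simps by simp
  also have "\<dots> \<simeq> m' \<cdot> (cs E' \<cdot> u)"
    by (rule sim_cong_right[OF v(2)]) (use simps in simp_all)
  also have "\<dots> = (m' \<cdot> cs E') \<cdot> u" using simps by simp
  also note 1
  also have "u \<cdot> (m \<cdot> cs E) = (u \<cdot> m) \<cdot> cs E" using simps by simp
  finally show "(m' \<cdot> v) \<cdot> cs E \<simeq> (u \<cdot> m) \<cdot> cs E" .
qed

text \<open>This is \<open>middle_natural\<close> for the composites \<open>zu E \<cdot> l\<close>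
  and \<open>zu E' \<cdot> l'\<close>, after which the Cartesian \<open>zu E'\<close> is
  cancelled.\<close>

lemma mate_natural:
  assumes u: "u \<in> vX E E'" and l: "mate E l" and l': "mate E' l'"
    and v: "v \<in> vY (fs E) (fs E')" "v \<cdot> cs E \<simeq> cs E' \<cdot> u"
    and w: "w \<in> vY (fl E) (fl E')" "zu E' \<cdot> w \<simeq> u \<cdot> zu E"
  shows "l' \<cdot> v \<simeq> w \<cdot> l"
proof (rule cartD(6)[OF zu])
  note U = G.vY[OF u] and V = G.vX[OF v(1)] and W = G.vX[OF w(1)]
  have ll: "l \<in> vY (fs E) (fl E)" "l' \<in> vY (fs E') (fl E')" using l l' by (auto simp: mate_def)
  note simps = U V W arrows[OF U(5)] arrows[OF U(6)] G.vX[OF ll(1)] G.vX[OF ll(2)]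
  show "E' \<in> fiber_obj D p X" by (rule U)
  show "l' \<cdot> v \<in> vY (fs E) (fl E')" "w \<cdot> l \<in> vY (fs E) (fl E')"
    using cmp_vert[OF Y v(1) ll(2)] cmp_vert[OF Y ll(1) w(1)] by auto
  have "zu E' \<cdot> (l' \<cdot> v) = (zu E' \<cdot> l') \<cdot> v" using simps by simp
  also have "\<dots> \<simeq> u \<cdot> (zu E \<cdot> l)"
    using middle_natural[OF u mate_middle[OF U(5) l] mate_middle[OF U(6) l'] v] .
  also have "\<dots> = (u \<cdot> zu E) \<cdot> l" using simps by simp
  also have "\<dots> \<simeq> (zu E' \<cdot> w) \<cdot> l"
    by (rule sim_cong_left[OF sim_sym[OF w(2)]]) (use simps in simp_all)
  also have "\<dots> = zu E' \<cdot> (w \<cdot> l)" using simps by simp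
  finally show "zu E' \<cdot> (l' \<cdot> v) \<simeq> zu E' \<cdot> (w \<cdot> l)" .
qed

text \<open>As \<open>mate_natural\<close>, but with \<open>k \<cdot> cu (fs E)\<close> in the
  middle and the coCartesian \<open>cu (fs E)\<close> cancelled.\<close>

lemma counit_natural:
  assumes u: "u \<in> vX E E'" and k: "counit E k" and k': "counit E' k'"
    and v: "v \<in> vY (fs E) (fs E')" "v \<cdot> cs E \<simeq> cs E' \<cdot> u"
    and w: "w \<in> vX (tgt D (cu (fs E))) (tgt D (cu (fs E')))" "w \<cdot> cu (fs E) \<simeq> cu (fs E') \<cdot> v"
  shows "k' \<cdot> w \<simeq> u \<cdot> k"
proof (rule cocartD(6)[OF cu])
  note U = G.vY[OF u] and V = G.vX[OF v(1)] and W = G.vY[OF w(1)]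
  have kk: "k \<in> vX (tgt D (cu (fs E))) E" "k' \<in> vX (tgt D (cu (fs E'))) E'" using k k' by (auto simp: counit_def)
  note simps = U V W arrows[OF U(5)] arrows[OF U(6)] G.vY[OF kk(1)] G.vY[OF kk(2)]
  show "fs E \<in> fiber_obj D p Y" by (rule V)
  show "k' \<cdot> w \<in> vX (tgt D (cu (fs E))) E'" "u \<cdot> k \<in> vX (tgt D (cu (fs E))) E'"
    using cmp_vert[OF X w(1) kk(2)] cmp_vert[OF X kk(1) u] by auto
  have "(k' \<cdot> w) \<cdot> cu (fs E) = k' \<cdot> (w \<cdot> cu (fs E))" using simps by simp
  also have "\<dots> \<simeq> k' \<cdot> (cu (fs E') \<cdot> v)"
    by (rule sim_cong_right[OF w(2)]) (use simps in simp_all)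
  also have "\<dots> = (k' \<cdot> cu (fs E')) \<cdot> v" using simps by simp
  also have "\<dots> \<simeq> u \<cdot> (k \<cdot> cu (fs E))"
    using middle_natural[OF u counit_middle[OF U(5) k] counit_middle[OF U(6) k'] v] .
  also have "\<dots> = (u \<cdot> k) \<cdot> cu (fs E)" using simps by simp
  finally show "(k' \<cdot> w) \<cdot> cu (fs E) \<simeq> (u \<cdot> k) \<cdot> cu (fs E)" .
qed

lemma mate_nat_trans:
  assumes "\<And>E. E \<in> fiber_obj D p X \<Longrightarrow> mate E (l E) \<and> \<tau> E = cls (l E)"
  shows "nat_trans (fiber D C p X) (fiber D C p Y) (push D C p f cs) (pull D C p g zu) \<tau>"
  unfolding nat_trans_def Ob_fiber
proof (intro conjI ballI)
  show "is_functor (fiber D C p X) (fiber D C p Y) (push D C p f cs)" using F.push_functor cs by blast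
  show "is_functor (fiber D C p X) (fiber D C p Y) (pull D C p g zu)" using G.pull_functor zu by blast
  have ov: "l E \<in> vY (fs E) (fl E)" if "E \<in> fiber_obj D p X" for E
    using assms[OF that] by (simp add: mate_def)
  fix E assume "E \<in> fiber_obj D p X"
  then show "\<tau> E \<in> hom (fiber D C p Y) (fo (push D C p f cs) E) (fo (pull D C p g zu) E)"
    using assms cls_hom[OF Y ov] by simp
next
  have ov: "l E \<in> vY (fs E) (fl E)" if "E \<in> fiber_obj D p X" for E
    using assms[OF that] by (simp add: mate_def)
  fix A assume "A \<in> Ar (fiber D C p X)"
  then obtain E E' u where u: "u \<in> vX E E'" "A = cls u" using Ar_fiber[OF X] by blast
  note U = G.vY[OF u(1)]
  obtain v where v: "v \<in> vY (fs E) (fs E')" "v \<cdot> cs E \<simeq> cs E' \<cdot> u" using F.push_ex[OF cs u(1)] by blast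
  obtain w where w: "w \<in> vY (fl E) (fl E')" "zu E' \<cdot> w \<simeq> u \<cdot> zu E" using G.pull_ex[OF zu u(1)] by blast
  have "l E' \<cdot> v \<simeq> w \<cdot> l E" using mate_natural[OF u(1) _ _ v w] assms U by blast
  then have "cls (l E' \<cdot> v) = cls (w \<cdot> l E)" using cls_eq simD by blast
  then show "Cmp (fiber D C p Y) (\<tau> (Cod (fiber D C p X) A)) (fa (push D C p f cs) A)
      = Cmp (fiber D C p Y) (fa (pull D C p g zu) A) (\<tau> (Dom (fiber D C p X) A))"
    using F.push_arr[OF cs u(1) v] G.pull_arr[OF zu u(1) w] Dom_Cod_fiber[OF u(1)] assms U u(2)
      Cmp_fiber[OF v(1) ov[OF U(6)]] Cmp_fiber[OF ov[OF U(5)] w(1)] by simp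
qed

lemma counit_nat_trans:
  assumes "\<And>E. E \<in> fiber_obj D p X \<Longrightarrow> counit E (k E) \<and> \<epsilon> E = cls (k E)"
  shows "nat_trans (fiber D C p X) (fiber D C p X) (comp_ftor (push D C p g cu) (push D C p f cs)) id_ftor \<epsilon>"
  unfolding nat_trans_def Ob_fiber
proof (intro conjI ballI)
  show "is_functor (fiber D C p X) (fiber D C p X) (comp_ftor (push D C p g cu) (push D C p f cs))"
    using comp_ftor_functor F.push_functor[OF cs] G.push_functor[OF cu] by blast
  show "is_functor (fiber D C p X) (fiber D C p X) id_ftor" using id_ftor_functor category_fiber[OF X] by blast
  have ov: "k E \<in> vX (tgt D (cu (fs E))) E" if "E \<in> fiber_obj D p X" for E
    using assms[OF that] by (simp add: counit_def)
  fix E assume "E \<in> fiber_obj D p X"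
  then show "\<epsilon> E \<in> hom (fiber D C p X) (fo (comp_ftor (push D C p g cu) (push D C p f cs)) E) (fo id_ftor E)"
    using assms cls_hom[OF X ov] by (simp add: comp_ftor_def id_ftor_def)
next
  have ov: "k E \<in> vX (tgt D (cu (fs E))) E" if "E \<in> fiber_obj D p X" for E
    using assms[OF that] by (simp add: counit_def)
  fix A assume "A \<in> Ar (fiber D C p X)"
  then obtain E E' u where u: "u \<in> vX E E'" "A = cls u" using Ar_fiber[OF X] by blast
  note U = G.vY[OF u(1)]
  obtain v where v: "v \<in> vY (fs E) (fs E')" "v \<cdot> cs E \<simeq> cs E' \<cdot> u" using F.push_ex[OF cs u(1)] by blast
  obtain w where w: "w \<in> vX (tgt D (cu (fs E))) (tgt D (cu (fs E')))" "w \<cdot> cu (fs E) \<simeq> cu (fs E') \<cdot> v"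
    using G.push_ex[OF cu v(1)] by blast
  have "k E' \<cdot> w \<simeq> u \<cdot> k E" using counit_natural[OF u(1) _ _ v w] assms U by blast
  then have "cls (k E' \<cdot> w) = cls (u \<cdot> k E)" using cls_eq simD by blast
  then show "Cmp (fiber D C p X) (\<epsilon> (Cod (fiber D C p X) A))
        (fa (comp_ftor (push D C p g cu) (push D C p f cs)) A)
      = Cmp (fiber D C p X) (fa id_ftor A) (\<epsilon> (Dom (fiber D C p X) A))"
    using F.push_arr[OF cs u(1) v] G.push_arr[OF cu v(1) w] Dom_Cod_fiber[OF u(1)] assms U u(2)
      Cmp_fiber[OF w(1) ov[OF U(6)]] Cmp_fiber[OF ov[OF U(5)] u(1)]
    by (simp add: comp_ftor_def id_ftor_def)
qed

text \<open>Naturality of \<open>\<tau>\<close> and the existence of a natural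
  \<open>\<epsilon>\<close> come for free once every component is a mate. Existence, uniqueness and
  invertibility can therefore be treated one object at a time.\<close>

lemma canonical_mate_iff:
  "canonical_mate D C p X Y \<delta> f g cs cu zu \<tau> \<longleftrightarrow> (\<forall>E \<in> fiber_obj D p X. \<exists>l. mate E l \<and> \<tau> E = cls l)"
proof
  assume c: "canonical_mate D C p X Y \<delta> f g cs cu zu \<tau>"
  show "\<forall>E \<in> fiber_obj D p X. \<exists>l. mate E l \<and> \<tau> E = cls l"
  proof
    fix E assume E: "E \<in> fiber_obj D p X"
    obtain a where a: "induced_by_opfibration D C p \<delta> (idn D E) (cu (fs E) \<cdot> cs E) a"
      and adj: "adjoint_arrows D C p g cu zu (fs E) E a (\<tau> E)"
      using c E unfolding canonical_mate_def by blast
    note ar = arrows[OF E]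
    obtain k1 where k1: "k1 \<in> vX (tgt D (cu (fs E))) E" "a = cls k1"
      using a ar \<delta> G.idn_C D.idn_mor[of E] fiber_objD[OF E] unfolding induced_by_opfibration_def
      by (auto simp: hom_fiber[OF X])
    obtain k where k: "k1 \<simeq> k" "coc \<delta> (idn D E) (k \<cdot> (cu (fs E) \<cdot> cs E))"
      using a unfolding induced_by_opfibration_def coc_def k1(2) Bex_def mem_cls by blast
    have kv: "k \<in> vX (tgt D (cu (fs E))) E" using sim_over[OF k(1) k1(1)] .
    have ck: "counit E k" using kv k(2) by (simp add: counit_def)
    have "\<tau> E \<in> hom (fiber D C p Y) (fs E) (fl E)"
      using adj g unfolding adjoint_arrows_def by simp
    then obtain l1 where l1: "l1 \<in> vY (fs E) (fl E)" "\<tau> E = cls l1" using hom_fiber[OF Y] by blast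
    \<comment> \<open>The representatives that witness adjointness may differ from the one that
      witnesses that \<open>a\<close> is induced by \<open>\<delta>\<close>; they are compared
      through \<open>k1\<close> and \<open>l1\<close>.\<close>
    obtain k2 l where kl: "k1 \<simeq> k2" "l1 \<simeq> l"
      "isomorphic (Hom_over D C p g [fs E] E) (k2 \<cdot> cu (fs E)) (zu E \<cdot> l)"
      using adj unfolding adjoint_arrows_def k1(2) l1(2) Bex_def mem_cls by blast
    have k2: "k2 \<in> vX (tgt D (cu (fs E))) E" using sim_over[OF kl(1) k1(1)] .
    have lv: "l \<in> vY (fs E) (fl E)" using sim_over[OF kl(2) l1(1)] .
    note V = G.vY[OF k2] G.vY[OF kv] G.vX[OF lv]
    have k2o: "k2 \<cdot> cu (fs E) \<in> over g (fs E) E" using V ar by (intro overI) simp_all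
    have "zu E \<cdot> l \<simeq> k2 \<cdot> cu (fs E)" using kl(3) isomorphic_over[OF k2o] sim_sym by blast
    also have "\<dots> \<simeq> k \<cdot> cu (fs E)"
      using sim_cong_left[OF sim_trans[OF sim_sym[OF kl(1)] k(1)] ar(4)] V ar by simp
    finally have "mate E l"
      using mateI[OF E lv] coc_middle[OF E _ _ counit_middle(1)[OF E ck]] counit_middle(2)[OF E ck] by blast
    moreover have "\<tau> E = cls l" using l1 kl(2) cls_eq G.vX by simp
    ultimately show "\<exists>l. mate E l \<and> \<tau> E = cls l" by blast
  qed
next
  assume "\<forall>E \<in> fiber_obj D p X. \<exists>l. mate E l \<and> \<tau> E = cls l"
  then obtain l where l: "\<And>E. E \<in> fiber_obj D p X \<Longrightarrow> mate E (l E) \<and> \<tau> E = cls (l E)" by metis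
  obtain k where k: "\<And>E. E \<in> fiber_obj D p X \<Longrightarrow> counit E (k E)" using counit_ex by metis
  define \<epsilon> where "\<epsilon> E = cls (k E)" for E
  show "canonical_mate D C p X Y \<delta> f g cs cu zu \<tau>"
    unfolding canonical_mate_def
  proof (intro conjI exI[of _ \<epsilon>] ballI)
    show "nat_trans (fiber D C p X) (fiber D C p Y) (push D C p f cs) (pull D C p g zu) \<tau>"
      using mate_nat_trans l by blast
    show "nat_trans (fiber D C p X) (fiber D C p X) (comp_ftor (push D C p g cu) (push D C p f cs)) id_ftor \<epsilon>"
      using counit_nat_trans[of k \<epsilon>] k by (simp add: \<epsilon>_def)
    fix E assume E: "E \<in> fiber_obj D p X"
    note ar = arrows[OF E] and iX = D.idn_mor[of E] fiber_objD[OF E]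
    have kv: "k E \<in> vX (tgt D (cu (fs E))) E" and kc: "coc \<delta> (idn D E) (k E \<cdot> (cu (fs E) \<cdot> cs E))"
      using k[OF E] by (auto simp: counit_def)
    have lv: "l E \<in> vY (fs E) (fl E)" using l[OF E] by (simp add: mate_def)
    have kk: "k E \<in> \<epsilon> E" and ll: "l E \<in> \<tau> E"
      using sim_refl G.vY(1)[OF kv] G.vX(1)[OF lv] l[OF E] by (auto simp: \<epsilon>_def mem_cls)
    have kh: "\<epsilon> E \<in> hom (fiber D C p X) (tgt D (cu (fs E))) E" unfolding \<epsilon>_def by (rule cls_hom[OF X kv])
    have lh: "\<tau> E \<in> hom (fiber D C p Y) (fs E) (fl E)" using cls_hom[OF Y lv] l[OF E] by simp
    show "induced_by_opfibration D C p \<delta> (idn D E) (cu (fs E) \<cdot> cs E) (\<epsilon> E)"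
      using kh kk kc ar iX \<delta>(2) G.idn_C unfolding induced_by_opfibration_def coc_def by auto
    have "isomorphic (Hom_over D C p g [fs E] E) (k E \<cdot> cu (fs E)) (zu E \<cdot> l E)"
      using counit_mate[OF E k[OF E]] l[OF E] isomorphic_over[OF counit_middle(1)[OF E k[OF E]]] by blast
    then show "adjoint_arrows D C p g cu zu (fs E) E (\<epsilon> E) (\<tau> E)"
      using kh lh kk ll g unfolding adjoint_arrows_def by auto
  qed
qed

text \<open>\<open>extensional\<close> fixes the values outside the fiber; inside it, all mates at
  \<open>E\<close> lie in one class.\<close>

lemma canonical_mate_ex1:
  "\<exists>!\<tau>. \<tau> \<in> extensional (fiber_obj D p X) \<and> canonical_mate D C p X Y \<delta> f g cs cu zu \<tau>"
proof (rule ex_ex1I)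
  obtain l where l: "\<And>E. E \<in> fiber_obj D p X \<Longrightarrow> mate E (l E)" using mate_ex by metis
  have "(\<lambda>E\<in>fiber_obj D p X. cls (l E)) \<in> extensional (fiber_obj D p X) \<and>
      canonical_mate D C p X Y \<delta> f g cs cu zu (\<lambda>E\<in>fiber_obj D p X. cls (l E))"
    unfolding canonical_mate_iff using l by auto
  then show "\<exists>\<tau>. \<tau> \<in> extensional (fiber_obj D p X) \<and> canonical_mate D C p X Y \<delta> f g cs cu zu \<tau>" by blast
next
  fix \<tau> \<tau>' assume t: "\<tau> \<in> extensional (fiber_obj D p X) \<and> canonical_mate D C p X Y \<delta> f g cs cu zu \<tau>"
    "\<tau>' \<in> extensional (fiber_obj D p X) \<and> canonical_mate D C p X Y \<delta> f g cs cu zu \<tau>'"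
  have "\<tau> E = \<tau>' E" if E: "E \<in> fiber_obj D p X" for E
  proof -
    obtain l l' where "mate E l" "\<tau> E = cls l" "mate E l'" "\<tau>' E = cls l'"
      using t E unfolding canonical_mate_iff by blast
    then show ?thesis using mate_unique[OF E] cls_eq simD by metis
  qed
  then show "\<tau> = \<tau>'" using t extensionalityI by blast
qed

lemma canonical_mate_nat_iso:
  assumes \<gamma>: "\<gamma> \<in> cell C" "cdom C \<gamma> = f \<bullet> g" "ccod C \<gamma> = idn C Y"
    and tri_f: "vcmp C (comp2 C \<gamma> 0 (cidt C f)) (comp2 C (cidt C f) 0 \<delta>) = cidt C f"
    and tri_g: "vcmp C (comp2 C (cidt C g) 0 \<gamma>) (comp2 C \<delta> 0 (cidt C g)) = cidt C g"
    and \<tau>: "canonical_mate D C p X Y \<delta> f g cs cu zu \<tau>"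
  shows "nat_iso (fiber D C p X) (fiber D C p Y) (push D C p f cs) (pull D C p g zu) \<tau>"
  unfolding nat_iso_def Ob_fiber
proof (intro conjI ballI)
  show "nat_trans (fiber D C p X) (fiber D C p Y) (push D C p f cs) (pull D C p g zu) \<tau>"
    using \<tau> by (simp add: canonical_mate_def)
  fix E assume E: "E \<in> fiber_obj D p X"
  note ar = arrows[OF E]
  obtain l where l: "mate E l" "\<tau> E = cls l" using \<tau> E unfolding canonical_mate_iff by blast
  have lv: "l \<in> vY (fs E) (fl E)" and lc: "coc \<delta> (idn D E) (zu E \<cdot> (l \<cdot> cs E))"
    using l(1) by (auto simp: mate_def)
  note L = G.vX[OF lv]
  have so: "cs E \<in> over f E (fs E)" and zo: "zu E \<in> over g (fl E) E"
    using ar by (intro overI; simp)+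
  have xz: "cs E \<cdot> zu E \<in> over (cdom C \<gamma>) (fl E) (fs E)" using cmp_over[OF zo so] \<gamma>(2) by simp
  obtain n where n: "n \<in> vY (fl E) (fs E)" "coc \<gamma> (cs E \<cdot> zu E) n"
    using coc_ex[OF \<gamma>(1) xz] \<gamma>(3) by auto
  note N = G.vX[OF n(1)] and simps = ar L G.vX[OF n(1)]
  have fsE: "fs E \<in> fiber_obj D p Y" and flE: "fl E \<in> fiber_obj D p Y" using L by auto
  have lso: "l \<cdot> cs E \<in> over f E (fl E)" using cmp_over[OF so lv] by simp
  \<comment> \<open>\<open>cs E\<close> is transported along \<open>f\<close> whiskered with
    \<open>\<delta>\<close>, and the result along \<open>\<gamma>\<close> whiskered with
    \<open>f\<close>. By \<open>tri_f\<close> the total is a transport along an identity, hence an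
    isomorphism; cancelling \<open>cs E\<close> makes \<open>n\<close> a left inverse of
    \<open>l\<close>.\<close>
  have "coc (comp2 C \<gamma> 0 (cidt C f)) ((cs E \<cdot> zu E) \<cdot> (l \<cdot> cs E)) (n \<cdot> (l \<cdot> cs E))"
    using coc_cmp_right[OF n(2) xz lso] .
  moreover have "coc (comp2 C (cidt C f) 0 \<delta>) (cs E) (cs E \<cdot> (zu E \<cdot> (l \<cdot> cs E)))"
    using coc_cmp_left[OF lc idn_vert[OF E] so] cmp_idn[OF so] by simp
  moreover have "cs E \<cdot> (zu E \<cdot> (l \<cdot> cs E)) = (cs E \<cdot> zu E) \<cdot> (l \<cdot> cs E)"
    using simps by simp
  ultimately have "coc (cidt C f) (cs E) (n \<cdot> (l \<cdot> cs E))"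
    using coc_vcmp[OF _ _ so] tri_f by metis
  then have 1: "cs E \<simeq> n \<cdot> (l \<cdot> cs E)" using coc_cidt[OF so] by blast
  have nl: "n \<cdot> l \<simeq> idn D (fs E)"
  proof (rule cocartD(6)[OF cs[OF E] cmp_vert[OF Y lv n(1)] idn_vert[OF fsE]])
    show "n \<cdot> l \<cdot> cs E \<simeq> idn D (fs E) \<cdot> cs E"
      using sim_sym[OF 1] idn_cmp[OF so] simps by simp
  qed
  note zl = mate_middle[OF E l(1)]
  have zlx: "(zu E \<cdot> l) \<cdot> cs E = zu E \<cdot> (l \<cdot> cs E)" using simps by simp
  \<comment> \<open>The other triangle, applied to \<open>zu E\<close>: transport along
    \<open>\<delta>\<close> whiskered with \<open>g\<close>, then along \<open>g\<close> whiskered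
    with \<open>\<gamma>\<close>. Cancelling the Cartesian \<open>zu E\<close> makes
    \<open>n\<close> a right inverse.\<close>
  have "coc (comp2 C (cidt C g) 0 \<gamma>) ((zu E \<cdot> l) \<cdot> (cs E \<cdot> zu E)) ((zu E \<cdot> l) \<cdot> n)"
    using coc_cmp_left[OF n(2) xz zl(1)] .
  moreover have "coc (comp2 C \<delta> 0 (cidt C g)) (zu E) ((zu E \<cdot> (l \<cdot> cs E)) \<cdot> zu E)"
    using coc_cmp_right[OF lc idn_vert[OF E] zo] idn_cmp[OF zo] by simp
  moreover have "(zu E \<cdot> (l \<cdot> cs E)) \<cdot> zu E = (zu E \<cdot> l) \<cdot> (cs E \<cdot> zu E)"
    using simps by simp
  ultimately have "coc (cidt C g) (zu E) ((zu E \<cdot> l) \<cdot> n)"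
    using coc_vcmp[OF _ _ zo] tri_g by metis
  then have 2: "zu E \<simeq> (zu E \<cdot> l) \<cdot> n" using coc_cidt[OF zo] by blast
  have ln: "l \<cdot> n \<simeq> idn D (fl E)"
  proof (rule cartD(6)[OF zu[OF E] cmp_vert[OF Y n(1) lv] idn_vert[OF flE]])
    show "zu E \<cdot> (l \<cdot> n) \<simeq> zu E \<cdot> idn D (fl E)"
      using sim_sym[OF 2] cmp_idn[OF zo] simps by simp
  qed
  have "cls (n \<cdot> l) = cls (idn D (fs E))" "cls (l \<cdot> n) = cls (idn D (fl E))"
    using nl ln cls_eq simD by blast+
  then show "is_iso (fiber D C p Y) (\<tau> E)"
    unfolding l(2) category.is_iso_iff[OF category_fiber[OF Y] cls_hom[OF Y lv]]
    using cls_hom[OF Y n(1)] Cmp_fiber[OF lv n(1)] Cmp_fiber[OF n(1) lv]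
    by (intro bexI[of _ "cls n"]) (simp_all add: Idt_fiber)
qed

end

section \<open>Reversal of 2-morphisms\<close>

definition op_cat :: "('o, 'a) cat \<Rightarrow> ('o, 'a) cat" where
  "op_cat A = \<lparr>Ob = Ob A, Ar = Ar A, Dom = Cod A, Cod = Dom A, Idt = Idt A, Cmp = (\<lambda>g f. Cmp A f g)\<rparr>"

lemma op_cat_simps [simp]:
  "Ob (op_cat A) = Ob A" "Ar (op_cat A) = Ar A" "Dom (op_cat A) = Cod A" "Cod (op_cat A) = Dom A"
  "Idt (op_cat A) = Idt A" "Cmp (op_cat A) g f = Cmp A f g"
  by (simp_all add: op_cat_def)

lemma hom_op [simp]: "hom (op_cat A) x y = hom A y x"
  by (auto simp: hom_def)

lemma is_iso_op [simp]: "is_iso (op_cat A) u \<longleftrightarrow> is_iso A u"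
  by (auto simp: is_iso_def)

lemma category_op: "category A \<Longrightarrow> category (op_cat A)"
  unfolding category_def by simp

text \<open>Symmetry of isomorphism is the reason why reversing 2-morphisms changes neither the
  fibers nor the functors between them.\<close>

lemma isomorphic_op: "category A \<Longrightarrow> isomorphic (op_cat A) x y \<longleftrightarrow> isomorphic A x y"
  using category.isomorphic_sym by (fastforce simp: isomorphic_def)

lemma is_functor_op: "is_functor A B F \<Longrightarrow> is_functor (op_cat A) (op_cat B) F"
  by (auto simp: is_functor_def category_op)

lemma cocartesian_arrow_op: "cocartesian_arrow (op_cat A) (op_cat B) F u \<longleftrightarrow> cartesian_arrow A B F u"
  by (simp add: cocartesian_arrow_def cartesian_arrow_def)

lemma opfibration_op: "fibration A B F \<Longrightarrow> opfibration (op_cat A) (op_cat B) F"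
  by (simp add: opfibration_def fibration_def cocartesian_arrow_op is_functor_op)

text \<open>Reversing arrows provides lifts of isomorphisms that end at \<open>x\<close>; so the
  inverse of \<open>w\<close> is lifted, and the inverse of this lift lies over
  \<open>w\<close>.\<close>

lemma fibration_isofibration:
  assumes "fibration A B F"
  shows "isofibration A B F"
  unfolding isofibration_def
proof (intro conjI ballI allI impI)
  show F: "is_functor A B F" using assms by (simp add: fibration_def)
  interpret A: category A using F by (rule is_functorD)
  interpret B: category B using F by (rule is_functorD)
  fix x y w assume x: "x \<in> Ob A" and w: "w \<in> hom B (fo F x) y" "is_iso B w"
  obtain v where v: "v \<in> hom B y (fo F x)" "is_iso B v" "Cmp B v w = Idt B (fo F x)" "Cmp B w v = Idt B y"
    using B.iso_inverse[OF w] .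
  obtain x' t where t: "t \<in> hom A x' x" "is_iso A t" "fo F x' = y" "fa F t = v"
    using opfibration_isofibration[OF opfibration_op[OF assms]] x v unfolding isofibration_def by fastforce
  obtain u where u: "u \<in> hom A x x'" "is_iso A u" "Cmp A u t = Idt A x'" "Cmp A t u = Idt A x"
    using A.iso_inverse[OF t(1,2)] .
  have x': "x' \<in> Ob A" using t A.hom_Ob by blast
  have Fu: "fa F u \<in> hom B (fo F x) y" using is_functorD(5)[OF F u(1)] t by simp
  have "Cmp B (fa F u) v = Idt B y"
    using is_functorD(6)[OF F t(1) u(1)] is_functorD(4)[OF F x'] u t by simp
  then have "Cmp B (Cmp B (fa F u) v) w = w" using w by (simp add: B.hom_Idt_Cmp)
  then have "fa F u = w"
    using B.hom_assoc[OF w(1) v(1) Fu] v(3) Fu by (simp add: B.hom_Cmp_Idt)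
  then show "\<exists>x'. \<exists>u \<in> hom A x x'. is_iso A u \<and> fo F x' = y \<and> fa F u = w"
    using u t by blast
qed

definition co :: "('o, 'f, 't) mcat2 \<Rightarrow> ('o, 'f, 't) mcat2" where
  "co M = M\<lparr>cdom := ccod M, ccod := cdom M, vcmp := (\<lambda>b a. vcmp M a b)\<rparr>"

lemma co_simps [simp]:
  "obj (co M) = obj M" "mor (co M) = mor M" "src (co M) = src M" "tgt (co M) = tgt M"
  "cell (co M) = cell M" "cdom (co M) = ccod M" "ccod (co M) = cdom M" "cidt (co M) = cidt M"
  "vcmp (co M) b a = vcmp M a b" "idn (co M) = idn M" "comp1 (co M) = comp1 M" "comp2 (co M) = comp2 M"
  by (simp_all add: co_def)

lemma composable_co [simp]: "composable (co M) = composable M"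
  by (intro ext) (simp add: composable_def)

lemma Hom_co: "Hom (co M) Xs Y = op_cat (Hom M Xs Y)"
  by (auto simp: Hom_def op_cat_def Let_def co_def)

lemma Hom_over_co: "Hom_over (co D) (co C) p f Es F = op_cat (Hom_over D C p f Es F)"
  by (auto simp: Hom_over_def op_cat_def Let_def co_def)

context two_multicategory
begin

lemma composable2_co: "composable2 (co M) b i a \<longleftrightarrow> composable2 M b i a"
  using cell_mor[of a] cell_mor[of b] cell_parallel[of a] cell_parallel[of b]
  by (auto simp: composable2_def composable_def)

lemma two_multicategory_co: "two_multicategory (co M)"
proof (rule two_multicategory.intro)
  show "category (Hom (co M) Xs Y)" for Xs Y
    unfolding Hom_co by (rule category_op[OF Hom_category])
  \<comment> \<open>The shift of the slot counts the sources of \<open>cdom\<close>, which reversal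
    turns into \<open>ccod\<close>; both have the same sources.\<close>
  show "comp2 (co M) (comp2 (co M) b i a) (k - 1 + length (src (co M) (cdom (co M) a))) c
      = comp2 (co M) (comp2 (co M) b k c) i a"
    if "composable2 (co M) b i a" "composable2 (co M) b k c" "i < k" for b i a k c
    using comp2_slots[of b i a k c] cell_parallel[of a] that by (simp add: composable2_co) (simp add: composable2_def)
qed (use src_obj tgt_obj cell_mor cell_parallel idn_mor comp1_mor comp2_cell comp2_cidt comp2_vcmp
    comp1_idn_left comp1_idn_right comp2_idn_left comp2_idn_right comp1_assoc comp2_assoc comp1_slots
    in \<open>auto simp: composable2_co\<close>)

end

context strict_functor
begin

lemma strict_functor_co: "strict_functor (co D) (co C) p"
proof (rule strict_functor.intro)
  show "two_multicategory (co D)" "two_multicategory (co C)"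
    by (rule D.two_multicategory_co C.two_multicategory_co)+
  show "strict_functor_axioms (co D) (co C) p"
    by unfold_locales (use po_obj pm_mor pc_cell pc_cidt pc_vcmp pm_idn pm_comp1 pc_comp2
        in \<open>auto simp: D.composable2_co\<close>)
qed

lemma isomorphic_co:
  "isomorphic (Hom_over (co D) (co C) p f Es F) k l \<longleftrightarrow> isomorphic (Hom_over D C p f Es F) k l"
  unfolding Hom_over_co by (rule isomorphic_op[OF Hom_over_category])

lemma iso_class_co: "iso_class (co D) (co C) p = iso_class D C p"
  by (intro ext) (simp add: iso_class_def isomorphic_co)

lemma fiber_obj_co [simp]: "fiber_obj (co D) p X = fiber_obj D p X"
  by (simp add: fiber_obj_def)

lemma fiber_co: "fiber (co D) (co C) p X = fiber D C p X"
  by (simp add: fiber_def iso_class_co Hom_over_co)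

lemma push_co: "push (co D) (co C) p f \<xi> = push D C p f \<xi>"
  by (simp add: push_def fiber_co isomorphic_co)

lemma pull_co: "pull (co D) (co C) p f \<zeta> = pull D C p f \<zeta>"
  by (simp add: pull_def fiber_co isomorphic_co)

lemma adjoint_arrows_co: "adjoint_arrows (co D) (co C) p = adjoint_arrows D C p"
  by (intro ext) (simp add: adjoint_arrows_def push_co pull_co fiber_co isomorphic_co)

lemma sim_co: "strict_functor.sim (co D) (co C) p = sim"
  by (intro ext) (simp add: sim_def strict_functor.sim_def[OF strict_functor_co] isomorphic_co)

text \<open>\<open>cocart\<close> and \<open>cart\<close> speak only of 1-morphisms and
  \<open>\<simeq>\<close>, so they carry over directly, without reversing any 2-Cartesian
  square.\<close>

lemma cocart_co: "strict_functor.cocart (co D) (co C) p = cocart"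
  by (intro ext) (simp add: cocart_def strict_functor.cocart_def[OF strict_functor_co] sim_co Hom_over_co)

lemma cart_co: "strict_functor.cart (co D) (co C) p = cart"
  by (intro ext) (simp add: cart_def strict_functor.cart_def[OF strict_functor_co] sim_co Hom_over_co)

text \<open>The two sides read sources and target off opposite ends of \<open>\<mu>\<close>. These
  agree once \<open>\<mu>\<close> is a 2-morphism, which either side implies.\<close>

lemma cocartesian2_co: "cocartesian2 (co D) (co C) p \<mu> \<longleftrightarrow> cartesian2 D C p \<mu>"
proof -
  have "\<mu> \<in> cell D" if "cocartesian2 (co D) (co C) p \<mu> \<or> cartesian2 D C p \<mu>"
    using that by (auto simp: cocartesian2_def cartesian2_def Let_def cocartesian_arrow_def
        cartesian_arrow_def Hom_def)
  moreover have "cocartesian2 (co D) (co C) p \<mu> \<longleftrightarrow> cartesian2 D C p \<mu>" if "\<mu> \<in> cell D"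
    using D.cell_parallel[OF that]
    by (simp add: cocartesian2_def cartesian2_def Let_def Hom_co cocartesian_arrow_op)
  ultimately show ?thesis by blast
qed

text \<open>\<open>\<xi>g\<close> and \<open>\<xi>h\<close> change places because the domain and
  codomain of \<open>\<gamma>\<close> do.\<close>

lemma induced_by_opfibration_co:
  assumes "\<gamma> \<in> cell C"
  shows "induced_by_opfibration (co D) (co C) p \<gamma> \<xi>h \<xi>g a \<longleftrightarrow> induced_by_fibration D C p \<gamma> \<xi>g \<xi>h a"
  using C.cell_parallel[OF assms]
  by (auto simp: induced_by_opfibration_def induced_by_fibration_def fiber_co cocartesian2_co)

lemma two_opfibration_co: "two_fibration D C p \<Longrightarrow> two_opfibration (co D) (co C) p"
  using strict_functor_co
  by (simp add: two_fibration_def two_opfibration_def Hom_co opfibration_op cocartesian2_co D.composable2_co)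

lemma push_choice_cocart:
  assumes iso: "\<And>Es F. \<lbrakk>set Es \<subseteq> obj D; F \<in> obj D\<rbrakk>
      \<Longrightarrow> isofibration (Hom D Es F) (Hom C (map (po p) Es) (po p F)) (Hom_functor p)"
    and "push_choice D C p f \<xi>" "src C f = [X]" "E \<in> fiber_obj D p X"
  shows "cocart f E (tgt D (\<xi> E)) (\<xi> E)"
proof -
  have "cocartesian1 D C p (\<xi> E)" "pm p (\<xi> E) = f" "src D (\<xi> E) = [E]"
    using assms(2-) by (auto simp: push_choice_def)
  moreover from this have "\<xi> E \<in> over f E (tgt D (\<xi> E))"
    by (intro overI) (auto simp: cocartesian1_def)
  ultimately show ?thesis using cocartesian1_cocart[OF iso] by blast
qed

lemma pull_choice_cart:
  assumes iso: "\<And>Es F. \<lbrakk>set Es \<subseteq> obj D; F \<in> obj D\<rbrakk>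
      \<Longrightarrow> isofibration (Hom D Es F) (Hom C (map (po p) Es) (po p F)) (Hom_functor p)"
    and "pull_choice D C p f \<zeta>" "src C f = [Y]" "tgt C f = X" "E \<in> fiber_obj D p X"
  shows "cart f (hd (src D (\<zeta> E))) E (\<zeta> E)"
proof -
  have z: "cartesian1 D C p 0 (\<zeta> E)" "pm p (\<zeta> E) = f" "tgt D (\<zeta> E) = E"
    using assms(2-) by (auto simp: pull_choice_def)
  then have "\<zeta> E \<in> mor D" by (simp add: cartesian1_def)
  \<comment> \<open>\<open>pull_choice\<close> does not prescribe the source; that it is a single
    object is read off from the base.\<close>
  moreover from this have "map (po p) (src D (\<zeta> E)) = [Y]" using pm_mor z assms(3) by metis
  then have "src D (\<zeta> E) = [hd (src D (\<zeta> E))]" by (cases "src D (\<zeta> E)") auto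
  ultimately have "\<zeta> E \<in> over f (hd (src D (\<zeta> E))) E" using z by (intro overI) auto
  then show ?thesis using cartesian1_cart[OF iso] z by blast
qed

end

section \<open>The adjunction between a morphism and its opposite correspondence\<close>

lemma fiber_product_universal:
  assumes "is_fiber_product A f g p q" "u \<in> Ar A" "v \<in> Ar A" "Dom A u = Dom A v"
    "Cod A u = Dom A f" "Cod A v = Dom A g" "Cmp A f u = Cmp A g v"
  shows "\<exists>!w. w \<in> hom A (Dom A u) (Dom A p) \<and> Cmp A p w = u \<and> Cmp A q w = v"
  using assms unfolding is_fiber_product_def by blast

lemma fiber_productD:
  assumes "is_fiber_product A f g p q"
  shows "f \<in> Ar A" "g \<in> Ar A" "p \<in> Ar A" "q \<in> Ar A" "Dom A q = Dom A p" "Cod A p = Dom A f"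
    "Cod A q = Dom A g" "Cmp A f p = Cmp A g q" "Cod A f = Cod A g"
  using assms by (simp_all add: is_fiber_product_def)

text \<open>The laws of the 2-multicategory are equalities of correspondences. They constrain the
  choice \<open>pb\<close> beyond the universal property of each single fiber product.\<close>

locale correspondences = S: category S + C: two_multicategory "cor S pb S0"
  for S :: "('o, 'm) cat" and pb :: "('o, 'm) fp_choice" and S0 :: "'m set" +
  fixes f :: 'm
  assumes choice: "fiber_product_choice S pb" and admissible: "admissible_class S S0" and f: "f \<in> Ar S"
begin

abbreviation "CC \<equiv> cor S pb S0"
abbreviation "T \<equiv> Cod S f"
abbreviation "U \<equiv> Dom S f"
abbreviation "\<iota> \<equiv> Idt S"
abbreviation after (infixl "\<circ>\<^sub>S" 75) where "g \<circ>\<^sub>S h \<equiv> Cmp S g h"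

lemma cor_simps [simp]:
  "obj CC = Ob S" "mor CC = {c. is_corr S c}" "src CC (V, \<alpha>s, \<beta>) = map (Cod S) \<alpha>s" "tgt CC (V, \<alpha>s, \<beta>) = Cod S \<beta>"
  "cell CC = {a. is_corr_cell S S0 a}" "cdom CC (c, m, c') = c" "ccod CC (c, m, c') = c'"
  "cidt CC c = (c, \<iota> (fst c), c)" "vcmp CC (c2, n, c3) (c0, m, c1) = (c0, n \<circ>\<^sub>S m, c3)"
  "idn CC X = (X, [\<iota> X], \<iota> X)" "comp1 CC = corr_comp S pb" "comp2 CC = corr_comp2 S pb"
  by (simp_all add: cor_def)

lemma UT: "U \<in> Ob S" "T \<in> Ob S" using f S.Dom_Ob S.Cod_Ob by blast+

lemmas S_simps [simp] = f UT S.Idt_Ar[OF UT(1)] S.Idt_Ar[OF UT(2)] S.Dom_Idt[OF UT(1)] S.Dom_Idt[OF UT(2)]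
  S.Cod_Idt[OF UT(1)] S.Cod_Idt[OF UT(2)] S.Cmp_Ar S.Dom_Cmp S.Cod_Cmp

lemma Idt_left [simp]: "\<lbrakk>m \<in> Ar S; Cod S m = X\<rbrakk> \<Longrightarrow> \<iota> X \<circ>\<^sub>S m = m"
  and Idt_right [simp]: "\<lbrakk>m \<in> Ar S; Dom S m = X\<rbrakk> \<Longrightarrow> m \<circ>\<^sub>S \<iota> X = m"
  using S.Idt_Cmp S.Cmp_Idt by blast+

lemma corr_f [simp]: "is_corr S (corr_of S f)" "is_corr S (corr_op S f)" "is_corr S (U, [\<iota> U], \<iota> U)" "is_corr S (T, [\<iota> T], \<iota> T)"
  by (simp_all add: is_corr_def corr_of_def corr_op_def)

lemma pb_fiber_product:
  assumes "is_corr S (V, \<alpha>s', \<beta>')" "is_corr S (W, \<alpha>s, \<beta>)" "i < length \<alpha>s'" "Cod S (\<alpha>s' ! i) = Cod S \<beta>"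
    "pb (V, \<alpha>s', \<beta>') i (W, \<alpha>s, \<beta>) = (p, q)"
  shows "is_fiber_product S \<beta> (\<alpha>s' ! i) p q"
  using choice assms unfolding fiber_product_choice_def by fastforce

text \<open>Frees \<open>corr_comp2\<close> from its definite description. The map \<open>w\<close>
  between the fiber products exists because both cells commute with the legs along which the
  products are formed.\<close>

lemma comp2_underlying:
  assumes b: "is_corr_cell S S0 ((V, \<alpha>s', \<beta>'), n, (V', \<kappa>s', \<chi>'))"
    and a: "is_corr_cell S S0 ((W, \<alpha>s, \<beta>), m, (W', \<kappa>s, \<chi>))"
    and i: "i < length \<alpha>s'" "Cod S (\<alpha>s' ! i) = Cod S \<beta>"
    and pq: "pb (V, \<alpha>s', \<beta>') i (W, \<alpha>s, \<beta>) = (p, q)" and pq': "pb (V', \<kappa>s', \<chi>') i (W', \<kappa>s, \<chi>) = (p', q')"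
  shows "\<exists>w \<in> hom S (Dom S p) (Dom S p'). p' \<circ>\<^sub>S w = m \<circ>\<^sub>S p \<and> q' \<circ>\<^sub>S w = n \<circ>\<^sub>S q \<and>
     corr_comp2 S pb ((V, \<alpha>s', \<beta>'), n, (V', \<kappa>s', \<chi>')) i ((W, \<alpha>s, \<beta>), m, (W', \<kappa>s, \<chi>))
       = (corr_comp S pb (V, \<alpha>s', \<beta>') i (W, \<alpha>s, \<beta>), w, corr_comp S pb (V', \<kappa>s', \<chi>') i (W', \<kappa>s, \<chi>))"
proof -
  have B: "is_corr S (V, \<alpha>s', \<beta>')" "is_corr S (V', \<kappa>s', \<chi>')" "n \<in> Ar S" "Dom S n = V" "Cod S n = V'"
      "map (\<lambda>\<alpha>. \<alpha> \<circ>\<^sub>S n) \<kappa>s' = \<alpha>s'"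
    using b by (auto simp: is_corr_cell_def hom_def)
  have A: "is_corr S (W, \<alpha>s, \<beta>)" "is_corr S (W', \<kappa>s, \<chi>)" "m \<in> Ar S" "Dom S m = W" "Cod S m = W'"
      "\<chi> \<circ>\<^sub>S m = \<beta>"
    using a by (auto simp: is_corr_cell_def hom_def)
  have l: "i < length \<kappa>s'" using i B(6) by auto
  then have n: "\<alpha>s' ! i = (\<kappa>s' ! i) \<circ>\<^sub>S n" and k: "\<kappa>s' ! i \<in> set \<kappa>s'" using B(6) by auto
  have K: "\<kappa>s' ! i \<in> Ar S" "Dom S (\<kappa>s' ! i) = V'" and L: "\<chi> \<in> Ar S" "Dom S \<chi> = W'"
    using B(2) A(2) k by (auto simp: is_corr_def)
  have "Cod S (\<kappa>s' ! i) = Cod S \<chi>"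
    using i(2) n A(3,5) B(3,5) K L A(6)[symmetric] by simp
  note P' = pb_fiber_product[OF B(2) A(2) l this pq'] and P = pb_fiber_product[OF B(1) A(1) i pq]
  note D = fiber_productD[OF P]
  have dom: "Dom S \<beta> = W" "Dom S (\<alpha>s' ! i) = V" using A(1) B(1) i(1) by (auto simp: is_corr_def)
  have "\<exists>!w. w \<in> hom S (Dom S (m \<circ>\<^sub>S p)) (Dom S p') \<and> p' \<circ>\<^sub>S w = m \<circ>\<^sub>S p \<and> q' \<circ>\<^sub>S w = n \<circ>\<^sub>S q"
  proof (rule fiber_product_universal[OF P'])
    have "\<chi> \<circ>\<^sub>S (m \<circ>\<^sub>S p) = \<beta> \<circ>\<^sub>S p"
      using S.Cmp_assoc[of p m \<chi>] A D dom L by simp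
    also have "\<dots> = (\<kappa>s' ! i) \<circ>\<^sub>S (n \<circ>\<^sub>S q)"
      using S.Cmp_assoc[of q n "\<kappa>s' ! i"] B D dom K n by simp
    finally show "\<chi> \<circ>\<^sub>S (m \<circ>\<^sub>S p) = (\<kappa>s' ! i) \<circ>\<^sub>S (n \<circ>\<^sub>S q)" .
  qed (use A B D dom K L in simp_all)
  moreover have "Dom S (m \<circ>\<^sub>S p) = Dom S p" using A D dom by simp
  ultimately have "\<exists>!w. w \<in> hom S (Dom S p) (Dom S p') \<and> p' \<circ>\<^sub>S w = m \<circ>\<^sub>S p \<and> q' \<circ>\<^sub>S w = n \<circ>\<^sub>S q"
    by simp
  from theI'[OF this] show ?thesis
    using pq pq' by auto
qed

lemma pb_op_of:
  obtains p q where "pb (corr_op S f) 0 (corr_of S f) = (p, q)" "is_fiber_product S f f p q"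
    "corr_comp S pb (corr_op S f) 0 (corr_of S f) = (Dom S p, [p], q)"
    "diagonal S pb f \<in> hom S U (Dom S p)" "p \<circ>\<^sub>S diagonal S pb f = \<iota> U" "q \<circ>\<^sub>S diagonal S pb f = \<iota> U"
proof -
  obtain p q where pq: "pb (corr_op S f) 0 (corr_of S f) = (p, q)" by fastforce
  have P: "is_fiber_product S f f p q"
    using pb_fiber_product[of U "[f]" "\<iota> U" U "[\<iota> U]" f 0 p q] pq corr_f by (simp add: corr_of_def corr_op_def)
  note D = fiber_productD[OF P]
  have "\<exists>!d. d \<in> hom S U (Dom S p) \<and> p \<circ>\<^sub>S d = \<iota> U \<and> q \<circ>\<^sub>S d = \<iota> U"
    using fiber_product_universal[OF P, of "\<iota> U" "\<iota> U"] by simp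
  from theI'[OF this] have "diagonal S pb f \<in> hom S U (Dom S p)" "p \<circ>\<^sub>S diagonal S pb f = \<iota> U" "q \<circ>\<^sub>S diagonal S pb f = \<iota> U"
    using pq by (simp_all add: diagonal_def)
  moreover have "corr_comp S pb (corr_op S f) 0 (corr_of S f) = (Dom S p, [p], q)"
    using pq D by (simp add: corr_of_def corr_op_def)
  ultimately show ?thesis using that pq P by blast
qed

text \<open>The fiber product is that of \<open>\<iota> U\<close> with itself, so its projections
  coincide. As a base change of an isomorphism the projection lies in \<open>S0\<close>, which is
  what puts the counit cell there as soon as \<open>f\<close> is in \<open>S0\<close>.\<close>

lemma pb_of_op:
  obtains p where "pb (corr_of S f) 0 (corr_op S f) = (p, p)" "p \<in> S0" "p \<in> Ar S" "Cod S p = U"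
    "corr_comp S pb (corr_of S f) 0 (corr_op S f) = (Dom S p, [f \<circ>\<^sub>S p], f \<circ>\<^sub>S p)"
    "counit_cell S pb f = ((Dom S p, [f \<circ>\<^sub>S p], f \<circ>\<^sub>S p), f \<circ>\<^sub>S p, (T, [\<iota> T], \<iota> T))"
proof -
  obtain p q where pq: "pb (corr_of S f) 0 (corr_op S f) = (p, q)" by fastforce
  have P: "is_fiber_product S (\<iota> U) (\<iota> U) p q"
    using pb_fiber_product[of U "[\<iota> U]" f U "[f]" "\<iota> U" 0 p q] pq corr_f by (simp add: corr_of_def corr_op_def)
  have pq': "p = q" using fiber_productD[OF P] by simp
  have "is_iso S (\<iota> U)" using S.is_iso_Idt UT by blast
  then have "q \<in> S0" using admissible P unfolding admissible_class_def by blast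
  then show ?thesis using that[of q] pq[unfolded pq'] fiber_productD(4,7)[OF P]
    by (simp add: corr_of_def corr_op_def counit_cell_def)
qed

lemma diagonal_cell:
  assumes "diagonal S pb f \<in> S0"
  shows "diagonal_cell S pb f \<in> cell CC" "cdom CC (diagonal_cell S pb f) = idn CC U"
    "ccod CC (diagonal_cell S pb f) = comp1 CC (corr_op S f) 0 (corr_of S f)"
proof -
  obtain p q where "is_fiber_product S f f p q" and
    pq: "corr_comp S pb (corr_op S f) 0 (corr_of S f) = (Dom S p, [p], q)" "diagonal S pb f \<in> hom S U (Dom S p)"
    "p \<circ>\<^sub>S diagonal S pb f = \<iota> U" "q \<circ>\<^sub>S diagonal S pb f = \<iota> U"
    using pb_op_of by metis
  note D = fiber_productD[OF this(1)]
  have "is_corr S (Dom S p, [p], q)" using D S.Dom_Ob by (simp add: is_corr_def)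
  then show "diagonal_cell S pb f \<in> cell CC"
    using assms pq by (simp add: diagonal_cell_def is_corr_cell_def del: corr_comp.simps)
  show "cdom CC (diagonal_cell S pb f) = idn CC U"
    "ccod CC (diagonal_cell S pb f) = comp1 CC (corr_op S f) 0 (corr_of S f)"
    by (simp_all add: diagonal_cell_def)
qed

lemma counit_cell:
  assumes "f \<in> S0"
  shows "counit_cell S pb f \<in> cell CC" "cdom CC (counit_cell S pb f) = comp1 CC (corr_of S f) 0 (corr_op S f)"
    "ccod CC (counit_cell S pb f) = idn CC T"
proof -
  obtain p where p: "p \<in> S0" "p \<in> Ar S" "Cod S p = U"
    "corr_comp S pb (corr_of S f) 0 (corr_op S f) = (Dom S p, [f \<circ>\<^sub>S p], f \<circ>\<^sub>S p)"
    "counit_cell S pb f = ((Dom S p, [f \<circ>\<^sub>S p], f \<circ>\<^sub>S p), f \<circ>\<^sub>S p, (T, [\<iota> T], \<iota> T))"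
    using pb_of_op by metis
  have "f \<circ>\<^sub>S p \<in> S0" using admissible p assms unfolding admissible_class_def by simp
  moreover have "is_corr S (Dom S p, [f \<circ>\<^sub>S p], f \<circ>\<^sub>S p)" using p S.Dom_Ob by (simp add: is_corr_def)
  ultimately show "counit_cell S pb f \<in> cell CC"
    using p corr_f by (simp add: is_corr_cell_def hom_def)
  show "cdom CC (counit_cell S pb f) = comp1 CC (corr_of S f) 0 (corr_op S f)"
    "ccod CC (counit_cell S pb f) = idn CC T"
    using p by simp_all
qed

lemma src_tgt:
  "corr_of S f \<in> mor CC" "src CC (corr_of S f) = [U]" "tgt CC (corr_of S f) = T"
  "corr_op S f \<in> mor CC" "src CC (corr_op S f) = [T]" "tgt CC (corr_op S f) = U"
  by (simp_all add: corr_of_def corr_op_def is_corr_def)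

lemma cidt_cells:
  "is_corr_cell S S0 (corr_of S f, \<iota> U, corr_of S f)" "is_corr_cell S S0 (corr_op S f, \<iota> U, corr_op S f)"
  using C.cidt_cell[OF src_tgt(1)] C.cidt_cell[OF src_tgt(4)] by (simp_all add: corr_of_def corr_op_def)

lemma units:
  "corr_comp S pb (corr_of S f) 0 (U, [\<iota> U], \<iota> U) = corr_of S f"
  "corr_comp S pb (T, [\<iota> T], \<iota> T) 0 (corr_of S f) = corr_of S f"
  "corr_comp S pb (corr_op S f) 0 (T, [\<iota> T], \<iota> T) = corr_op S f"
  "corr_comp S pb (U, [\<iota> U], \<iota> U) 0 (corr_op S f) = corr_op S f"
  using C.comp1_idn[OF src_tgt(1,2)] C.idn_comp1[OF src_tgt(1,3)]
    C.comp1_idn[OF src_tgt(4,5)] C.idn_comp1[OF src_tgt(4,6)] by simp_all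

text \<open>The source leg of \<open>corr_of S f\<close> is an identity, so it is enough to follow
  the source legs through the two whiskered cells. What remains is the first projection after the
  diagonal.\<close>

lemma triangle_of:
  assumes "f \<in> S0" "diagonal S pb f \<in> S0"
  shows "vcmp CC (comp2 CC (counit_cell S pb f) 0 (cidt CC (corr_of S f)))
      (comp2 CC (cidt CC (corr_of S f)) 0 (diagonal_cell S pb f)) = cidt CC (corr_of S f)"
proof -
  let ?F = "corr_of S f" and ?d = "diagonal S pb f"
  obtain p2 q2 where gf: "pb (corr_op S f) 0 ?F = (p2, q2)" "is_fiber_product S f f p2 q2"
    "corr_comp S pb (corr_op S f) 0 ?F = (Dom S p2, [p2], q2)"
    "?d \<in> hom S U (Dom S p2)" "p2 \<circ>\<^sub>S ?d = \<iota> U" "q2 \<circ>\<^sub>S ?d = \<iota> U"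
    using pb_op_of by metis
  obtain p3 where fg: "pb ?F 0 (corr_op S f) = (p3, p3)" "p3 \<in> Ar S" "Cod S p3 = U"
    "corr_comp S pb ?F 0 (corr_op S f) = (Dom S p3, [f \<circ>\<^sub>S p3], f \<circ>\<^sub>S p3)"
    "counit_cell S pb f = ((Dom S p3, [f \<circ>\<^sub>S p3], f \<circ>\<^sub>S p3), f \<circ>\<^sub>S p3, (T, [\<iota> T], \<iota> T))"
    using pb_of_op by metis
  note D2 = fiber_productD[OF gf(2)]
  have dc: "diagonal_cell S pb f = ((U, [\<iota> U], \<iota> U), ?d, (Dom S p2, [p2], q2))"
    using gf by (simp add: diagonal_cell_def)
  have d: "?d \<in> Ar S" "Dom S ?d = U" "Cod S ?d = Dom S p2" using gf by (auto simp: hom_def)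
  obtain p q where pq: "pb ?F 0 (U, [\<iota> U], \<iota> U) = (p, q)" by fastforce
  obtain p' q' where pq': "pb ?F 0 (Dom S p2, [p2], q2) = (p', q')" by fastforce
  obtain p4 q4 where pq4: "pb (Dom S p3, [f \<circ>\<^sub>S p3], f \<circ>\<^sub>S p3) 0 ?F = (p4, q4)" by fastforce
  obtain p5 q5 where pq5: "pb (T, [\<iota> T], \<iota> T) 0 ?F = (p5, q5)" by fastforce
  have cd: "is_corr_cell S S0 ((U, [\<iota> U], \<iota> U), ?d, (Dom S p2, [p2], q2))"
    using diagonal_cell(1)[OF assms(2)] dc by simp
  have cc: "is_corr_cell S S0 ((Dom S p3, [f \<circ>\<^sub>S p3], f \<circ>\<^sub>S p3), f \<circ>\<^sub>S p3, (T, [\<iota> T], \<iota> T))"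
    using counit_cell(1)[OF assms(1)] fg by simp
  have corrs: "is_corr S (Dom S p2, [p2], q2)" "is_corr S (Dom S p3, [f \<circ>\<^sub>S p3], f \<circ>\<^sub>S p3)"
    using cd cc by (auto simp: is_corr_cell_def)
  have P: "is_fiber_product S (\<iota> U) (\<iota> U) p q"
    using pb_fiber_product[of U "[\<iota> U]" f U "[\<iota> U]" "\<iota> U" 0 p q] pq corr_f by (simp add: corr_of_def)
  have P': "is_fiber_product S q2 (\<iota> U) p' q'"
    using pb_fiber_product[of U "[\<iota> U]" f "Dom S p2" "[p2]" q2 0 p' q'] pq' corr_f corrs D2 by (simp add: corr_of_def)
  have P4: "is_fiber_product S f (f \<circ>\<^sub>S p3) p4 q4"
    using pb_fiber_product[of "Dom S p3" "[f \<circ>\<^sub>S p3]" "f \<circ>\<^sub>S p3" U "[\<iota> U]" f 0 p4 q4] pq4 corr_f corrs fg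
    by (simp add: corr_of_def)
  have P5: "is_fiber_product S f (\<iota> T) p5 q5"
    using pb_fiber_product[of T "[\<iota> T]" "\<iota> T" U "[\<iota> U]" f 0 p5 q5] pq5 corr_f by (simp add: corr_of_def)
  note D = fiber_productD[OF P] and D' = fiber_productD[OF P'] and D4 = fiber_productD[OF P4] and D5 = fiber_productD[OF P5]
  \<comment> \<open>The strict unit laws, read on the source leg, turn the projections
    \<open>p\<close> and \<open>p5\<close> of the two composites with identities into
    identities.\<close>
  have p: "p = \<iota> U" using units(1) pq D(3,6) by (simp add: corr_of_def)
  have p5: "p5 = \<iota> U" using units(2) pq5 D5(3,6) by (simp add: corr_of_def)
  have "composable CC ?F 0 (corr_op S f)" "composable CC (corr_op S f) 0 ?F"
    using src_tgt by (auto simp: composable_def)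
  then have "corr_comp S pb (Dom S p3, [f \<circ>\<^sub>S p3], f \<circ>\<^sub>S p3) 0 ?F = corr_comp S pb ?F 0 (Dom S p2, [p2], q2)"
    using C.comp1_assoc[of ?F 0 "corr_op S f" 0 ?F] gf fg by simp
  \<comment> \<open>Strict associativity on the source leg expresses the projection for
    \<open>(f \<circ> f^op) \<circ> f\<close> through those for
    \<open>f \<circ> (f^op \<circ> f)\<close>.\<close>
  then have p4: "p4 = p2 \<circ>\<^sub>S p'" "Dom S p4 = Dom S p'"
    using pq4 pq' D4(3,6) D'(3,6) D2(3,5) by (simp_all add: corr_of_def)
  obtain w where w: "w \<in> hom S (Dom S p) (Dom S p')" "p' \<circ>\<^sub>S w = ?d \<circ>\<^sub>S p"
    "comp2 CC (cidt CC ?F) 0 (diagonal_cell S pb f)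
      = (corr_comp S pb ?F 0 (U, [\<iota> U], \<iota> U), w, corr_comp S pb ?F 0 (Dom S p2, [p2], q2))"
    using comp2_underlying[of U "[\<iota> U]" f "\<iota> U" U "[\<iota> U]" f U "[\<iota> U]" "\<iota> U" ?d "Dom S p2" "[p2]" q2 0 p q p' q']
      cidt_cells(1) cd pq pq' dc by (auto simp: corr_of_def simp del: corr_comp.simps corr_comp2.simps)
  obtain w' where w': "w' \<in> hom S (Dom S p4) (Dom S p5)" "p5 \<circ>\<^sub>S w' = \<iota> U \<circ>\<^sub>S p4"
    "comp2 CC (counit_cell S pb f) 0 (cidt CC ?F)
      = (corr_comp S pb (Dom S p3, [f \<circ>\<^sub>S p3], f \<circ>\<^sub>S p3) 0 ?F, w', corr_comp S pb (T, [\<iota> T], \<iota> T) 0 ?F)"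
    using comp2_underlying[of "Dom S p3" "[f \<circ>\<^sub>S p3]" "f \<circ>\<^sub>S p3" "f \<circ>\<^sub>S p3" T "[\<iota> T]" "\<iota> T" U "[\<iota> U]" f "\<iota> U" U "[\<iota> U]" f 0 p4 q4 p5 q5]
      cidt_cells(1) cc pq4 pq5 fg by (auto simp: corr_of_def simp del: corr_comp.simps corr_comp2.simps)
  have "w' = p4" using w'(1,2) p5 D4(3,6) by (simp add: hom_def)
  then have "w' \<circ>\<^sub>S w = p2 \<circ>\<^sub>S (p' \<circ>\<^sub>S w)"
    using p4 S.Cmp_assoc[of w p' p2] w(1) D'(3,6) D2(3,5) by (simp add: hom_def)
  also have "\<dots> = \<iota> U" using w(2) p d gf(5) by simp
  finally show ?thesis
    using w w' units by (simp add: corr_of_def del: corr_comp.simps corr_comp2.simps)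
qed

text \<open>Mirror image of \<open>triangle_of\<close>: the target leg of \<open>corr_op S f\<close>
  is an identity, so the target legs are followed, and the second projection after the diagonal
  remains.\<close>

lemma triangle_op:
  assumes "f \<in> S0" "diagonal S pb f \<in> S0"
  shows "vcmp CC (comp2 CC (cidt CC (corr_op S f)) 0 (counit_cell S pb f))
      (comp2 CC (diagonal_cell S pb f) 0 (cidt CC (corr_op S f))) = cidt CC (corr_op S f)"
proof -
  let ?G = "corr_op S f" and ?d = "diagonal S pb f"
  obtain p2 q2 where gf: "pb ?G 0 (corr_of S f) = (p2, q2)" "is_fiber_product S f f p2 q2"
    "corr_comp S pb ?G 0 (corr_of S f) = (Dom S p2, [p2], q2)"
    "?d \<in> hom S U (Dom S p2)" "p2 \<circ>\<^sub>S ?d = \<iota> U" "q2 \<circ>\<^sub>S ?d = \<iota> U"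
    using pb_op_of by metis
  obtain p3 where fg: "pb (corr_of S f) 0 ?G = (p3, p3)" "p3 \<in> Ar S" "Cod S p3 = U"
    "corr_comp S pb (corr_of S f) 0 ?G = (Dom S p3, [f \<circ>\<^sub>S p3], f \<circ>\<^sub>S p3)"
    "counit_cell S pb f = ((Dom S p3, [f \<circ>\<^sub>S p3], f \<circ>\<^sub>S p3), f \<circ>\<^sub>S p3, (T, [\<iota> T], \<iota> T))"
    using pb_of_op by metis
  note D2 = fiber_productD[OF gf(2)]
  have dc: "diagonal_cell S pb f = ((U, [\<iota> U], \<iota> U), ?d, (Dom S p2, [p2], q2))"
    using gf by (simp add: diagonal_cell_def)
  have d: "?d \<in> Ar S" "Dom S ?d = U" "Cod S ?d = Dom S p2" using gf by (auto simp: hom_def)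
  obtain p q where pq: "pb (U, [\<iota> U], \<iota> U) 0 ?G = (p, q)" by fastforce
  obtain p' q' where pq': "pb (Dom S p2, [p2], q2) 0 ?G = (p', q')" by fastforce
  obtain p4 q4 where pq4: "pb ?G 0 (Dom S p3, [f \<circ>\<^sub>S p3], f \<circ>\<^sub>S p3) = (p4, q4)" by fastforce
  obtain p5 q5 where pq5: "pb ?G 0 (T, [\<iota> T], \<iota> T) = (p5, q5)" by fastforce
  have cd: "is_corr_cell S S0 ((U, [\<iota> U], \<iota> U), ?d, (Dom S p2, [p2], q2))"
    using diagonal_cell(1)[OF assms(2)] dc by simp
  have cc: "is_corr_cell S S0 ((Dom S p3, [f \<circ>\<^sub>S p3], f \<circ>\<^sub>S p3), f \<circ>\<^sub>S p3, (T, [\<iota> T], \<iota> T))"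
    using counit_cell(1)[OF assms(1)] fg by simp
  have corrs: "is_corr S (Dom S p2, [p2], q2)" "is_corr S (Dom S p3, [f \<circ>\<^sub>S p3], f \<circ>\<^sub>S p3)"
    using cd cc by (auto simp: is_corr_cell_def)
  have P: "is_fiber_product S (\<iota> U) (\<iota> U) p q"
    using pb_fiber_product[of U "[\<iota> U]" "\<iota> U" U "[f]" "\<iota> U" 0 p q] pq corr_f by (simp add: corr_op_def)
  have P': "is_fiber_product S (\<iota> U) p2 p' q'"
    using pb_fiber_product[of "Dom S p2" "[p2]" q2 U "[f]" "\<iota> U" 0 p' q'] pq' corr_f corrs D2 by (simp add: corr_op_def)
  have P4: "is_fiber_product S (f \<circ>\<^sub>S p3) f p4 q4"
    using pb_fiber_product[of U "[f]" "\<iota> U" "Dom S p3" "[f \<circ>\<^sub>S p3]" "f \<circ>\<^sub>S p3" 0 p4 q4] pq4 corr_f corrs fg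
    by (simp add: corr_op_def)
  have P5: "is_fiber_product S (\<iota> T) f p5 q5"
    using pb_fiber_product[of U "[f]" "\<iota> U" T "[\<iota> T]" "\<iota> T" 0 p5 q5] pq5 corr_f by (simp add: corr_op_def)
  note D = fiber_productD[OF P] and D' = fiber_productD[OF P'] and D4 = fiber_productD[OF P4] and D5 = fiber_productD[OF P5]
  have q: "q = \<iota> U" using units(4) pq D(4,7) by (simp add: corr_op_def)
  have q5: "q5 = \<iota> U" using units(3) pq5 D5(4,7) by (simp add: corr_op_def)
  have "composable CC ?G 0 (corr_of S f)" "composable CC (corr_of S f) 0 ?G"
    using src_tgt by (auto simp: composable_def)
  then have "corr_comp S pb (Dom S p2, [p2], q2) 0 ?G = corr_comp S pb ?G 0 (Dom S p3, [f \<circ>\<^sub>S p3], f \<circ>\<^sub>S p3)"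
    using C.comp1_assoc[of ?G 0 "corr_of S f" 0 ?G] gf fg by simp
  then have q4: "q4 = q2 \<circ>\<^sub>S q'" "Dom S p4 = Dom S p'"
    using pq4 pq' D4(4,7) by (simp_all add: corr_op_def)
  obtain w where w: "w \<in> hom S (Dom S p) (Dom S p')" "q' \<circ>\<^sub>S w = ?d \<circ>\<^sub>S q"
    "comp2 CC (diagonal_cell S pb f) 0 (cidt CC ?G)
      = (corr_comp S pb (U, [\<iota> U], \<iota> U) 0 ?G, w, corr_comp S pb (Dom S p2, [p2], q2) 0 ?G)"
    using comp2_underlying[of U "[\<iota> U]" "\<iota> U" ?d "Dom S p2" "[p2]" q2 U "[f]" "\<iota> U" "\<iota> U" U "[f]" "\<iota> U" 0 p q p' q']
      cidt_cells(2) cd pq pq' dc by (auto simp: corr_op_def simp del: corr_comp.simps corr_comp2.simps)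
  obtain w' where w': "w' \<in> hom S (Dom S p4) (Dom S p5)" "q5 \<circ>\<^sub>S w' = \<iota> U \<circ>\<^sub>S q4"
    "comp2 CC (cidt CC ?G) 0 (counit_cell S pb f)
      = (corr_comp S pb ?G 0 (Dom S p3, [f \<circ>\<^sub>S p3], f \<circ>\<^sub>S p3), w', corr_comp S pb ?G 0 (T, [\<iota> T], \<iota> T))"
    using comp2_underlying[of U "[f]" "\<iota> U" "\<iota> U" U "[f]" "\<iota> U" "Dom S p3" "[f \<circ>\<^sub>S p3]" "f \<circ>\<^sub>S p3" "f \<circ>\<^sub>S p3" T "[\<iota> T]" "\<iota> T" 0 p4 q4 p5 q5]
      cidt_cells(2) cc pq4 pq5 fg by (auto simp: corr_op_def simp del: corr_comp.simps corr_comp2.simps)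
  have "w' = q4" using w'(1,2) q5 D4(4,7) D5(5) by (simp add: hom_def)
  then have "w' \<circ>\<^sub>S w = q2 \<circ>\<^sub>S (q' \<circ>\<^sub>S w)"
    using q4 S.Cmp_assoc[of w q' q2] w(1) D'(4,5,7) D2(4,5) by (simp add: hom_def)
  also have "\<dots> = \<iota> U" using w(2) q d gf(6) by simp
  finally show ?thesis
    using w w' units by (simp add: corr_op_def del: corr_comp.simps corr_comp2.simps)
qed

end

section \<open>The canonical transformations\<close>

lemma canonical_shriek_to_star_mate:
  "canonical_shriek_to_star S pb C D p f cs cu zu \<tau> \<longleftrightarrow>
     canonical_mate D C p (Dom S f) (Cod S f) (diagonal_cell S pb f) (corr_of S f) (corr_op S f) cs cu zu \<tau>"
  by (simp add: canonical_shriek_to_star_def canonical_mate_def Let_def Ob_fiber)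

text \<open>After reversal the counit cell starts at the identity of \<open>Cod S f\<close>, which
  is the shape that \<open>canonical_mate\<close> expects of \<open>\<delta>\<close>. That it is a
  2-morphism is needed to reverse the notion of induced arrow.\<close>

lemma canonical_star_to_shriek_mate:
  assumes "strict_functor D C p" and \<gamma>: "counit_cell S pb f \<in> cell C"
  shows "canonical_star_to_shriek S pb C D p f cs cu zs \<tau> \<longleftrightarrow>
     canonical_mate (co D) (co C) p (Cod S f) (Dom S f) (counit_cell S pb f) (corr_op S f) (corr_of S f) cu cs zs \<tau>"
proof -
  interpret strict_functor D C p by fact
  show ?thesis
    by (simp add: canonical_star_to_shriek_def canonical_mate_def Let_def Ob_fiber
        fiber_co push_co pull_co adjoint_arrows_co induced_by_opfibration_co[OF \<gamma>])
qed

lemma proper_shriek_to_star: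
  assumes S: "category S" "fiber_product_choice S pb" "admissible_class S S0"
    and D: "proper_six_functor_formalism S pb S0 D p" and f: "f \<in> Ar S"
    and cs: "push_choice D (cor S pb S0) p (corr_of S f) cs"
    and cu: "push_choice D (cor S pb S0) p (corr_op S f) cu"
    and zu: "pull_choice D (cor S pb S0) p (corr_op S f) zu"
    and \<Delta>: "diagonal S pb f \<in> S0"
  shows "\<exists>!\<tau>. \<tau> \<in> extensional (fiber_obj D p (Dom S f)) \<and>
      canonical_shriek_to_star S pb (cor S pb S0) D p f cs cu zu \<tau>"
    and "f \<in> S0 \<Longrightarrow> canonical_shriek_to_star S pb (cor S pb S0) D p f cs cu zu \<tau> \<Longrightarrow>
      nat_iso (fiber D (cor S pb S0) p (Dom S f)) (fiber D (cor S pb S0) p (Cod S f))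
        (push D (cor S pb S0) p (corr_of S f) cs) (pull D (cor S pb S0) p (corr_op S f) zu) \<tau>"
proof -
  have o: "two_opfibration D (cor S pb S0) p"
    using D by (simp add: proper_six_functor_formalism_def)
  interpret strict_functor D "cor S pb S0" p using o by (simp add: two_opfibration_def)
  interpret correspondences S pb S0 f
    using S f C.two_multicategory_axioms by (simp add: correspondences_def correspondences_axioms_def)
  have iso: "isofibration (Hom D Es F) (Hom CC (map (po p) Es) (po p F)) (Hom_functor p)"
    if "set Es \<subseteq> obj D" "F \<in> obj D" for Es F
    using o that opfibration_isofibration unfolding two_opfibration_def by blast
  interpret mate_situation D CC p U T "corr_of S f" "corr_op S f" "diagonal_cell S pb f" cs cu zu
  proof (unfold_locales)
    show "two_opfibration D CC p" by (rule o)
  qed (use src_tgt diagonal_cell[OF \<Delta>] UT push_choice_cocart[OF iso cs] push_choice_cocart[OF iso cu]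
      pull_choice_cart[OF iso zu] in \<open>simp_all del: cor_simps(3-)\<close>)
  show "\<exists>!\<tau>. \<tau> \<in> extensional (fiber_obj D p U) \<and> canonical_shriek_to_star S pb CC D p f cs cu zu \<tau>"
    unfolding canonical_shriek_to_star_mate by (rule canonical_mate_ex1)
  assume "f \<in> S0" "canonical_shriek_to_star S pb CC D p f cs cu zu \<tau>"
  \<comment> \<open>The diagonal gives the unit; \<open>f\<close> in \<open>S0\<close> supplies the
    counit cell as a 2-morphism of the base.\<close>
  then show "nat_iso (fiber D CC p U) (fiber D CC p T) (push D CC p (corr_of S f) cs) (pull D CC p (corr_op S f) zu) \<tau>"
    unfolding canonical_shriek_to_star_mate
    using canonical_mate_nat_iso[OF counit_cell triangle_of triangle_op] \<Delta> by blast
qed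

lemma etale_star_to_shriek:
  assumes S: "category S" "fiber_product_choice S pb" "admissible_class S S0"
    and D: "etale_six_functor_formalism S pb S0 D p" and f: "f \<in> Ar S"
    and cs: "push_choice D (cor S pb S0) p (corr_of S f) cs"
    and cu: "push_choice D (cor S pb S0) p (corr_op S f) cu"
    and zs: "pull_choice D (cor S pb S0) p (corr_of S f) zs"
    and f0: "f \<in> S0"
  shows "\<exists>!\<tau>. \<tau> \<in> extensional (fiber_obj D p (Cod S f)) \<and>
      canonical_star_to_shriek S pb (cor S pb S0) D p f cs cu zs \<tau>"
    and "diagonal S pb f \<in> S0 \<Longrightarrow> canonical_star_to_shriek S pb (cor S pb S0) D p f cs cu zs \<tau> \<Longrightarrow>
      nat_iso (fiber D (cor S pb S0) p (Cod S f)) (fiber D (cor S pb S0) p (Dom S f))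
        (push D (cor S pb S0) p (corr_op S f) cu) (pull D (cor S pb S0) p (corr_of S f) zs) \<tau>"
proof -
  have o: "two_fibration D (cor S pb S0) p"
    using D by (simp add: etale_six_functor_formalism_def)
  interpret strict_functor D "cor S pb S0" p using o by (simp add: two_fibration_def)
  interpret correspondences S pb S0 f
    using S f C.two_multicategory_axioms by (simp add: correspondences_def correspondences_axioms_def)
  have iso: "isofibration (Hom D Es F) (Hom CC (map (po p) Es) (po p F)) (Hom_functor p)"
    if "set Es \<subseteq> obj D" "F \<in> obj D" for Es F
    using o that fibration_isofibration unfolding two_fibration_def by blast
  note mate = canonical_star_to_shriek_mate[OF strict_functor_axioms counit_cell(1)[OF f0]]
  \<comment> \<open>The reversed counit cell goes from the identity of \<open>T\<close> to the
    composite of \<open>corr_of S f\<close> after \<open>corr_op S f\<close>, so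
    \<open>corr_op S f\<close> takes the place of \<open>f\<close>.\<close>
  have m: "mate_situation (co D) (co CC) p T U (corr_op S f) (corr_of S f) (counit_cell S pb f) cu cs zs"
    unfolding mate_situation_def mate_situation_axioms_def two_opfib_def two_opfib_axioms_def
    using strict_functor_co two_opfibration_co[OF o] src_tgt counit_cell[OF f0] UT
      push_choice_cocart[OF iso cs] push_choice_cocart[OF iso cu] pull_choice_cart[OF iso zs]
    by (simp add: cocart_co cart_co del: cor_simps(3-))
  show "\<exists>!\<tau>. \<tau> \<in> extensional (fiber_obj D p T) \<and> canonical_star_to_shriek S pb CC D p f cs cu zs \<tau>"
    unfolding mate using mate_situation.canonical_mate_ex1[OF m] by simp
  assume "diagonal S pb f \<in> S0" "canonical_star_to_shriek S pb CC D p f cs cu zs \<tau>"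
  \<comment> \<open>Now the diagonal cell acts as the counit. As vertical composition is reversed
    too, \<open>triangle_op\<close> becomes the identity \<open>tri_f\<close> and
    \<open>triangle_of\<close> becomes \<open>tri_g\<close>.\<close>
  then show "nat_iso (fiber D CC p T) (fiber D CC p U) (push D CC p (corr_op S f) cu) (pull D CC p (corr_of S f) zs) \<tau>"
    unfolding mate
    using mate_situation.canonical_mate_nat_iso[OF m, of "diagonal_cell S pb f" \<tau>]
      diagonal_cell triangle_of[OF f0] triangle_op[OF f0]
    by (simp add: fiber_co push_co pull_co del: cor_simps(3-))
qed

text \<open>Makes the condition on the diagonal automatic in both contexts, where the class of all
  morphisms takes the place of \<open>S0\<close>.\<close>

lemma diagonal_Ar:
  assumes "category S" "strict_fiber_product_choice S pb" "f \<in> Ar S"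
  shows "diagonal S pb f \<in> Ar S"
proof -
  interpret category S by fact
  interpret correspondences S pb "Ar S" f
    using assms Cmp_Ar
    by (simp add: correspondences_def correspondences_axioms_def strict_fiber_product_choice_def cor_G_def
        admissible_class_def is_iso_def is_fiber_product_def)
  show ?thesis using pb_op_of by (metis (no_types, lifting) hom_def mem_Collect_eq)
qed

theorem proposition8p3:
  fixes S :: "('o, 'm) cat" and pb :: "('o, 'm) fp_choice" and S0 :: "'m set"
  assumes "category S"
    and "has_fiber_products S"
    and "\<exists>t. final_object S t"
    and "strict_fiber_product_choice S pb"
    and "admissible_class S S0"
  shows
    "(\<forall>(D :: ('x, 'f, 't) mcat2) p.
        proper_six_functor_formalism S pb S0 D p \<longrightarrow>
        (\<forall>f \<in> Ar S. \<forall>cs cu zu.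
           push_choice D (cor S pb S0) p (corr_of S f) cs \<and>
           push_choice D (cor S pb S0) p (corr_op S f) cu \<and>
           pull_choice D (cor S pb S0) p (corr_op S f) zu \<and>
           diagonal S pb f \<in> S0 \<longrightarrow>
             (\<exists>!\<tau>. \<tau> \<in> extensional (fiber_obj D p (Dom S f)) \<and>
                canonical_shriek_to_star S pb (cor S pb S0) D p f cs cu zu \<tau>) \<and>
             (f \<in> S0 \<longrightarrow>
                (\<forall>\<tau>. canonical_shriek_to_star S pb (cor S pb S0) D p f cs cu zu \<tau> \<longrightarrow>
                   nat_iso (fiber D (cor S pb S0) p (Dom S f)) (fiber D (cor S pb S0) p (Cod S f))
                     (push D (cor S pb S0) p (corr_of S f) cs)
                     (pull D (cor S pb S0) p (corr_op S f) zu) \<tau>)))) \<and>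
     (\<forall>(D :: ('x, 'f, 't) mcat2) p.
        etale_six_functor_formalism S pb S0 D p \<longrightarrow>
        (\<forall>f \<in> Ar S. \<forall>cs cu zs.
           push_choice D (cor S pb S0) p (corr_of S f) cs \<and>
           push_choice D (cor S pb S0) p (corr_op S f) cu \<and>
           pull_choice D (cor S pb S0) p (corr_of S f) zs \<and>
           f \<in> S0 \<longrightarrow>
             (\<exists>!\<tau>. \<tau> \<in> extensional (fiber_obj D p (Cod S f)) \<and>
                canonical_star_to_shriek S pb (cor S pb S0) D p f cs cu zs \<tau>) \<and>
             (diagonal S pb f \<in> S0 \<longrightarrow>
                (\<forall>\<tau>. canonical_star_to_shriek S pb (cor S pb S0) D p f cs cu zs \<tau> \<longrightarrow>
                   nat_iso (fiber D (cor S pb S0) p (Cod S f)) (fiber D (cor S pb S0) p (Dom S f))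
                     (push D (cor S pb S0) p (corr_op S f) cu)
                     (pull D (cor S pb S0) p (corr_of S f) zs) \<tau>)))) \<and>
     (\<forall>(D :: ('x, 'f, 't) mcat2) p.
        wirthmueller_context S pb D p \<longrightarrow>
        (\<forall>f \<in> Ar S. \<forall>cs cu zs.
           push_choice D (cor_G S pb) p (corr_of S f) cs \<and>
           push_choice D (cor_G S pb) p (corr_op S f) cu \<and>
           pull_choice D (cor_G S pb) p (corr_of S f) zs \<longrightarrow>
             (\<exists>!\<tau>. \<tau> \<in> extensional (fiber_obj D p (Cod S f)) \<and>
                canonical_star_to_shriek S pb (cor_G S pb) D p f cs cu zs \<tau> \<and>
                nat_iso (fiber D (cor_G S pb) p (Cod S f)) (fiber D (cor_G S pb) p (Dom S f))
                  (push D (cor_G S pb) p (corr_op S f) cu)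
                  (pull D (cor_G S pb) p (corr_of S f) zs) \<tau>))) \<and>
     (\<forall>(D :: ('x, 'f, 't) mcat2) p.
        grothendieck_context S pb D p \<longrightarrow>
        (\<forall>f \<in> Ar S. \<forall>cs cu zu.
           push_choice D (cor_G S pb) p (corr_of S f) cs \<and>
           push_choice D (cor_G S pb) p (corr_op S f) cu \<and>
           pull_choice D (cor_G S pb) p (corr_op S f) zu \<longrightarrow>
             (\<exists>!\<tau>. \<tau> \<in> extensional (fiber_obj D p (Dom S f)) \<and>
                canonical_shriek_to_star S pb (cor_G S pb) D p f cs cu zu \<tau> \<and>
                nat_iso (fiber D (cor_G S pb) p (Dom S f)) (fiber D (cor_G S pb) p (Cod S f))
                  (push D (cor_G S pb) p (corr_of S f) cs)
                  (pull D (cor_G S pb) p (corr_op S f) zu) \<tau>)))"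
proof (intro conjI allI impI ballI)
  have choice: "fiber_product_choice S pb" using assms(4) by (simp add: strict_fiber_product_choice_def)
  have adm: "admissible_class S (Ar S)"
    using category.Cmp_Ar[OF assms(1)] by (simp add: admissible_class_def is_iso_def is_fiber_product_def)
  note proper = proper_shriek_to_star[OF assms(1) choice]
  note etale = etale_star_to_shriek[OF assms(1) choice]
  note diag = diagonal_Ar[OF assms(1,4)]
  {
    fix D :: "('x, 'f, 't) mcat2" and p f cs cu zu
    assume D: "proper_six_functor_formalism S pb S0 D p" and f: "f \<in> Ar S"
      and ch: "push_choice D (cor S pb S0) p (corr_of S f) cs \<and> push_choice D (cor S pb S0) p (corr_op S f) cu \<and>
        pull_choice D (cor S pb S0) p (corr_op S f) zu \<and> diagonal S pb f \<in> S0"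
    note P = proper[OF assms(5) D f ch[THEN conjunct1] ch[THEN conjunct2, THEN conjunct1]
        ch[THEN conjunct2, THEN conjunct2, THEN conjunct1] ch[THEN conjunct2, THEN conjunct2, THEN conjunct2]]
    show "\<exists>!\<tau>. \<tau> \<in> extensional (fiber_obj D p (Dom S f)) \<and>
        canonical_shriek_to_star S pb (cor S pb S0) D p f cs cu zu \<tau>"
      by (rule P(1))
    fix \<tau> assume "f \<in> S0" "canonical_shriek_to_star S pb (cor S pb S0) D p f cs cu zu \<tau>"
    then show "nat_iso (fiber D (cor S pb S0) p (Dom S f)) (fiber D (cor S pb S0) p (Cod S f))
        (push D (cor S pb S0) p (corr_of S f) cs) (pull D (cor S pb S0) p (corr_op S f) zu) \<tau>"
      by (rule P(2))
  next
    fix D :: "('x, 'f, 't) mcat2" and p f cs cu zs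
    assume D: "etale_six_functor_formalism S pb S0 D p" and f: "f \<in> Ar S"
      and ch: "push_choice D (cor S pb S0) p (corr_of S f) cs \<and> push_choice D (cor S pb S0) p (corr_op S f) cu \<and>
        pull_choice D (cor S pb S0) p (corr_of S f) zs \<and> f \<in> S0"
    note P = etale[OF assms(5) D f ch[THEN conjunct1] ch[THEN conjunct2, THEN conjunct1]
        ch[THEN conjunct2, THEN conjunct2, THEN conjunct1] ch[THEN conjunct2, THEN conjunct2, THEN conjunct2]]
    show "\<exists>!\<tau>. \<tau> \<in> extensional (fiber_obj D p (Cod S f)) \<and>
        canonical_star_to_shriek S pb (cor S pb S0) D p f cs cu zs \<tau>"
      by (rule P(1))
    fix \<tau> assume "diagonal S pb f \<in> S0" "canonical_star_to_shriek S pb (cor S pb S0) D p f cs cu zs \<tau>"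
    then show "nat_iso (fiber D (cor S pb S0) p (Cod S f)) (fiber D (cor S pb S0) p (Dom S f))
        (push D (cor S pb S0) p (corr_op S f) cu) (pull D (cor S pb S0) p (corr_of S f) zs) \<tau>"
      by (rule P(2))
  next
    fix D :: "('x, 'f, 't) mcat2" and p f cs cu zs
    assume D: "wirthmueller_context S pb D p" and f: "f \<in> Ar S"
      and ch: "push_choice D (cor_G S pb) p (corr_of S f) cs \<and> push_choice D (cor_G S pb) p (corr_op S f) cu \<and>
        pull_choice D (cor_G S pb) p (corr_of S f) zs"
    have "etale_six_functor_formalism S pb (Ar S) D p"
      using D by (simp add: wirthmueller_context_def etale_six_functor_formalism_def cor_G_def)
    note P = etale[OF adm this f, folded cor_G_def, OF ch[THEN conjunct1] ch[THEN conjunct2, THEN conjunct1]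
        ch[THEN conjunct2, THEN conjunct2] f]
    show "\<exists>!\<tau>. \<tau> \<in> extensional (fiber_obj D p (Cod S f)) \<and>
        canonical_star_to_shriek S pb (cor_G S pb) D p f cs cu zs \<tau> \<and>
        nat_iso (fiber D (cor_G S pb) p (Cod S f)) (fiber D (cor_G S pb) p (Dom S f))
          (push D (cor_G S pb) p (corr_op S f) cu) (pull D (cor_G S pb) p (corr_of S f) zs) \<tau>"
      using P(1) P(2)[OF diag[OF f]] by blast
  next
    fix D :: "('x, 'f, 't) mcat2" and p f cs cu zu
    assume D: "grothendieck_context S pb D p" and f: "f \<in> Ar S"
      and ch: "push_choice D (cor_G S pb) p (corr_of S f) cs \<and> push_choice D (cor_G S pb) p (corr_op S f) cu \<and>
        pull_choice D (cor_G S pb) p (corr_op S f) zu"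
    have "proper_six_functor_formalism S pb (Ar S) D p"
      using D by (simp add: grothendieck_context_def proper_six_functor_formalism_def cor_G_def)
    note P = proper[OF adm this f, folded cor_G_def, OF ch[THEN conjunct1] ch[THEN conjunct2, THEN conjunct1]
        ch[THEN conjunct2, THEN conjunct2] diag[OF f]]
    show "\<exists>!\<tau>. \<tau> \<in> extensional (fiber_obj D p (Dom S f)) \<and>
        canonical_shriek_to_star S pb (cor_G S pb) D p f cs cu zu \<tau> \<and>
        nat_iso (fiber D (cor_G S pb) p (Dom S f)) (fiber D (cor_G S pb) p (Cod S f))
          (push D (cor_G S pb) p (corr_of S f) cs) (pull D (cor_G S pb) p (corr_op S f) zu) \<tau>"
      using P(1) P(2)[OF f] by blast
  }
qed

end
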